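(* Suppose that for every $K>4$ the problem $\mathrm{CSP}^{\mathrm{rand},1-\frac{1}{100}}_{n^{K/4}}(\mathrm{XOR}_K)$ is hard. Then there is no efficient learning algorithm with non-trivial performance on the family of $\frac{2}{100}$-almost-realizable distributions on $\{-1,1,0\}^{n}\times\{\pm 1\}$.
   Context: For a distribution $\mathcal D$ on $\{-1,1,0\}^n\times\{\pm1\}$ and $h$, $\mathrm{Err}_{\mathcal D}(h)=\Pr_{(x,y)\sim\mathcal D}(h(x)\ne y)$; $\mathcal D$ is $\eta$-almost-realizable if some halfspace $h_w(x)=\mathrm{sign}(\langle w,x\rangle)$ has $\mathrm{Err}_{\mathcal D}(h_w)\le\eta$. A learning algorithm gets i.i.d. samples from $\mathcal D$ and outputs a polynomial-time-evaluable hypothesis (not necessarily a halfspace), succeeding with constant probability; it is efficient if it runs in polynomial time. Non-trivial performance on a family: for some constant $c>0$ the returned $h$ satisfies $\mathrm{Err}_{\mathcal D}(h)\le\frac12-\frac1{n^c}$ whenever $\mathcal D$ is in the family. Random XOR: a $K$-tuple over $n$ variables is a map $C:\{\pm1\}^n\to\{\pm1\}^K$, $C(\psi)=(\sigma_1\psi_{i_1},\dots,\sigma_K\psi_{i_K})$ with distinct $i_1,\dots,i_K\in[n]$ and signs $\sigma_j\in\{\pm1\}$; $\mathcal X_{n,K}$ is the set of $K$-tuples. A $K$-formula is $J=\{C_1,\dots,C_m\}\subset\mathcal X_{n,K}$; random means independent uniform $C_j$. $\mathrm{XOR}_K$ is parity on $\{\pm1\}^K$; $\mathrm{VAL}_{\mathrm{XOR}}(J)=\max_{\psi}\frac{|\{j:\mathrm{XOR}_K(C_j(\psi))=1\}|}{m}$.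 $\mathrm{CSP}^{\mathrm{rand},1-\eta}_m(\mathrm{XOR}_K)$ is easy if a polynomial-time randomized algorithm outputs "non-random" w.p. $\ge3/4$ whenever $\mathrm{VAL}_{\mathrm{XOR}}(J)\ge1-\eta$, and for random $J$, with probability $1-o_n(1)$ over $J$, outputs "random" w.p. $\ge3/4$; hard otherwise. *)

theory Defs
  imports "HOL-Probability.Probability" "HOL-Computational_Algebra.Polynomial"
begin

section \<open>Model of computation\<close>

text \<open>
  The machine model is the WHILE language over binary trees, a general-purpose imperative language
  with unbounded loops. Every evaluation of an expression is charged the sizes of all the trees it
  touches, including those of subexpressions. Hence there is no gain from sharing, the running time
  bounds the size of everything that is computed, and running times agree with those of
  multi-tape Turing machines up to polynomial overhead in both directions.
\<close>

datatype bintree = Lf | Nd bintree bintree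

datatype expr = Var nat | LfE | NdE expr expr | Left expr | Right expr

datatype com =
    Skip
  | Assign nat expr
  | Seq com com
  | If expr com com
  | While expr com

type_synonym state = "nat \<Rightarrow> bintree"

fun left :: "bintree \<Rightarrow> bintree" where
  "left Lf = Lf"
| "left (Nd l r) = l"

fun right :: "bintree \<Rightarrow> bintree" where
  "right Lf = Lf"
| "right (Nd l r) = r"

fun val :: "expr \<Rightarrow> state \<Rightarrow> bintree" where
  "val (Var v) s = s v"
| "val LfE s = Lf"
| "val (NdE a b) s = Nd (val a s) (val b s)"
| "val (Left a) s = left (val a s)"
| "val (Right a) s = right (val a s)"

text \<open>Here \<open>size t\<close> is the number of inner nodes of \<open>t\<close>.\<close>

fun ecost :: "expr \<Rightarrow> state \<Rightarrow> nat" where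
  "ecost (Var v) s = 1 + size (s v)"
| "ecost LfE s = 1"
| "ecost (NdE a b) s = ecost a s + ecost b s + 1 + size (val (NdE a b) s)"
| "ecost (Left a) s = ecost a s + 1 + size (val (Left a) s)"
| "ecost (Right a) s = ecost a s + 1 + size (val (Right a) s)"

text \<open>
  \<open>exec c s t s'\<close>: started in \<open>s\<close>, the program \<open>c\<close> halts after time exactly \<open>t\<close> in state \<open>s'\<close>.
  A test succeeds iff its value is not \<open>Lf\<close>.
\<close>

inductive exec :: "com \<Rightarrow> state \<Rightarrow> nat \<Rightarrow> state \<Rightarrow> bool" where
  Skip: "exec Skip s 1 s"
| Assign: "exec (Assign v e) s (1 + ecost e s) (s(v := val e s))"
| Seq: "exec c1 s t1 s' \<Longrightarrow> exec c2 s' t2 s'' \<Longrightarrow> exec (Seq c1 c2) s (t1 + t2) s''"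
| IfTrue: "val e s \<noteq> Lf \<Longrightarrow> exec c1 s t s' \<Longrightarrow> exec (If e c1 c2) s (1 + ecost e s + t) s'"
| IfFalse: "val e s = Lf \<Longrightarrow> exec c2 s t s' \<Longrightarrow> exec (If e c1 c2) s (1 + ecost e s + t) s'"
| WhileFalse: "val e s = Lf \<Longrightarrow> exec (While e c) s (1 + ecost e s) s"
| WhileTrue: "val e s \<noteq> Lf \<Longrightarrow> exec c s t1 s' \<Longrightarrow> exec (While e c) s' t2 s'' \<Longrightarrow>
    exec (While e c) s (1 + ecost e s + t1 + t2) s''"

inductive_cases SkipE: "exec Skip s t s'"
inductive_cases AssignE: "exec (Assign v e) s t s'"
inductive_cases SeqE: "exec (Seq c1 c2) s t s'"
inductive_cases IfE: "exec (If e c1 c2) s t s'"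
inductive_cases WhileE: "exec (While e c) s t s'"

lemma exec_deterministic:
  "exec c s t s' \<Longrightarrow> exec c s u s'' \<Longrightarrow> u = t \<and> s'' = s'"
proof (induction arbitrary: u s'' rule: exec.induct)
  case (Skip s)
  then show ?case by (rule SkipE) simp
next
  case (Assign v e s)
  then show ?case by (rule AssignE) simp
next
  case (Seq c1 s t1 s' c2 t2 s2)
  from Seq.prems obtain u1 u2 r where u: "u = u1 + u2" "exec c1 s u1 r" "exec c2 r u2 s''"
    by (rule SeqE)
  from Seq.IH(1)[OF u(2)] Seq.IH(2)[of u2 s''] u show ?case by simp
next
  case (IfTrue e s c1 t s' c2)
  from IfTrue.prems show ?case
    by (rule IfE) (use IfTrue.hyps IfTrue.IH[of "u - (1 + ecost e s)" s''] in simp_all)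
next
  case (IfFalse e s c2 t s' c1)
  from IfFalse.prems show ?case
    by (rule IfE) (use IfFalse.hyps IfFalse.IH[of "u - (1 + ecost e s)" s''] in simp_all)
next
  case (WhileFalse e s c)
  from WhileFalse.prems show ?case
    by (rule WhileE) (use WhileFalse.hyps in simp_all)
next
  case (WhileTrue e s c t1 s' t2 s2)
  from WhileTrue.prems show ?case
  proof (rule WhileE)
    assume "val e s = Lf"
    with WhileTrue.hyps show ?thesis by simp
  next
    fix u1 r u2
    assume u: "u = Suc (ecost e s + u1 + u2)" "exec c s u1 r" "exec (While e c) r u2 s''"
    from WhileTrue.IH(1)[OF u(2)] WhileTrue.IH(2)[of u2 s''] u show ?thesis by simp
  qed
qed

text \<open>Input and output are passed in variable 0; all other variables initially hold \<open>Lf\<close>.\<close>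

definition init :: "bintree \<Rightarrow> state" where
  "init x = (\<lambda>_. Lf)(0 := x)"

definition halts_within :: "com \<Rightarrow> bintree \<Rightarrow> nat \<Rightarrow> bool" where
  "halts_within c x b \<longleftrightarrow> (\<exists>t s. t \<le> b \<and> exec c (init x) t s)"

definition result :: "com \<Rightarrow> bintree \<Rightarrow> bintree" where
  "result c x = (THE y. \<exists>t s. exec c (init x) t s \<and> y = s 0)"

lemma result_eq: "exec c (init x) t s \<Longrightarrow> result c x = s 0"
  unfolding result_def by (rule the_equality) (blast dest: exec_deterministic)+

section \<open>Encodings\<close>

fun enc_nat :: "nat \<Rightarrow> bintree" where
  "enc_nat 0 = Lf"
| "enc_nat (Suc n) = Nd Lf (enc_nat n)"

fun enc_list :: "('a \<Rightarrow> bintree) \<Rightarrow> 'a list \<Rightarrow> bintree" where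
  "enc_list f [] = Lf"
| "enc_list f (x # xs) = Nd (f x) (enc_list f xs)"

definition enc_pair :: "('a \<Rightarrow> bintree) \<Rightarrow> ('b \<Rightarrow> bintree) \<Rightarrow> 'a \<times> 'b \<Rightarrow> bintree" where
  "enc_pair f g = (\<lambda>(a, b). Nd (f a) (g b))"

definition enc_bool :: "bool \<Rightarrow> bintree" where
  "enc_bool b = (if b then Nd Lf Lf else Lf)"

text \<open>Used for the values \<open>-1, 0, 1\<close> only, which are encoded as the unary numbers 0, 1, 2.\<close>

definition enc_trit :: "int \<Rightarrow> bintree" where
  "enc_trit a = enc_nat (nat (a + 1))"

section \<open>Randomized polynomial time\<close>

text \<open>
  A randomized algorithm is a program \<open>c\<close> together with a polynomial \<open>q\<close>: on an input with
  parameter \<open>n\<close> it receives \<open>q(n)\<close> independent fair coin tosses as an auxiliary input.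
\<close>

definition coins :: "nat poly \<Rightarrow> nat \<Rightarrow> bool list pmf" where
  "coins q n = replicate_pmf (poly q n) (pmf_of_set UNIV)"

definition with_coins :: "bintree \<Rightarrow> bool list \<Rightarrow> bintree" where
  "with_coins x r = Nd x (enc_list enc_bool r)"

text \<open>
  \<open>I n\<close> is the set of valid inputs with parameter \<open>n\<close>. Below, \<open>n\<close> is always part of the input in
  unary and the inputs in \<open>I n\<close> have size polynomial in \<open>n\<close>, so that a time bound polynomial in
  \<open>n\<close> is the same as one polynomial in the size of the input.
\<close>

definition rand_poly_time :: "com \<Rightarrow> nat poly \<Rightarrow> (nat \<Rightarrow> bintree set) \<Rightarrow> bool" where
  "rand_poly_time c q I \<longleftrightarrow>
     (\<exists>p :: nat poly. \<forall>n. \<forall>x \<in> I n. \<forall>r. length r = poly q n \<longrightarrow>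
        halts_within c (with_coins x r) (poly p n))"

section \<open>Random XOR\<close>

definition sign_vectors :: "nat \<Rightarrow> int list set" where
  "sign_vectors n = {\<psi>. set \<psi> \<subseteq> {-1, 1} \<and> length \<psi> = n}"

text \<open>
  The \<open>K\<close>-tuple mapping \<open>\<psi>\<close> to \<open>(\<sigma>\<^sub>1\<psi>(i\<^sub>1), \<dots>, \<sigma>\<^sub>K\<psi>(i\<^sub>K))\<close> is represented by the list of
  the pairs \<open>(i\<^sub>j, \<sigma>\<^sub>j)\<close>, which it determines uniquely. Variables are numbered from 0.
\<close>

type_synonym ktuple = "(nat \<times> int) list"

definition ktuples :: "nat \<Rightarrow> nat \<Rightarrow> ktuple set" where
  "ktuples n K = {C. length C = K \<and> distinct (map fst C) \<and> set C \<subseteq> {..<n} \<times> {-1, 1}}"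

definition apply_ktuple :: "ktuple \<Rightarrow> int list \<Rightarrow> int list" where
  "apply_ktuple C \<psi> = map (\<lambda>(i, \<sigma>). \<sigma> * \<psi> ! i) C"

definition XOR :: "int list \<Rightarrow> int" where
  "XOR z = prod_list z"

definition formulas :: "nat \<Rightarrow> nat \<Rightarrow> nat \<Rightarrow> ktuple list set" where
  "formulas n K m = {J. set J \<subseteq> ktuples n K \<and> length J = m}"

definition random_formula :: "nat \<Rightarrow> nat \<Rightarrow> nat \<Rightarrow> ktuple list pmf" where
  "random_formula n K m = replicate_pmf m (pmf_of_set (ktuples n K))"

definition VAL_XOR :: "nat \<Rightarrow> ktuple list \<Rightarrow> real" where
  "VAL_XOR n J = Max ((\<lambda>\<psi>. real (card {j. j < length J \<and> XOR (apply_ktuple (J ! j) \<psi>) = 1})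
                            / real (length J)) ` sign_vectors n)"

definition enc_formula :: "nat \<Rightarrow> ktuple list \<Rightarrow> bintree" where
  "enc_formula n J =
     Nd (enc_nat n) (enc_list (enc_list (enc_pair enc_nat enc_trit)) J)"

text \<open>The output \<open>Lf\<close> means ``random'', every other output means ``non-random''.\<close>

definition prob_random :: "com \<Rightarrow> nat poly \<Rightarrow> nat \<Rightarrow> ktuple list \<Rightarrow> real" where
  "prob_random c q n J =
     measure_pmf.prob (coins q n) {r. result c (with_coins (enc_formula n J) r) = Lf}"

definition prob_nonrandom :: "com \<Rightarrow> nat poly \<Rightarrow> nat \<Rightarrow> ktuple list \<Rightarrow> real" where
  "prob_nonrandom c q n J =
     measure_pmf.prob (coins q n) {r. result c (with_coins (enc_formula n J) r) \<noteq> Lf}"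

text \<open>
  The problem \<open>CSP\<close> with random formulas, \<open>m n\<close> constraints and value at least \<open>\<alpha>\<close>; the number of
  constraints \<open>m\<close> is meant to be polynomially bounded.
\<close>

definition CSP_XOR_easy :: "real \<Rightarrow> (nat \<Rightarrow> nat) \<Rightarrow> nat \<Rightarrow> bool" where
  "CSP_XOR_easy \<alpha> m K \<longleftrightarrow>
     (\<exists>c q.
        rand_poly_time c q (\<lambda>n. enc_formula n ` formulas n K (m n)) \<and>
        (\<forall>n. \<forall>J \<in> formulas n K (m n). VAL_XOR n J \<ge> \<alpha> \<longrightarrow> prob_nonrandom c q n J \<ge> 3 / 4) \<and>
        (\<lambda>n. measure_pmf.prob (random_formula n K (m n)) {J. prob_random c q n J \<ge> 3 / 4})
          \<longlonglongrightarrow> 1)"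

definition CSP_XOR_hard :: "real \<Rightarrow> (nat \<Rightarrow> nat) \<Rightarrow> nat \<Rightarrow> bool" where
  "CSP_XOR_hard \<alpha> m K \<longleftrightarrow> \<not> CSP_XOR_easy \<alpha> m K"

section \<open>Learning halfspaces\<close>

definition instances :: "nat \<Rightarrow> int list set" where
  "instances n = {x. set x \<subseteq> {-1, 1, 0} \<and> length x = n}"

definition examples :: "nat \<Rightarrow> (int list \<times> int) set" where
  "examples n = instances n \<times> {-1, 1}"

definition Err :: "(int list \<times> int) pmf \<Rightarrow> (int list \<Rightarrow> real) \<Rightarrow> real" where
  "Err D h = measure_pmf.prob D {(x, y). h x \<noteq> real_of_int y}"

text \<open>
  As \<open>sgn 0 = 0\<close>, points on the separating hyperplane count as misclassified. This makes the
  family of almost-realizable distributions at most as large as with \<open>sign 0 = 1\<close> or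
  \<open>sign 0 = -1\<close>, so the resulting lower bound covers these conventions as well.
\<close>

definition halfspace :: "(nat \<Rightarrow> real) \<Rightarrow> int list \<Rightarrow> real" where
  "halfspace w x = sgn (\<Sum>i<length x. w i * real_of_int (x ! i))"

definition almost_realizable :: "real \<Rightarrow> nat \<Rightarrow> (int list \<times> int) pmf set" where
  "almost_realizable \<eta> n =
     {D. set_pmf D \<subseteq> examples n \<and> (\<exists>w. Err D (halfspace w) \<le> \<eta>)}"

text \<open>
  A learning algorithm is given by a randomized algorithm \<open>(L, q)\<close>, a polynomial \<open>d\<close> and a
  deterministic evaluator \<open>E\<close>. In dimension \<open>n\<close>, \<open>L\<close> receives \<open>d(n)\<close> independent examples and
  outputs an arbitrary description \<open>z\<close> of a hypothesis, whose value at \<open>x\<close> is the result of running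
  \<open>E\<close> on \<open>z\<close> and \<open>x\<close>; the output \<open>Lf\<close> is the label \<open>-1\<close>, every other output is the label \<open>1\<close>.
\<close>

definition enc_vec :: "int list \<Rightarrow> bintree" where
  "enc_vec = enc_list enc_trit"

definition enc_sample :: "nat \<Rightarrow> (int list \<times> int) list \<Rightarrow> bintree" where
  "enc_sample n S = Nd (enc_nat n) (enc_list (enc_pair enc_vec enc_trit) S)"

definition samples :: "nat poly \<Rightarrow> nat \<Rightarrow> (int list \<times> int) list set" where
  "samples d n = {S. set S \<subseteq> examples n \<and> length S = poly d n}"

definition hypothesis :: "com \<Rightarrow> bintree \<Rightarrow> int list \<Rightarrow> real" where
  "hypothesis E z x = (if result E (Nd z (enc_vec x)) = Lf then -1 else 1)"

definition efficient :: "com \<Rightarrow> nat poly \<Rightarrow> nat poly \<Rightarrow> com \<Rightarrow> bool" where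
  "efficient L q d E \<longleftrightarrow>
     rand_poly_time L q (\<lambda>n. enc_sample n ` samples d n) \<and>
     (\<exists>p :: nat poly. \<forall>n. \<forall>S \<in> samples d n. \<forall>r. length r = poly q n \<longrightarrow>
        (\<forall>x \<in> instances n.
           halts_within E (Nd (result L (with_coins (enc_sample n S) r)) (enc_vec x)) (poly p n)))"

definition learned ::
  "com \<Rightarrow> nat poly \<Rightarrow> nat poly \<Rightarrow> com \<Rightarrow> nat \<Rightarrow> (int list \<times> int) pmf \<Rightarrow> (int list \<Rightarrow> real) pmf" where
  "learned L q d E n D =
     map_pmf (\<lambda>(S, r). hypothesis E (result L (with_coins (enc_sample n S) r)))
       (pair_pmf (replicate_pmf (poly d n) D) (coins q n))"

text \<open>
  The requirement is imposed for all large \<open>n\<close> only: for \<open>n = 1\<close> the bound \<open>1/2 - 1/n\<^sup>c\<close> is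
  negative and can never be met. The success probability \<open>\<delta>\<close> is an arbitrary positive constant.
\<close>

definition nontrivial_performance ::
  "com \<Rightarrow> nat poly \<Rightarrow> nat poly \<Rightarrow> com \<Rightarrow> (nat \<Rightarrow> (int list \<times> int) pmf set) \<Rightarrow> bool" where
  "nontrivial_performance L q d E F \<longleftrightarrow>
     (\<exists>c > 0. \<exists>\<delta> > 0. \<forall>\<^sub>F n in sequentially. \<forall>D \<in> F n.
        measure_pmf.prob (learned L q d E n D) {h. Err D h \<le> 1 / 2 - 1 / real n powr c} \<ge> \<delta>)"

end

theory Submission
  imports Defs
begin

text \<open>
  From a formula \<open>J\<close> one draws labelled examples as follows: pick a random tuple \<open>C\<close> of \<open>J\<close> and
  random signs \<open>\<tau> \<in> {\<plusminus>1}\<^sup>K\<close>, flip the signs of \<open>C\<close> by \<open>\<tau>\<close>, and attach the label \<open>\<Prod>\<tau>\<close>. If \<open>\<psi>\<close>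
  satisfies \<open>C\<close>, then the label is the parity of the vector \<open>\<tau> C(\<psi>)\<close>, which is uniform on \<open>{\<plusminus>1}\<^sup>K\<close>;
  hence its sum \<open>s\<close> is \<open>O(\<surd>K)\<close> with probability close to 1, and on this range the parity is the sign
  of a polynomial of degree \<open>D = O(\<surd>K)\<close> in \<open>s\<close> with roots at the odd integers. As \<open>s\<close> is linear in
  the \<open>{-1, 0, 1}\<close>-vector of the flipped tuple, this is a halfspace over the \<open>D\<close>-th tensor power, of
  dimension \<open>N = (n + 1)\<^sup>D\<close>. So if almost all constraints are satisfiable, then the examples are
  almost realizable and the learner succeeds. If \<open>J\<close> is random, then examples from distinct tuples
  carry labels that are independent of everything else, and no hypothesis can predict them. Fresh
  examples distinguish the two cases. For \<open>K\<close> large the \<open>n\<^bsup>K/4\<^esup>\<close> tuples of \<open>J\<close> outnumber the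
  polynomially many (in \<open>N\<close>) examples that are drawn, so that repeated tuples are unlikely.
\<close>

section \<open>Polynomial-time computable functions\<close>

text \<open>The dimension N = (n + 1)^D depends on K, so it is not obvious that n^(K/4) beats every
  polynomial in N. It does because D grows only like the square root of K: with
  \<open>K = 8 * a^2\<close>, \<open>D = 40 * a\<close> and about N^e examples, repeated tuples are
  rare once n^(2 D e) = n^(80 a e) is small against n^(K/4) = n^(2 a^2), that is, for a > 40 e. The
  factor 40 makes Chebyshev's bound K / (40 a)^2 equal to 1/200. The hardness assumption concerns
  programs, so the reduction has to be a program too; a predicate closed under composition,
  branching and bounded loops spares its explicit construction. The learner may be run on random
  formulas because efficiency is demanded for all samples, also for those that no halfspace fits. As
  it succeeds with some constant probability only, a constant number of independent trials is made
  and a single success counts; on a random formula a trial succeeds with probability O(1/n) on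
  average, so the repetition does no harm.\<close>

fun ebnd :: "expr \<Rightarrow> nat" where
  "ebnd (Var v) = Suc v"
| "ebnd LfE = 0"
| "ebnd (NdE a b) = max (ebnd a) (ebnd b)"
| "ebnd (Left a) = ebnd a"
| "ebnd (Right a) = ebnd a"

fun cbnd :: "com \<Rightarrow> nat" where
  "cbnd Skip = 0"
| "cbnd (Assign v e) = max (Suc v) (ebnd e)"
| "cbnd (Seq c d) = max (cbnd c) (cbnd d)"
| "cbnd (If e c d) = max (ebnd e) (max (cbnd c) (cbnd d))"
| "cbnd (While e c) = max (ebnd e) (cbnd c)"

lemma val_cong: "(\<And>v. v < ebnd e \<Longrightarrow> s v = s' v) \<Longrightarrow> val e s = val e s'"
  by (induction e) auto

lemma ecost_cong: "(\<And>v. v < ebnd e \<Longrightarrow> s v = s' v) \<Longrightarrow> ecost e s = ecost e s'"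
proof (induction e)
  case (NdE a b)
  have "ecost a s = ecost a s'" "ecost b s = ecost b s'" using NdE by auto
  moreover have "val a s = val a s'" "val b s = val b s'"
    using NdE.prems by (auto intro!: val_cong)
  ultimately show ?case by simp
next
  case (Left a)
  have "ecost a s = ecost a s'" using Left by auto
  moreover have "val a s = val a s'" using Left.prems by (auto intro!: val_cong)
  ultimately show ?case by simp
next
  case (Right a)
  have "ecost a s = ecost a s'" using Right by auto
  moreover have "val a s = val a s'" using Right.prems by (auto intro!: val_cong)
  ultimately show ?case by simp
qed auto

text \<open>Variables from \<open>cbnd c\<close> on are neither read nor written, so a run depends
  on the lower part of the state only. A program can thus serve as a subroutine while its caller
  keeps data in higher variables.\<close>

lemma exec_frame:
  "exec c s t s' \<Longrightarrow> cbnd c \<le> b \<Longrightarrow> (\<And>v. v < b \<Longrightarrow> s1 v = s v) \<Longrightarrow>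
    exec c s1 t (\<lambda>v. if v < b then s' v else s1 v)"
proof (induction arbitrary: s1 rule: exec.induct)
  case (Skip s)
  then have "(\<lambda>v. if v < b then s v else s1 v) = s1" by auto
  then show ?case using exec.Skip[of s1] by simp
next
  case (Assign v e s)
  have "val e s1 = val e s" "ecost e s1 = ecost e s"
    by (rule val_cong ecost_cong; use Assign.prems in auto)+
  moreover have "(\<lambda>w. if w < b then (s(v := val e s)) w else s1 w) = s1(v := val e s)"
    using Assign by auto
  ultimately show ?case using exec.Assign[of v e s1] by simp
next
  case (Seq c1 s t1 s' c2 t2 s'')
  let ?m = "\<lambda>v. if v < b then s' v else s1 v"
  have "exec c1 s1 t1 ?m" using Seq by auto
  moreover have "exec c2 ?m t2 (\<lambda>v. if v < b then s'' v else ?m v)"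
    using Seq by (intro Seq.IH) auto
  moreover have "(\<lambda>v. if v < b then s'' v else ?m v) = (\<lambda>v. if v < b then s'' v else s1 v)"
    by auto
  ultimately show ?case by (auto intro: exec.Seq)
next
  case (IfTrue e s c1 t s' c2)
  have "val e s1 = val e s" "ecost e s1 = ecost e s"
    by (rule val_cong ecost_cong; use IfTrue.prems in auto)+
  moreover have "exec c1 s1 t (\<lambda>v. if v < b then s' v else s1 v)" using IfTrue by auto
  ultimately show ?case using IfTrue.hyps exec.IfTrue[of e s1 c1 t _ c2] by metis
next
  case (IfFalse e s c2 t s' c1)
  have "val e s1 = val e s" "ecost e s1 = ecost e s"
    by (rule val_cong ecost_cong; use IfFalse.prems in auto)+
  moreover have "exec c2 s1 t (\<lambda>v. if v < b then s' v else s1 v)" using IfFalse by auto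
  ultimately show ?case using IfFalse.hyps exec.IfFalse[of e s1 c2 t _ c1] by metis
next
  case (WhileFalse e s c)
  have "val e s1 = val e s" "ecost e s1 = ecost e s"
    by (rule val_cong ecost_cong; use WhileFalse.prems in auto)+
  moreover have "(\<lambda>v. if v < b then s v else s1 v) = s1" using WhileFalse by auto
  ultimately show ?case using WhileFalse exec.WhileFalse[of e s1 c] by auto
next
  case (WhileTrue e s c t1 s' t2 s'')
  let ?m = "\<lambda>v. if v < b then s' v else s1 v"
  have "val e s1 = val e s" "ecost e s1 = ecost e s"
    by (rule val_cong ecost_cong; use WhileTrue.prems in auto)+
  moreover have "exec c s1 t1 ?m" using WhileTrue by auto
  moreover have "exec (While e c) ?m t2 (\<lambda>v. if v < b then s'' v else ?m v)"
    using WhileTrue by (intro WhileTrue.IH) auto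
  moreover have "(\<lambda>v. if v < b then s'' v else ?m v) = (\<lambda>v. if v < b then s'' v else s1 v)"
    by auto
  ultimately show ?case using WhileTrue.hyps exec.WhileTrue[of e s1 c t1 ?m t2] by auto
qed

lemma size_val_le_ecost: "size (val e s) \<le> ecost e s"
  by (cases e) auto

text \<open>The cost of an assignment includes the size of the assigned value. Polynomial time
  therefore yields polynomial size of the output, and compositions need no separate size
  bounds.\<close>

lemma exec_size: "exec c s t s' \<Longrightarrow> size (s' v) \<le> t + size (s v)"
proof (induction rule: exec.induct)
  case (Assign w e s)
  then show ?case using size_val_le_ecost[of e s] by auto
qed auto

fun clean :: "nat \<Rightarrow> com" where
  "clean 0 = Skip"
| "clean (Suc b) = Seq (clean b) (Assign (Suc b) LfE)"

lemma exec_clean: "exec (clean b) s (1 + 2 * b) (\<lambda>v. if 1 \<le> v \<and> v \<le> b then Lf else s v)"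
proof (induction b)
  case 0
  have "(\<lambda>v. if 1 \<le> v \<and> v \<le> 0 then Lf else s v) = s" by auto
  then show ?case using exec.Skip[of s] by simp
next
  case (Suc b)
  let ?s = "\<lambda>v. if 1 \<le> v \<and> v \<le> b then Lf else s v"
  have "exec (clean (Suc b)) s (1 + 2 * b + (1 + ecost LfE ?s)) (?s(Suc b := val LfE ?s))"
    unfolding clean.simps by (rule exec.Seq[OF Suc exec.Assign])
  moreover have "?s(Suc b := val LfE ?s) = (\<lambda>v. if 1 \<le> v \<and> v \<le> Suc b then Lf else s v)"
    by auto
  ultimately show ?case by simp
qed

text \<open>If the data of the caller are in variables above \<open>b\<close> and those from 1 to \<open>b\<close> are empty, then
  \<open>c\<close> runs as from its initial state, and the same situation holds again afterwards.\<close>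

definition call :: "com \<Rightarrow> nat \<Rightarrow> com" where
  "call c b = Seq c (clean b)"

lemma exec_call:
  assumes "exec c (init x) t s" "cbnd c \<le> Suc b" "s1 0 = x" "\<And>v. 1 \<le> v \<Longrightarrow> v \<le> b \<Longrightarrow> s1 v = Lf"
  shows "exec (call c b) s1 (t + (1 + 2 * b)) (s1(0 := s 0))"
proof -
  have "exec c s1 t (\<lambda>v. if v < Suc b then s v else s1 v)"
    using assms by (intro exec_frame[OF assms(1)]) (auto simp: init_def)
  moreover have "(\<lambda>v. if 1 \<le> v \<and> v \<le> b then Lf else (if v < Suc b then s v else s1 v)) = s1(0 := s 0)"
    using assms by (auto simp: fun_eq_iff)
  ultimately show ?thesis unfolding call_def
    using exec_clean[of b "\<lambda>v. if v < Suc b then s v else s1 v"] by (metis exec.Seq)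
qed

section \<open>Polynomial bounds in the size of the encoded input\<close>

definition pbounded :: "'a set \<Rightarrow> ('a \<Rightarrow> bintree) \<Rightarrow> ('a \<Rightarrow> nat) \<Rightarrow> bool" where
  "pbounded X e g \<longleftrightarrow> (\<exists>p :: nat poly. \<forall>x\<in>X. g x \<le> poly p (size (e x)))"

lemma poly_nat_mono: "(m :: nat) \<le> n \<Longrightarrow> poly p m \<le> poly p n"
  by (induction p) (auto intro!: add_mono mult_mono)

lemma pbounded_const: "pbounded X e (\<lambda>_. k)"
  unfolding pbounded_def by (rule exI[of _ "[:k:]"]) auto

lemma pbounded_size: "pbounded X e (\<lambda>x. size (e x))"
  unfolding pbounded_def by (rule exI[of _ "[:0,1:]"]) auto

lemma pbounded_add: "pbounded X e f \<Longrightarrow> pbounded X e g \<Longrightarrow> pbounded X e (\<lambda>x. f x + g x)"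
  unfolding pbounded_def
proof (elim exE)
  fix p q :: "nat poly"
  assume "\<forall>x\<in>X. f x \<le> poly p (size (e x))" "\<forall>x\<in>X. g x \<le> poly q (size (e x))"
  then show "\<exists>p. \<forall>x\<in>X. f x + g x \<le> poly p (size (e x))"
    by (intro exI[of _ "p + q"]) (auto intro: add_mono)
qed

lemma pbounded_mult: "pbounded X e f \<Longrightarrow> pbounded X e g \<Longrightarrow> pbounded X e (\<lambda>x. f x * g x)"
  unfolding pbounded_def
proof (elim exE)
  fix p q :: "nat poly"
  assume "\<forall>x\<in>X. f x \<le> poly p (size (e x))" "\<forall>x\<in>X. g x \<le> poly q (size (e x))"
  then show "\<exists>p. \<forall>x\<in>X. f x * g x \<le> poly p (size (e x))"
    by (intro exI[of _ "p * q"]) (auto intro: mult_mono)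
qed

lemma pbounded_poly: "pbounded X e f \<Longrightarrow> pbounded X e (\<lambda>x. poly p (f x))"
  unfolding pbounded_def
proof (elim exE)
  fix q :: "nat poly"
  assume "\<forall>x\<in>X. f x \<le> poly q (size (e x))"
  then show "\<exists>q. \<forall>x\<in>X. poly p (f x) \<le> poly q (size (e x))"
    by (intro exI[of _ "pcompose p q"]) (auto simp: poly_pcompose intro: poly_nat_mono)
qed

lemma pbounded_mono: "pbounded X e g \<Longrightarrow> (\<And>x. x \<in> Y \<Longrightarrow> x \<in> X \<and> f x \<le> g x) \<Longrightarrow> pbounded Y e f"
  unfolding pbounded_def by (meson order_trans)

text \<open>The sum of the two polynomials serves both cases, as their maximum need not be a
  polynomial. Each bound is required on its own part of the domain only.\<close>

lemma pbounded_if: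
  assumes "pbounded {x \<in> X. P x} e f" "pbounded {x \<in> X. \<not> P x} e g"
  shows "pbounded X e (\<lambda>x. if P x then f x else g x)"
proof -
  obtain p q where "\<forall>x\<in>{x \<in> X. P x}. f x \<le> poly p (size (e x))"
    "\<forall>x\<in>{x \<in> X. \<not> P x}. g x \<le> poly q (size (e x))"
    using assms unfolding pbounded_def by auto
  then show ?thesis
    unfolding pbounded_def by (intro exI[of _ "p + q"]) (auto intro: trans_le_add1 trans_le_add2)
qed

text \<open>Bounds are taken in the size of an encoding, so a bound under \<open>e'\<close> turns
  into one under \<open>e\<close> as soon as the encoded image has polynomial size.\<close>

lemma pbounded_comp:
  assumes "pbounded Y e' g" "pbounded X e (\<lambda>x. size (e' (h x)))" "\<And>x. x \<in> X \<Longrightarrow> h x \<in> Y"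
  shows "pbounded X e (\<lambda>x. g (h x))"
proof -
  obtain p where p: "\<forall>y\<in>Y. g y \<le> poly p (size (e' y))" using assms(1) by (auto simp: pbounded_def)
  show ?thesis
    by (rule pbounded_mono[OF pbounded_poly[OF assms(2), of p]]) (use p assms(3) in auto)
qed

lemmas pbounded_intros = pbounded_const pbounded_size pbounded_add pbounded_mult pbounded_poly

text \<open>The program has to be correct and fast on the inputs \<open>e x\<close> with \<open>x \<in> X\<close> only: the learner
  and its evaluator may diverge elsewhere.\<close>

definition ptime :: "'a set \<Rightarrow> ('a \<Rightarrow> bintree) \<Rightarrow> ('a \<Rightarrow> bintree) \<Rightarrow> bool" where
  "ptime X e f \<longleftrightarrow> (\<exists>c T. pbounded X e T \<and>
     (\<forall>x\<in>X. \<exists>t s. exec c (init (e x)) t s \<and> s 0 = f x \<and> t \<le> T x))"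

section \<open>Closure of polynomial time under composition, pairing and branching\<close>

lemma ptI:
  assumes "pbounded X e T" "\<And>x. x \<in> X \<Longrightarrow> \<exists>t s. exec c (init (e x)) t s \<and> s 0 = f x \<and> t \<le> T x"
  shows "ptime X e f"
  using assms unfolding ptime_def by blast

lemma ptE:
  assumes "ptime X e f"
  obtains c T where "pbounded X e T" "\<And>x. x \<in> X \<Longrightarrow> \<exists>t s. exec c (init (e x)) t s \<and> s 0 = f x \<and> t \<le> T x"
  using assms unfolding ptime_def by blast

lemma ptime_size:
  assumes "ptime X e f"
  shows "pbounded X e (\<lambda>x. size (f x))"
proof -
  obtain c T where T: "pbounded X e T"
    "\<And>x. x \<in> X \<Longrightarrow> \<exists>t s. exec c (init (e x)) t s \<and> s 0 = f x \<and> t \<le> T x"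
    by (rule ptE[OF assms]) (rule that; assumption)
  have "size (f x) \<le> T x + size (e x)" if x: "x \<in> X" for x
  proof -
    obtain t s where ts: "exec c (init (e x)) t s" "s 0 = f x" "t \<le> T x"
      using T(2)[OF x] by auto
    then show ?thesis using exec_size[OF ts(1), of 0] by (simp add: init_def)
  qed
  then show ?thesis
    by (intro pbounded_mono[OF pbounded_add[OF T(1) pbounded_size]]) auto
qed

lemma ptime_cong: "ptime X e f \<Longrightarrow> (\<And>x. x \<in> Y \<Longrightarrow> x \<in> X \<and> e x = e' x \<and> f x = f' x) \<Longrightarrow> ptime Y e' f'"
  unfolding ptime_def pbounded_def by metis

lemma ptime_subset: "ptime X e f \<Longrightarrow> Y \<subseteq> X \<Longrightarrow> ptime Y e f"
  by (erule ptime_cong) auto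

lemma ptime_expr:
  assumes "pbounded X e (\<lambda>x. ecost a (init (e x)))"
  shows "ptime X e (\<lambda>x. val a (init (e x)))"
proof (rule ptI)
  show "pbounded X e (\<lambda>x. 1 + ecost a (init (e x)))" by (intro pbounded_intros assms)
  show "\<exists>t s. exec (Assign 0 a) (init (e x)) t s \<and> s 0 = val a (init (e x)) \<and>
      t \<le> 1 + ecost a (init (e x))" for x
    using exec.Assign[of 0 a "init (e x)"] by fastforce
qed

lemma ptime_id: "ptime X e e"
  using ptime_expr[of X e "Var 0"]
  by (simp add: init_def pbounded_size pbounded_const pbounded_add[OF pbounded_const[of _ _ 1], simplified])

text \<open>The time of the second program is polynomial in the size of the intermediate value,
  which is polynomial in the input by \<open>ptime_size\<close>. The domain \<open>Y\<close> admits
  a second program that is only known to halt on certain inputs.\<close>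

lemma ptime_comp:
  assumes "ptime Y e' g" "ptime X e (\<lambda>x. e' (h x))" "\<And>x. x \<in> X \<Longrightarrow> h x \<in> Y"
  shows "ptime X e (\<lambda>x. g (h x))"
proof -
  obtain c T where T: "pbounded Y e' T"
    "\<And>x. x \<in> Y \<Longrightarrow> \<exists>t s. exec c (init (e' x)) t s \<and> s 0 = g x \<and> t \<le> T x"
    by (rule ptE[OF assms(1)]) (rule that; assumption)
  obtain d U where U: "pbounded X e U"
    "\<And>x. x \<in> X \<Longrightarrow> \<exists>t s. exec d (init (e x)) t s \<and> s 0 = e' (h x) \<and> t \<le> U x"
    by (rule ptE[OF assms(2)]) (rule that; assumption)
  define b where "b = cbnd d"
  show ?thesis
  proof (rule ptI)
    show "pbounded X e (\<lambda>x. (U x + (1 + 2 * b)) + T (h x))"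
      by (intro pbounded_intros U(1) pbounded_comp[OF T(1) ptime_size[OF assms(2)] assms(3)])
    show "\<exists>t s. exec (Seq (call d b) c) (init (e x)) t s \<and> s 0 = g (h x) \<and>
       t \<le> (U x + (1 + 2 * b)) + T (h x)" if x: "x \<in> X" for x
    proof -
      obtain t s where ts: "exec d (init (e x)) t s" "s 0 = e' (h x)" "t \<le> U x"
        using U(2)[OF x] by auto
      obtain u r where ur: "exec c (init (e' (h x))) u r" "r 0 = g (h x)" "u \<le> T (h x)"
        using T(2)[OF assms(3)[OF x]] by auto
      have "exec (call d b) (init (e x)) (t + (1 + 2 * b)) ((init (e x))(0 := s 0))"
        by (rule exec_call[OF ts(1)]) (auto simp: b_def init_def)
      moreover have "(init (e x))(0 := s 0) = init (e' (h x))"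
        using ts(2) by (auto simp: init_def)
      ultimately have "exec (Seq (call d b) c) (init (e x)) ((t + (1 + 2 * b)) + u) r"
        using ur(1) by (metis exec.Seq)
      then show ?thesis using ts ur by (intro exI[of _ "(t + (1 + 2 * b)) + u"] exI[of _ r]) auto
    qed
  qed
qed

lemma ptime_left: "ptime X e f \<Longrightarrow> ptime X e (\<lambda>x. left (f x))"
proof (rule ptime_comp[where h = f and Y = UNIV and e' = "\<lambda>x. x"])
  have "size (left t) \<le> size t" for t by (cases t) auto
  then have "pbounded UNIV (\<lambda>x. x) (\<lambda>x. ecost (Left (Var 0)) (init x))"
    by (intro pbounded_mono[OF pbounded_add[OF pbounded_add[OF pbounded_size pbounded_size] pbounded_const[of _ _ 2]]])
       (auto simp: init_def)
  from ptime_expr[OF this] show "ptime UNIV (\<lambda>x. x) left" by (simp add: init_def)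
qed auto

lemma ptime_right: "ptime X e f \<Longrightarrow> ptime X e (\<lambda>x. right (f x))"
proof (rule ptime_comp[where h = f and Y = UNIV and e' = "\<lambda>x. x"])
  have "size (right t) \<le> size t" for t by (cases t) auto
  then have "pbounded UNIV (\<lambda>x. x) (\<lambda>x. ecost (Right (Var 0)) (init x))"
    by (intro pbounded_mono[OF pbounded_add[OF pbounded_add[OF pbounded_size pbounded_size] pbounded_const[of _ _ 2]]])
       (auto simp: init_def)
  from ptime_expr[OF this] show "ptime UNIV (\<lambda>x. x) right" by (simp add: init_def)
qed auto

fun quote_expr :: "bintree \<Rightarrow> expr" where
  "quote_expr Lf = LfE"
| "quote_expr (Nd l r) = NdE (quote_expr l) (quote_expr r)"

lemma val_quote_expr: "val (quote_expr t) s = t"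
  by (induction t) auto

lemma ptime_const: "ptime X e (\<lambda>_. t)"
proof -
  have "ecost (quote_expr t) s = ecost (quote_expr t) (init Lf)" for s
    by (induction t) (auto simp: val_quote_expr)
  then have "(\<lambda>x. ecost (quote_expr t) (init (e x))) = (\<lambda>x. ecost (quote_expr t) (init Lf))"
    by blast
  then have "pbounded X e (\<lambda>x. ecost (quote_expr t) (init (e x)))"
    using pbounded_const by metis
  from ptime_expr[OF this] show ?thesis by (simp add: val_quote_expr)
qed

lemma ptime_Nd:
  assumes "ptime X e f" "ptime X e g"
  shows "ptime X e (\<lambda>x. Nd (f x) (g x))"
proof -
  obtain c T where T: "pbounded X e T"
    "\<And>x. x \<in> X \<Longrightarrow> \<exists>t s. exec c (init (e x)) t s \<and> s 0 = f x \<and> t \<le> T x"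
    by (rule ptE[OF assms(1)]) (rule that; assumption)
  obtain d U where U: "pbounded X e U"
    "\<And>x. x \<in> X \<Longrightarrow> \<exists>t s. exec d (init (e x)) t s \<and> s 0 = g x \<and> t \<le> U x"
    by (rule ptE[OF assms(2)]) (rule that; assumption)
  define b where "b = max (cbnd c) (cbnd d)"
  \<comment> \<open>The input is kept in variable \<open>b+1\<close> and the first result in
    \<open>b+2\<close>, out of reach of both subroutines.\<close>
  define P where "P = Seq (Assign (b+1) (Var 0)) (Seq (call c b) (Seq (Assign (b+2) (Var 0))
    (Seq (Assign 0 (Var (b+1))) (Seq (call d b) (Assign 0 (NdE (Var (b+2)) (Var 0)))))))"
  show ?thesis
  proof (rule ptI)
    show "pbounded X e (\<lambda>x. 20 + 4 * b + 3 * size (e x) + T x + U x + 4 * size (f x) + 4 * size (g x))"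
      by (intro pbounded_intros U(1) T(1) ptime_size assms)
    show "\<exists>t s. exec P (init (e x)) t s \<and> s 0 = Nd (f x) (g x) \<and>
       t \<le> 20 + 4 * b + 3 * size (e x) + T x + U x + 4 * size (f x) + 4 * size (g x)"
      if x: "x \<in> X" for x
    proof -
      obtain t s where ts: "exec c (init (e x)) t s" "s 0 = f x" "t \<le> T x"
        using T(2)[OF x] by auto
      obtain u r where ur: "exec d (init (e x)) u r" "r 0 = g x" "u \<le> U x"
        using U(2)[OF x] by auto
      define s0 where "s0 = init (e x)"
      define s1 where "s1 = s0(b+1 := val (Var 0) s0)"
      define s2 where "s2 = s1(0 := s 0)"
      define s3 where "s3 = s2(b+2 := val (Var 0) s2)"
      define s4 where "s4 = s3(0 := val (Var (b+1)) s3)"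
      define s5 where "s5 = s4(0 := r 0)"
      note defs = s0_def s1_def s2_def s3_def s4_def s5_def
      have 2: "exec (call c b) s1 (t + (1 + 2 * b)) s2" unfolding s2_def
        by (rule exec_call[OF ts(1)]) (auto simp: b_def defs init_def)
      have 5: "exec (call d b) s4 (u + (1 + 2 * b)) s5" unfolding s5_def
        by (rule exec_call[OF ur(1)]) (auto simp: b_def defs init_def)
      note 1 = exec.Assign[of "b+1" "Var 0" s0, folded s1_def]
      note 3 = exec.Assign[of "b+2" "Var 0" s2, folded s3_def]
      note 4 = exec.Assign[of 0 "Var (b+1)" s3, folded s4_def]
      note 6 = exec.Assign[of 0 "NdE (Var (b+2)) (Var 0)" s5]
      note seqs = exec.Seq[OF 1 exec.Seq[OF 2 exec.Seq[OF 3 exec.Seq[OF 4 exec.Seq[OF 5 6]]]]]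
      define t' where "t' = (1 + ecost (Var 0) s0) + ((t + (1 + 2 * b)) + ((1 + ecost (Var 0) s2) +
            ((1 + ecost (Var (b+1)) s3) + ((u + (1 + 2 * b)) + (1 + ecost (NdE (Var (b+2)) (Var 0)) s5)))))"
      define s' where "s' = s5(0 := val (NdE (Var (b+2)) (Var 0)) s5)"
      have *: "exec P (init (e x)) t' s'"
        using seqs unfolding P_def s0_def[symmetric] t'_def s'_def .
      note * = * s'_def t'_def
      have "s' 0 = Nd (f x) (g x)" using * ts ur by (simp add: defs)
      moreover have "t' \<le> 20 + 4 * b + 3 * size (e x) + T x + U x + 4 * size (f x) + 4 * size (g x)"
        using * ts ur by (simp add: defs init_def)
      ultimately show ?thesis using *(1) by blast
    qed
  qed
qed

text \<open>Each branch has to be correct and fast only on the inputs that reach it, so a test can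
  guard a program that may diverge elsewhere.\<close>

lemma ptime_if:
  assumes "ptime X e B" "ptime {x \<in> X. B x \<noteq> Lf} e f" "ptime {x \<in> X. B x = Lf} e g"
  shows "ptime X e (\<lambda>x. if B x \<noteq> Lf then f x else g x)"
proof -
  obtain a A where A: "pbounded X e A"
    "\<And>x. x \<in> X \<Longrightarrow> \<exists>t s. exec a (init (e x)) t s \<and> s 0 = B x \<and> t \<le> A x"
    by (rule ptE[OF assms(1)]) (rule that; assumption)
  obtain c T where T: "pbounded {x \<in> X. B x \<noteq> Lf} e T"
    "\<And>x. x \<in> {x \<in> X. B x \<noteq> Lf} \<Longrightarrow> \<exists>t s. exec c (init (e x)) t s \<and> s 0 = f x \<and> t \<le> T x"
    by (rule ptE[OF assms(2)]) (rule that; assumption)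
  obtain d U where U: "pbounded {x \<in> X. B x = Lf} e U"
    "\<And>x. x \<in> {x \<in> X. B x = Lf} \<Longrightarrow> \<exists>t s. exec d (init (e x)) t s \<and> s 0 = g x \<and> t \<le> U x"
    by (rule ptE[OF assms(3)]) (rule that; assumption)
  define b where "b = max (cbnd a) (max (cbnd c) (cbnd d))"
  define P where "P = Seq (Assign (b+1) (Var 0)) (Seq (call a b) (Seq (Assign (b+2) (Var 0))
    (Seq (Assign 0 (Var (b+1))) (If (Var (b+2)) (call c b) (call d b)))))"
  show ?thesis
  proof (rule ptI)
    show "pbounded X e (\<lambda>x. 20 + 4 * b + 3 * size (e x) + A x + 2 * size (B x) +
        (if B x \<noteq> Lf then T x else U x))"
      by (intro pbounded_intros T(1) U(1) A(1) ptime_size assms pbounded_if) (use U(1) in simp)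
    show "\<exists>t s. exec P (init (e x)) t s \<and> s 0 = (if B x \<noteq> Lf then f x else g x) \<and>
       t \<le> 20 + 4 * b + 3 * size (e x) + A x + 2 * size (B x) + (if B x \<noteq> Lf then T x else U x)"
      if x: "x \<in> X" for x
    proof -
      obtain k v where kv: "exec a (init (e x)) k v" "v 0 = B x" "k \<le> A x"
        using A(2)[OF x] by auto
      \<comment> \<open>With \<open>c'\<close> standing for the branch that is taken, one
        computation of the running time covers both cases.\<close>
      define c' where "c' = (if B x \<noteq> Lf then c else d)"
      obtain t s where ts: "exec c' (init (e x)) t s" "s 0 = (if B x \<noteq> Lf then f x else g x)"
          "t \<le> (if B x \<noteq> Lf then T x else U x)"
        using T(2)[of x] U(2)[of x] x unfolding c'_def by (cases "B x = Lf") auto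
      define s0 where "s0 = init (e x)"
      define s1 where "s1 = s0(b+1 := val (Var 0) s0)"
      define s2 where "s2 = s1(0 := v 0)"
      define s3 where "s3 = s2(b+2 := val (Var 0) s2)"
      define s4 where "s4 = s3(0 := val (Var (b+1)) s3)"
      define s5 where "s5 = s4(0 := s 0)"
      note defs = s0_def s1_def s2_def s3_def s4_def s5_def
      have 2: "exec (call a b) s1 (k + (1 + 2 * b)) s2" unfolding s2_def
        by (rule exec_call[OF kv(1)]) (auto simp: b_def defs init_def)
      have 5: "exec (call c' b) s4 (t + (1 + 2 * b)) s5" unfolding s5_def
        by (rule exec_call[OF ts(1)]) (auto simp: b_def defs init_def c'_def)
      have 6: "exec (If (Var (b+2)) (call c b) (call d b)) s4
          (1 + ecost (Var (b+2)) s4 + (t + (1 + 2 * b))) s5"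
      proof (cases "B x = Lf")
        case True
        then show ?thesis using 5 kv by (intro exec.IfFalse) (auto simp: c'_def defs)
      next
        case False
        then show ?thesis using 5 kv by (intro exec.IfTrue) (auto simp: c'_def defs)
      qed
      note 1 = exec.Assign[of "b+1" "Var 0" s0, folded s1_def]
      note 3 = exec.Assign[of "b+2" "Var 0" s2, folded s3_def]
      note 4 = exec.Assign[of 0 "Var (b+1)" s3, folded s4_def]
      note seqs = exec.Seq[OF 1 exec.Seq[OF 2 exec.Seq[OF 3 exec.Seq[OF 4 6]]]]
      define t' where "t' = (1 + ecost (Var 0) s0) + ((k + (1 + 2 * b)) + ((1 + ecost (Var 0) s2) +
            ((1 + ecost (Var (b+1)) s3) + (1 + ecost (Var (b+2)) s4 + (t + (1 + 2 * b))))))"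
      have *: "exec P (init (e x)) t' s5"
        using seqs unfolding P_def s0_def[symmetric] t'_def .
      note * = * t'_def
      have "s5 0 = (if B x \<noteq> Lf then f x else g x)" using ts by (simp add: defs)
      moreover have "t' \<le> 20 + 4 * b + 3 * size (e x) + A x + 2 * size (B x) +
          (if B x \<noteq> Lf then T x else U x)"
        using * ts kv by (simp add: defs init_def)
      ultimately show ?thesis using *(1) by blast
    qed
  qed
qed

text \<open>The loop holds the environment in \<open>b+1\<close>, the remaining list in
  \<open>b+2\<close> and the accumulator in \<open>b+3\<close>; an encoded list is \<open>Lf\<close>
  exactly if it is empty, so it is its own loop test. The bounds \<open>T\<close> and
  \<open>Z\<close> are uniform over all rounds, which makes the total time a product.\<close>

lemma exec_fold_loop:
  fixes ea :: "'a \<Rightarrow> bintree" and eb :: "'b \<Rightarrow> bintree" and env :: bintree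
  assumes c: "cbnd c \<le> Suc b"
  assumes step: "\<And>k. k < length ys \<Longrightarrow>
    \<exists>t s. exec c (init (Nd env (Nd (ea (ys ! k)) (eb (fold st (take k ys) a))))) t s \<and>
       s 0 = eb (st (ys ! k) (fold st (take k ys) a)) \<and> t \<le> T"
  assumes sz: "\<And>k. k \<le> length ys \<Longrightarrow> size (eb (fold st (take k ys) a)) \<le> Z"
  assumes Z: "size env \<le> Z" "size (enc_list ea ys) \<le> Z"
  assumes s: "\<And>v. 1 \<le> v \<Longrightarrow> v \<le> b \<Longrightarrow> s v = Lf" "s (b+1) = env" "s (b+2) = enc_list ea ys"
    "s (b+3) = eb a"
  shows "\<exists>t s'. exec (While (Var (b+2))
      (Seq (Assign 0 (NdE (Var (b+1)) (NdE (Left (Var (b+2))) (Var (b+3)))))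
      (Seq (call c b) (Seq (Assign (b+3) (Var 0)) (Assign (b+2) (Right (Var (b+2)))))))) s t s' \<and>
     s' (b+3) = eb (fold st ys a) \<and> t \<le> (length ys + 1) * (50 + 20 * Z + T + 2 * b)"
  using assms(2-)
proof (induction ys arbitrary: a s)
  case Nil
  let ?c = "(Seq (Assign 0 (NdE (Var (b+1)) (NdE (Left (Var (b+2))) (Var (b+3)))))
      (Seq (call c b) (Seq (Assign (b+3) (Var 0)) (Assign (b+2) (Right (Var (b+2)))))))"
  have "exec (While (Var (b+2)) ?c) s (1 + ecost (Var (b+2)) s) s"
    by (rule exec.WhileFalse) (use Nil in simp)
  then show ?case using Nil by (intro exI[of _ "1 + ecost (Var (b+2)) s"] exI[of _ s]) simp
next
  case (Cons y ys)
  let ?c = "(Seq (Assign 0 (NdE (Var (b+1)) (NdE (Left (Var (b+2))) (Var (b+3)))))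
      (Seq (call c b) (Seq (Assign (b+3) (Var 0)) (Assign (b+2) (Right (Var (b+2)))))))"
  obtain t r where tr: "exec c (init (Nd env (Nd (ea y) (eb a)))) t r" "r 0 = eb (st y a)" "t \<le> T"
    using Cons.prems(1)[of 0] by auto
  define ee where "ee = NdE (Var (b+1)) (NdE (Left (Var (b+2))) (Var (b+3)))"
  define s1 where "s1 = s(0 := val ee s)"
  define s2 where "s2 = s1(0 := r 0)"
  define s3 where "s3 = s2(b+3 := val (Var 0) s2)"
  define s4 where "s4 = s3(b+2 := val (Right (Var (b+2))) s3)"
  note defs = s1_def s2_def s3_def s4_def
  have 2: "exec (call c b) s1 (t + (1 + 2 * b)) s2" unfolding s2_def
    by (rule exec_call[OF tr(1) c]) (use Cons.prems in \<open>auto simp: defs ee_def\<close>)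
  have body: "exec ?c s ((1 + ecost ee s) + ((t + (1 + 2 * b)) + ((1 + ecost (Var 0) s2) +
      (1 + ecost (Right (Var (b+2))) s3)))) s4"
    unfolding ee_def[symmetric] unfolding s4_def
    by (intro exec.Seq[OF exec.Assign[of 0 ee s, folded s1_def]] exec.Seq[OF 2]
         exec.Seq[OF exec.Assign[of "b+3" "Var 0" s2, folded s3_def]] exec.Assign)
  have Zh: "size (ea y) + size (enc_list ea ys) + 1 \<le> Z" using Cons.prems(4) by simp
  have s4: "s4 (b+1) = env" "s4 (b+2) = enc_list ea ys" "s4 (b+3) = eb (st y a)"
     "\<And>v. 1 \<le> v \<Longrightarrow> v \<le> b \<Longrightarrow> s4 v = Lf"
    using Cons.prems tr by (auto simp: defs)
  have "\<exists>t s'. exec (While (Var (b+2)) ?c) s4 t s' \<and>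
     s' (b+3) = eb (fold st ys (st y a)) \<and> t \<le> (length ys + 1) * (50 + 20 * Z + T + 2 * b)"
  proof (rule Cons.IH)
    show "\<exists>t s. exec c (init (Nd env (Nd (ea (ys ! k)) (eb (fold st (take k ys) (st y a)))))) t s \<and>
       s 0 = eb (st (ys ! k) (fold st (take k ys) (st y a))) \<and> t \<le> T" if "k < length ys" for k
      using Cons.prems(1)[of "Suc k"] that by auto
    show "size (eb (fold st (take k ys) (st y a))) \<le> Z" if "k \<le> length ys" for k
      using Cons.prems(2)[of "Suc k"] that by auto
  qed (use s4 Cons.prems Zh in auto)
  then obtain u s' where u: "exec (While (Var (b+2)) ?c) s4 u s'"
     "s' (b+3) = eb (fold st ys (st y a))" "u \<le> (length ys + 1) * (50 + 20 * Z + T + 2 * b)"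
    by blast
  have "exec (While (Var (b+2)) ?c) s (1 + ecost (Var (b+2)) s + ((1 + ecost ee s) +
      ((t + (1 + 2 * b)) + ((1 + ecost (Var 0) s2) + (1 + ecost (Right (Var (b+2))) s3)))) + u) s'"
    by (rule exec.WhileTrue[OF _ body u(1)]) (use Cons.prems in simp)
  moreover have "ecost ee s \<le> 20 + 10 * Z"
    using Cons.prems(2)[of 0] Cons.prems(3,4,6,7,8) unfolding ee_def by simp
  moreover have "ecost (Var 0) s2 \<le> 1 + Z"
    using Cons.prems(2)[of 1] tr unfolding s2_def by simp
  moreover have "ecost (Right (Var (b+2))) s3 \<le> 5 + 3 * Z"
    using Cons.prems Zh unfolding defs by simp
  moreover have "ecost (Var (b+2)) s \<le> 1 + Z"
    using Cons.prems by simp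
  ultimately have "exec (While (Var (b+2)) ?c) s (1 + ecost (Var (b+2)) s + ((1 + ecost ee s) +
      ((t + (1 + 2 * b)) + ((1 + ecost (Var 0) s2) + (1 + ecost (Right (Var (b+2))) s3)))) + u) s'"
    "1 + ecost (Var (b+2)) s + ((1 + ecost ee s) + ((t + (1 + 2 * b)) + ((1 + ecost (Var 0) s2) +
       (1 + ecost (Right (Var (b+2))) s3)))) \<le> 50 + 20 * Z + T + 2 * b"
    using tr(3) by linarith+
  then show ?case using u(2,3)
    by (intro exI[of _ "1 + ecost (Var (b+2)) s + ((1 + ecost ee s) + ((t + (1 + 2 * b)) +
       ((1 + ecost (Var 0) s2) + (1 + ecost (Right (Var (b+2))) s3)))) + u"] exI[of _ s'])
      (auto simp del: ecost.simps)
qed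

lemma length_le_size_enc_list: "length xs \<le> size (enc_list f xs)"
  by (induction xs) auto

lemma size_nth_enc_list: "k < length xs \<Longrightarrow> size (f (xs ! k)) \<le> size (enc_list f xs)"
  by (induction xs arbitrary: k) (auto simp: nth_Cons split: nat.splits intro: trans_le_add2 le_SucI)

text \<open>A polynomial-time step is not enough for a polynomial-time loop: a step that doubles its
  accumulator would give exponential size. Hence the bound \<open>g\<close> on all intermediate
  accumulators. The set \<open>Y\<close> collects the situations in which the step is run, so that
  invariants can enter its correctness.\<close>

lemma ptime_fold:
  assumes xs: "ptime X e (\<lambda>x. enc_list ea (xs x))" and ini: "ptime X e (\<lambda>x. eb (ini x))"
    and st: "ptime Y (\<lambda>p. Nd (e (fst p)) (Nd (ea (fst (snd p))) (eb (snd (snd p)))))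
        (\<lambda>p. eb (st (fst p) (fst (snd p)) (snd (snd p))))"
    and Y: "\<And>x k. x \<in> X \<Longrightarrow> k < length (xs x) \<Longrightarrow>
        (x, xs x ! k, fold (st x) (take k (xs x)) (ini x)) \<in> Y"
    and g: "pbounded X e g" "\<And>x k. x \<in> X \<Longrightarrow> k \<le> length (xs x) \<Longrightarrow>
        size (eb (fold (st x) (take k (xs x)) (ini x))) \<le> g x"
  shows "ptime X e (\<lambda>x. eb (fold (st x) (xs x) (ini x)))"
proof -
  obtain c1 T1 where T1: "pbounded X e T1"
    "\<And>x. x \<in> X \<Longrightarrow> \<exists>t s. exec c1 (init (e x)) t s \<and> s 0 = enc_list ea (xs x) \<and> t \<le> T1 x"
    by (rule ptE[OF xs]) (rule that; assumption)
  obtain c2 T2 where T2: "pbounded X e T2"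
    "\<And>x. x \<in> X \<Longrightarrow> \<exists>t s. exec c2 (init (e x)) t s \<and> s 0 = eb (ini x) \<and> t \<le> T2 x"
    by (rule ptE[OF ini]) (rule that; assumption)
  obtain c S where S: "pbounded Y (\<lambda>p. Nd (e (fst p)) (Nd (ea (fst (snd p))) (eb (snd (snd p))))) S"
    "\<And>q. q \<in> Y \<Longrightarrow> \<exists>t s. exec c (init (Nd (e (fst q)) (Nd (ea (fst (snd q))) (eb (snd (snd q)))))) t s \<and>
      s 0 = eb (st (fst q) (fst (snd q)) (snd (snd q))) \<and> t \<le> S q"
    by (rule ptE[OF st]) (rule that; assumption)
  obtain p where "\<And>q. q \<in> Y \<Longrightarrow> S q \<le> poly p (size (Nd (e (fst q)) (Nd (ea (fst (snd q))) (eb (snd (snd q))))))"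
    using S(1) unfolding pbounded_def by blast
  note S = S(2) this
  have p: "\<exists>t s. exec c (init (Nd (e x) (Nd (ea a) (eb v)))) t s \<and>
      s 0 = eb (st x a v) \<and> t \<le> poly p (size (Nd (e x) (Nd (ea a) (eb v))))"
    if "(x, a, v) \<in> Y" for x a v
    using S(1)[OF that] S(2)[OF that] by (auto simp del: bintree.size dest: order_trans)
  define b where "b = max (cbnd c) (max (cbnd c1) (cbnd c2))"
  define W where "W = While (Var (b+2))
      (Seq (Assign 0 (NdE (Var (b+1)) (NdE (Left (Var (b+2))) (Var (b+3)))))
      (Seq (call c b) (Seq (Assign (b+3) (Var 0)) (Assign (b+2) (Right (Var (b+2)))))))"
  define P where "P = Seq (Assign (b+1) (Var 0)) (Seq (call c1 b) (Seq (Assign (b+2) (Var 0))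
     (Seq (Assign 0 (Var (b+1))) (Seq (call c2 b) (Seq (Assign (b+3) (Var 0)) (Seq W (Assign 0 (Var (b+3)))))))))"
  define Z where "Z x = size (e x) + size (enc_list ea (xs x)) + g x" for x
  have Zpb: "pbounded X e Z" unfolding Z_def by (intro pbounded_intros ptime_size[OF xs] g)
  \<comment> \<open>The input of the step consists of three trees of size at most
    \<open>Z x\<close>, joined by two inner nodes.\<close>
  define T where "T x = poly p (2 + 3 * Z x)" for x
  have Tpb: "pbounded X e T" unfolding T_def by (intro pbounded_intros Zpb)
  define R where "R x = T1 x + T2 x + 50 + 20 * Z x + 4 * b + (Z x + 1) * (50 + 20 * Z x + T x + 2 * b)" for x
  show ?thesis
  proof (rule ptI[where c = P])
    show "pbounded X e R" unfolding R_def by (intro pbounded_intros T1(1) T2(1) Zpb Tpb)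
    show "\<exists>t s. exec P (init (e x)) t s \<and> s 0 = eb (fold (st x) (xs x) (ini x)) \<and> t \<le> R x"
      if x: "x \<in> X" for x
    proof -
      obtain t s where ts: "exec c1 (init (e x)) t s" "s 0 = enc_list ea (xs x)" "t \<le> T1 x"
        using T1(2)[OF x] by auto
      obtain u r where ur: "exec c2 (init (e x)) u r" "r 0 = eb (ini x)" "u \<le> T2 x"
        using T2(2)[OF x] by auto
      define s0 where "s0 = init (e x)"
      define s1 where "s1 = s0(b+1 := val (Var 0) s0)"
      define s2 where "s2 = s1(0 := s 0)"
      define s3 where "s3 = s2(b+2 := val (Var 0) s2)"
      define s4 where "s4 = s3(0 := val (Var (b+1)) s3)"
      define s5 where "s5 = s4(0 := r 0)"
      define s6 where "s6 = s5(b+3 := val (Var 0) s5)"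
      note defs = s0_def s1_def s2_def s3_def s4_def s5_def s6_def
      have 2: "exec (call c1 b) s1 (t + (1 + 2 * b)) s2" unfolding s2_def
        by (rule exec_call[OF ts(1)]) (auto simp: b_def defs init_def)
      have 5: "exec (call c2 b) s4 (u + (1 + 2 * b)) s5" unfolding s5_def
        by (rule exec_call[OF ur(1)]) (auto simp: b_def defs init_def)
      have "\<exists>t s'. exec W s6 t s' \<and> s' (b+3) = eb (fold (st x) (xs x) (ini x)) \<and>
          t \<le> (length (xs x) + 1) * (50 + 20 * Z x + T x + 2 * b)"
        unfolding W_def
      proof (rule exec_fold_loop)
        show "cbnd c \<le> Suc b" by (simp add: b_def)
        show "\<exists>t s. exec c (init (Nd (e x) (Nd (ea (xs x ! k)) (eb (fold (st x) (take k (xs x)) (ini x)))))) t s \<and>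
         s 0 = eb (st x (xs x ! k) (fold (st x) (take k (xs x)) (ini x))) \<and> t \<le> T x"
          if k: "k < length (xs x)" for k
        proof -
          have "size (Nd (e x) (Nd (ea (xs x ! k)) (eb (fold (st x) (take k (xs x)) (ini x))))) \<le> 2 + 3 * Z x"
            using size_nth_enc_list[of k "xs x" ea] k g(2)[OF x, of k] by (simp add: Z_def)
          from poly_nat_mono[OF this, of p] p[OF Y[OF x k]] show ?thesis
            unfolding T_def by (meson order_trans)
        qed
        show "size (eb (fold (st x) (take k (xs x)) (ini x))) \<le> Z x" if "k \<le> length (xs x)" for k
          using g(2)[OF x that] by (simp add: Z_def)
      qed (use ts ur in \<open>auto simp: defs init_def Z_def\<close>)
      then obtain w q where w: "exec W s6 w q" "q (b+3) = eb (fold (st x) (xs x) (ini x))"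
          "w \<le> (length (xs x) + 1) * (50 + 20 * Z x + T x + 2 * b)" by blast
      note 1 = exec.Assign[of "b+1" "Var 0" s0, folded s1_def]
      note 3 = exec.Assign[of "b+2" "Var 0" s2, folded s3_def]
      note 4 = exec.Assign[of 0 "Var (b+1)" s3, folded s4_def]
      note 6 = exec.Assign[of "b+3" "Var 0" s5, folded s6_def]
      note 8 = exec.Assign[of 0 "Var (b+3)" q]
      note seqs = exec.Seq[OF 1 exec.Seq[OF 2 exec.Seq[OF 3 exec.Seq[OF 4 exec.Seq[OF 5
        exec.Seq[OF 6 exec.Seq[OF w(1) 8]]]]]]]
      define t' where "t' = (1 + ecost (Var 0) s0) + ((t + (1 + 2 * b)) + ((1 + ecost (Var 0) s2) +
            ((1 + ecost (Var (b+1)) s3) + ((u + (1 + 2 * b)) + ((1 + ecost (Var 0) s5) +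
            (w + (1 + ecost (Var (b+3)) q)))))))"
      define s' where "s' = q(0 := val (Var (b+3)) q)"
      have *: "exec P (init (e x)) t' s'"
        using seqs unfolding P_def s0_def[symmetric] t'_def s'_def .
      note * = * s'_def t'_def
      have "size (eb (ini x)) \<le> Z x" "size (eb (fold (st x) (xs x) (ini x))) \<le> Z x"
        using g(2)[OF x, of 0] g(2)[OF x, of "length (xs x)"] by (auto simp: Z_def)
      moreover have "size (e x) \<le> Z x" "size (enc_list ea (xs x)) \<le> Z x" by (auto simp: Z_def)
      moreover have "w \<le> (Z x + 1) * (50 + 20 * Z x + T x + 2 * b)"
        using length_le_size_enc_list[of "xs x" ea]
        by (intro order_trans[OF w(3)] mult_right_mono) (auto simp: Z_def)
      ultimately have "t' \<le> R x"
        using * ts ur w unfolding R_def by (simp add: defs init_def)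
      moreover have "s' 0 = eb (fold (st x) (xs x) (ini x))" using * w by simp
      ultimately show ?thesis using *(1) by blast
    qed
  qed
qed

text \<open>Inside a loop body the input is the environment paired with loop data. What was
  computable from the environment alone remains so after a projection; \<open>h\<close> is mostly
  \<open>fst\<close>.\<close>

lemma ptime_lift:
  assumes "ptime X e F" "\<And>p. p \<in> Y \<Longrightarrow> h p \<in> X"
  shows "ptime Y (\<lambda>p. Nd (e (h p)) (B p)) (\<lambda>p. F (h p))"
  by (rule ptime_comp[OF assms(1)]) (use ptime_left[OF ptime_id[of Y "\<lambda>p. Nd (e (h p)) (B p)"]] assms in simp_all)

lemma ptime_env1: "ptime Y (\<lambda>p. Nd (A p) (B p)) (\<lambda>p. B p)"
  using ptime_right[OF ptime_id[of Y "\<lambda>p. Nd (A p) (B p)"]] by simp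

lemma ptime_env2: "ptime Y (\<lambda>p. Nd (A p) (Nd (B p) (C p))) (\<lambda>p. B p)"
  using ptime_left[OF ptime_right[OF ptime_id[of Y "\<lambda>p. Nd (A p) (Nd (B p) (C p))"]]] by simp

lemma ptime_env3: "ptime Y (\<lambda>p. Nd (A p) (Nd (B p) (C p))) (\<lambda>p. C p)"
  using ptime_right[OF ptime_right[OF ptime_id[of Y "\<lambda>p. Nd (A p) (Nd (B p) (C p))"]]] by simp

section \<open>Unary numbers, lists and signs\<close>

lemma ptime_Cons:
  "ptime X e (\<lambda>x. ea (a x)) \<Longrightarrow> ptime X e (\<lambda>x. enc_list ea (xs x)) \<Longrightarrow> ptime X e (\<lambda>x. enc_list ea (a x # xs x))"
  by (simp add: ptime_Nd)

lemma ptime_Suc: "ptime X e (\<lambda>x. enc_nat (f x)) \<Longrightarrow> ptime X e (\<lambda>x. enc_nat (Suc (f x)))"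
  by (simp add: ptime_Nd ptime_const)

lemma size_enc_nat [simp]: "size (enc_nat n) = n"
  by (induction n) auto

lemma enc_nat_eq_Lf [simp]: "enc_nat n = Lf \<longleftrightarrow> n = 0"
  by (cases n) auto

lemma size_enc_list: "size (enc_list f xs) = (\<Sum>x\<leftarrow>xs. size (f x) + 1)"
  by (induction xs) auto

lemma right_enc_nat: "right (enc_nat n) = enc_nat (n - 1)"
  by (cases n) auto

lemma right_enc_list: "right (enc_list f xs) = enc_list f (tl xs)"
  by (cases xs) auto

lemma left_enc_list: "xs \<noteq> [] \<Longrightarrow> left (enc_list f xs) = f (hd xs)"
  by (cases xs) auto

text \<open>A unary number is a list of units, which turns bounded iteration into a fold.\<close>

lemma enc_nat_eq_enc_list: "enc_nat k = enc_list (\<lambda>_. Lf) (replicate k ())"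
  by (induction k) auto

lemma ptime_rev:
  assumes "ptime X e (\<lambda>x. enc_list ea (xs x))"
  shows "ptime X e (\<lambda>x. enc_list ea (rev (xs x)))"
proof -
  have "ptime X e (\<lambda>x. enc_list ea (fold Cons (xs x) []))"
  proof (rule ptime_fold[OF assms])
    show "ptime X e (\<lambda>x. enc_list ea [])" by (simp add: ptime_const)
    show "ptime UNIV (\<lambda>p. Nd (e (fst p)) (Nd (ea (fst (snd p))) (enc_list ea (snd (snd p)))))
         (\<lambda>p. enc_list ea (fst (snd p) # snd (snd p)))"
      by (intro ptime_Cons ptime_env2 ptime_env3)
    show "pbounded X e (\<lambda>x. size (enc_list ea (xs x)))" by (rule ptime_size[OF assms])
    have "size (enc_list ea (take k ys)) \<le> size (enc_list ea ys)" for k ys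
      by (subst append_take_drop_id[of k ys, symmetric]) (simp only: size_enc_list map_append sum_list_append)
    then show "size (enc_list ea (fold Cons (take k (xs x)) [])) \<le> size (enc_list ea (xs x))" for x k
      by (simp add: fold_Cons_rev size_enc_list rev_map[symmetric])
  qed auto
  then show ?thesis by (simp add: fold_Cons_rev)
qed

lemma ptime_append:
  assumes "ptime X e (\<lambda>x. enc_list ea (xs x))" "ptime X e (\<lambda>x. enc_list ea (ys x))"
  shows "ptime X e (\<lambda>x. enc_list ea (xs x @ ys x))"
proof -
  have "ptime X e (\<lambda>x. enc_list ea (fold Cons (rev (xs x)) (ys x)))"
  proof (rule ptime_fold[where eb = "enc_list ea" and ini = ys, OF ptime_rev[OF assms(1)] assms(2)])
    show "ptime UNIV (\<lambda>p. Nd (e (fst p)) (Nd (ea (fst (snd p))) (enc_list ea (snd (snd p)))))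
         (\<lambda>p. enc_list ea (fst (snd p) # snd (snd p)))"
      by (intro ptime_Cons ptime_env2 ptime_env3)
    show "pbounded X e (\<lambda>x. size (enc_list ea (xs x)) + size (enc_list ea (ys x)))"
      by (intro pbounded_intros ptime_size[OF assms(1)] ptime_size[OF assms(2)])
    have "size (enc_list ea (drop k zs)) \<le> size (enc_list ea zs)" for k zs
      by (subst (2) append_take_drop_id[of k zs, symmetric]) (simp only: size_enc_list map_append sum_list_append)
    then show "size (enc_list ea (fold Cons (take k (rev (xs x))) (ys x))) \<le>
       size (enc_list ea (xs x)) + size (enc_list ea (ys x))" for x k
      by (simp add: fold_Cons_rev size_enc_list rev_map[symmetric] take_rev)
  qed auto
  then show ?thesis by (simp add: fold_Cons_rev)
qed

lemma fold_Cons_map: "fold (\<lambda>a acc. f a # acc) xs ys = rev (map f xs) @ ys"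
  by (induction xs arbitrary: ys) auto

text \<open>The fold conses the images in reverse order. Its accumulator stays small because each
  image is computed from the environment and one entry, never from earlier images.\<close>

lemma ptime_map:
  assumes "ptime X e (\<lambda>x. enc_list ea (xs x))"
    and f: "ptime Y (\<lambda>p. Nd (e (fst p)) (ea (snd p))) (\<lambda>p. eb (f (fst p) (snd p)))"
    and Y: "\<And>x a. x \<in> X \<Longrightarrow> a \<in> set (xs x) \<Longrightarrow> (x, a) \<in> Y"
  shows "ptime X e (\<lambda>x. enc_list eb (map (\<lambda>a. f x a) (xs x)))"
proof -
  obtain p where p: "\<And>q. q \<in> Y \<Longrightarrow> size (eb (f (fst q) (snd q))) \<le> poly p (size (Nd (e (fst q)) (ea (snd q))))"
    using ptime_size[OF f] unfolding pbounded_def by blast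
  define g where "g x = size (enc_list ea (xs x)) * (poly p (1 + size (e x) + size (enc_list ea (xs x))) + 1)" for x
  have "ptime X e (\<lambda>x. enc_list eb (fold (\<lambda>a acc. f x a # acc) (xs x) []))"
  proof (rule ptime_fold[OF assms(1)])
    show "ptime X e (\<lambda>x. enc_list eb [])" by (simp add: ptime_const)
    let ?Y = "{q. (fst q, fst (snd q)) \<in> Y}"
    let ?e = "(\<lambda>p. Nd (e (fst p)) (Nd (ea (fst (snd p))) (enc_list eb (snd (snd p)))))"
    have "ptime ?Y ?e (\<lambda>p. Nd (e (fst p)) (ea (fst (snd p))))"
      by (intro ptime_Nd ptime_env2 ptime_lift ptime_id) auto
    then have "ptime ?Y ?e (\<lambda>q. (\<lambda>p. eb (f (fst p) (snd p))) (fst q, fst (snd q)))"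
      by (intro ptime_comp[OF f]) auto
    then show "ptime ?Y ?e (\<lambda>p. enc_list eb (f (fst p) (fst (snd p)) # snd (snd p)))"
      by (intro ptime_Cons ptime_env3) simp
    show "(x, xs x ! k, fold (\<lambda>a acc. f x a # acc) (take k (xs x)) []) \<in> ?Y"
      if "x \<in> X" "k < length (xs x)" for x k
      using Y that by simp
    show "pbounded X e g" unfolding g_def by (intro pbounded_intros ptime_size[OF assms(1)])
    show "size (enc_list eb (fold (\<lambda>a acc. f x a # acc) (take k (xs x)) [])) \<le> g x"
      if x: "x \<in> X" and k: "k \<le> length (xs x)" for x k
    proof -
      let ?B = "poly p (1 + size (e x) + size (enc_list ea (xs x))) + 1"
      have "size (eb (f x a)) + 1 \<le> ?B" if a: "a \<in> set (xs x)" for a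
      proof -
        obtain i where i: "i < length (xs x)" "a = xs x ! i" using a by (auto simp: in_set_conv_nth)
        have "size (Nd (e x) (ea a)) \<le> 1 + size (e x) + size (enc_list ea (xs x))"
          using size_nth_enc_list[OF i(1), of ea] i by simp
        from poly_nat_mono[OF this, of p] p[OF Y[OF x a]] show ?thesis by simp
      qed
      then have "(\<Sum>a\<leftarrow>take k (xs x). size (eb (f x a)) + 1) \<le> (\<Sum>a\<leftarrow>take k (xs x). ?B)"
        by (intro sum_list_mono) (meson in_set_takeD)
      also have "\<dots> = length (take k (xs x)) * ?B" by (simp only: sum_list_triv of_nat_id)
      also have "\<dots> \<le> g x" unfolding g_def
        using length_le_size_enc_list[of "xs x" ea] by (intro mult_right_mono) auto
      finally show ?thesis by (simp add: fold_Cons_map size_enc_list rev_map[symmetric] o_def)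
    qed
  qed
  then have "ptime X e (\<lambda>x. enc_list eb (rev (map (f x) (xs x))))" by (simp add: fold_Cons_map)
  from ptime_rev[OF this] show ?thesis by simp
qed

lemma fold_replicate_funpow: "fold (\<lambda>_. f) (replicate k ()) b = (f ^^ k) b"
  by (induction k arbitrary: b) (auto simp: funpow_swap1)

lemma ptime_iter:
  assumes k: "ptime X e (\<lambda>x. enc_nat (k x))" and ini: "ptime X e (\<lambda>x. eb (ini x))"
    and st: "ptime Y (\<lambda>p. Nd (e (fst p)) (eb (snd p))) (\<lambda>p. eb (st (fst p) (snd p)))"
    and Y: "\<And>x i. x \<in> X \<Longrightarrow> i < k x \<Longrightarrow> (x, (st x ^^ i) (ini x)) \<in> Y"
    and g: "pbounded X e g" "\<And>x i. x \<in> X \<Longrightarrow> i \<le> k x \<Longrightarrow> size (eb ((st x ^^ i) (ini x))) \<le> g x"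
  shows "ptime X e (\<lambda>x. eb ((st x ^^ k x) (ini x)))"
proof -
  have "ptime X e (\<lambda>x. eb (fold (\<lambda>_. st x) (replicate (k x) ()) (ini x)))"
  proof (rule ptime_fold[where eb = eb and ini = ini and ea = "\<lambda>_. Lf", OF k[unfolded enc_nat_eq_enc_list] ini _ _ g(1)])
    let ?Y = "{q. (fst q, snd (snd q)) \<in> Y}"
    let ?e = "(\<lambda>p. Nd (e (fst p)) (Nd Lf (eb (snd (snd p)))))"
    have "ptime ?Y ?e (\<lambda>p. Nd (e (fst p)) (eb (snd (snd p))))"
      by (intro ptime_Nd ptime_env3 ptime_lift ptime_id) auto
    then have "ptime ?Y ?e (\<lambda>q. (\<lambda>p. eb (st (fst p) (snd p))) (fst q, snd (snd q)))"
      by (intro ptime_comp[OF st]) auto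
    then show "ptime ?Y ?e (\<lambda>p. eb (st (fst p) (snd (snd p))))" by simp
  qed (use Y g(2) in \<open>auto simp: fold_replicate_funpow min_def\<close>)
  then show ?thesis by (simp add: fold_replicate_funpow)
qed

lemma ptime_add:
  assumes "ptime X e (\<lambda>x. enc_nat (f x))" "ptime X e (\<lambda>x. enc_nat (g x))"
  shows "ptime X e (\<lambda>x. enc_nat (f x + g x))"
proof -
  have *: "(Suc ^^ i) j = i + j" for i j by (induction i) auto
  have "ptime X e (\<lambda>x. enc_nat ((Suc ^^ f x) (g x)))"
  proof (rule ptime_iter[where eb = enc_nat and ini = g, OF assms])
    show "ptime UNIV (\<lambda>p. Nd (e (fst p)) (enc_nat (snd p))) (\<lambda>p. enc_nat (Suc (snd p)))"
      by (intro ptime_Suc ptime_env1)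
    show "pbounded X e (\<lambda>x. size (enc_nat (f x)) + size (enc_nat (g x)))"
      by (intro pbounded_intros ptime_size assms)
  qed (auto simp: *)
  then show ?thesis by (simp add: *)
qed

lemma ptime_mult:
  assumes "ptime X e (\<lambda>x. enc_nat (f x))" "ptime X e (\<lambda>x. enc_nat (g x))"
  shows "ptime X e (\<lambda>x. enc_nat (f x * g x))"
proof -
  have *: "(((+) m) ^^ i) 0 = i * m" for i and m :: nat by (induction i) auto
  have "ptime X e (\<lambda>x. enc_nat (((\<lambda>v. g x + v) ^^ f x) 0))"
  proof (rule ptime_iter[OF assms(1)])
    show "ptime X e (\<lambda>x. enc_nat 0)" by (simp add: ptime_const)
    show "ptime (X \<times> UNIV) (\<lambda>p. Nd (e (fst p)) (enc_nat (snd p))) (\<lambda>p. enc_nat (g (fst p) + snd p))"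
      by (intro ptime_add ptime_env1 ptime_lift[OF assms(2)]) auto
    show "pbounded X e (\<lambda>x. size (enc_nat (f x)) * size (enc_nat (g x)))"
      by (intro pbounded_intros ptime_size assms)
  qed (auto simp: *)
  then show ?thesis by (simp add: *)
qed

text \<open>As \<open>right Lf = Lf\<close>, the right subtree of a unary number is its truncated
  predecessor. Comparisons of numbers are reduced to this subtraction.\<close>

lemma ptime_minus:
  assumes "ptime X e (\<lambda>x. enc_nat (f x))" "ptime X e (\<lambda>x. enc_nat (g x))"
  shows "ptime X e (\<lambda>x. enc_nat (f x - g x))"
proof -
  have *: "((\<lambda>v. v - 1) ^^ i) j = j - i" for i and j :: nat by (induction i) auto
  have "ptime X e (\<lambda>x. enc_nat (((\<lambda>v. v - 1) ^^ g x) (f x)))"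
  proof (rule ptime_iter[where eb = enc_nat and ini = f, OF assms(2,1)])
    show "ptime UNIV (\<lambda>p. Nd (e (fst p)) (enc_nat (snd p))) (\<lambda>p. enc_nat (snd p - 1))"
      unfolding right_enc_nat[symmetric] by (intro ptime_right ptime_env1)
    show "pbounded X e (\<lambda>x. size (enc_nat (f x)))"
      by (intro pbounded_intros ptime_size assms)
  qed (auto simp: * simp del: One_nat_def)
  then show ?thesis by (simp add: * del: One_nat_def)
qed

lemma ptime_poly: "ptime X e (\<lambda>x. enc_nat (f x)) \<Longrightarrow> ptime X e (\<lambda>x. enc_nat (poly p (f x)))"
proof (induction p)
  case (pCons a p)
  then show ?case unfolding poly_pCons by (intro ptime_add ptime_mult ptime_const)
qed (simp add: ptime_const)

lemma ptime_power: "ptime X e (\<lambda>x. enc_nat (f x)) \<Longrightarrow> ptime X e (\<lambda>x. enc_nat (f x ^ k))"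
  using ptime_poly[of X e f "monom 1 k"] by (simp add: poly_monom)

lemma ptime_drop:
  assumes "ptime X e (\<lambda>x. enc_nat (k x))" "ptime X e (\<lambda>x. enc_list ea (xs x))"
  shows "ptime X e (\<lambda>x. enc_list ea (drop (k x) (xs x)))"
proof -
  have *: "(tl ^^ i) ys = drop i ys" for i and ys :: "'b list"
    by (induction i) (auto simp: tl_drop drop_Suc)
  have "ptime X e (\<lambda>x. enc_list ea ((tl ^^ k x) (xs x)))"
  proof (rule ptime_iter[where eb = "enc_list ea" and ini = xs, OF assms])
    show "ptime UNIV (\<lambda>p. Nd (e (fst p)) (enc_list ea (snd p))) (\<lambda>p. enc_list ea (tl (snd p)))"
      unfolding right_enc_list[symmetric] by (intro ptime_right ptime_env1)
    show "pbounded X e (\<lambda>x. size (enc_list ea (xs x)))"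
      by (intro pbounded_intros ptime_size assms)
    show "size (enc_list ea ((tl ^^ i) (xs x))) \<le> size (enc_list ea (xs x))" for x i
      unfolding * by (subst (2) append_take_drop_id[of i "xs x", symmetric])
        (simp only: size_enc_list map_append sum_list_append)
  qed auto
  then show ?thesis by (simp add: *)
qed

lemma ptime_nth:
  assumes "ptime X e (\<lambda>x. enc_list ea (xs x))" "ptime X e (\<lambda>x. enc_nat (k x))"
    "\<And>x. x \<in> X \<Longrightarrow> k x < length (xs x)"
  shows "ptime X e (\<lambda>x. ea (xs x ! k x))"
  by (rule ptime_cong[OF ptime_left[OF ptime_drop[OF assms(2,1)]]])
     (use assms(3) in \<open>fastforce simp: left_enc_list hd_drop_conv_nth\<close>)

lemma ptime_length: "ptime X e (\<lambda>x. enc_list ea (xs x)) \<Longrightarrow> ptime X e (\<lambda>x. enc_nat (length (xs x)))"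
proof -
  assume *: "ptime X e (\<lambda>x. enc_list ea (xs x))"
  have "ptime X e (\<lambda>x. enc_list (\<lambda>_. Lf) (map (\<lambda>a. ()) (xs x)))"
    by (rule ptime_map[OF * ptime_const UNIV_I])
  then show ?thesis by (simp add: enc_nat_eq_enc_list map_replicate_const)
qed

lemma ptime_upt:
  assumes "ptime X e (\<lambda>x. enc_nat (k x))"
  shows "ptime X e (\<lambda>x. enc_list enc_nat [0..<k x])"
proof -
  have *: "((\<lambda>l. 0 # map (\<lambda>i. Suc i) l) ^^ i) [] = [0..<i]" for i
    by (induction i) (auto simp: map_Suc_upt upt_conv_Cons simp del: upt_Suc)
  have "ptime X e (\<lambda>x. enc_list enc_nat (((\<lambda>l. 0 # map (\<lambda>i. Suc i) l) ^^ k x) []))"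
  proof (rule ptime_iter[OF assms])
    show "ptime X e (\<lambda>x. enc_list enc_nat [])" by (simp add: ptime_const)
    show "ptime UNIV (\<lambda>p. Nd (e (fst p)) (enc_list enc_nat (snd p)))
      (\<lambda>p. enc_list enc_nat (0 # map (\<lambda>i. Suc i) (snd p)))"
      by (intro ptime_Cons ptime_const ptime_map[where ea = enc_nat, OF _ _ UNIV_I] ptime_env1 ptime_Suc)
    show "pbounded X e (\<lambda>x. size (enc_nat (k x)) * size (enc_nat (k x)))"
      by (intro pbounded_intros ptime_size assms)
    have "sum_list (map (\<lambda>j. size (enc_nat j) + 1) [0..<i]) \<le> i * i" for i
      by (induction i) (auto simp: algebra_simps)
    then show "size (enc_list enc_nat (((\<lambda>l. 0 # map (\<lambda>i. Suc i) l) ^^ i) [])) \<le>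
      size (enc_nat (k x)) * size (enc_nat (k x))" if "i \<le> k x" for x i
      unfolding * size_enc_list size_enc_nat using that by (meson mult_le_mono order_trans)
  qed auto
  then show ?thesis unfolding * .
qed

lemma ptime_concat:
  assumes "ptime X e (\<lambda>x. enc_list (enc_list ea) (xss x))"
  shows "ptime X e (\<lambda>x. enc_list ea (concat (xss x)))"
proof -
  have *: "fold (\<lambda>l acc. acc @ l) yss zs = zs @ concat yss" for yss and zs :: "'b list"
    by (induction yss arbitrary: zs) auto
  have "ptime X e (\<lambda>x. enc_list ea (fold (\<lambda>l acc. acc @ l) (xss x) []))"
  proof (rule ptime_fold[OF assms])
    show "ptime X e (\<lambda>x. enc_list ea [])" by (simp add: ptime_const)
    show "ptime UNIV (\<lambda>p. Nd (e (fst p)) (Nd (enc_list ea (fst (snd p))) (enc_list ea (snd (snd p)))))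
         (\<lambda>p. enc_list ea (snd (snd p) @ fst (snd p)))"
      by (intro ptime_append ptime_env2 ptime_env3)
    show "pbounded X e (\<lambda>x. size (enc_list (enc_list ea) (xss x)))" by (rule ptime_size[OF assms])
    show "size (enc_list ea (fold (\<lambda>l acc. acc @ l) (take k (xss x)) [])) \<le> size (enc_list (enc_list ea) (xss x))" for x k
    proof -
      have "size (enc_list ea (concat yss)) \<le> size (enc_list (enc_list ea) yss)" for yss
        by (induction yss) (auto simp: size_enc_list)
      also have "size (enc_list (enc_list ea) (take k (xss x))) \<le> size (enc_list (enc_list ea) (xss x))"
        by (subst (2) append_take_drop_id[of k "xss x", symmetric])
          (simp only: size_enc_list map_append sum_list_append)
      finally show ?thesis by (simp add: *)
    qed
  qed auto
  then show ?thesis by (simp add: *)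
qed

lemma ptime_if_zero:
  assumes "ptime X e (\<lambda>x. enc_nat (k x))" "ptime {x \<in> X. k x = 0} e f" "ptime {x \<in> X. k x \<noteq> 0} e g"
  shows "ptime X e (\<lambda>x. if k x = 0 then f x else g x)"
proof -
  have "ptime X e (\<lambda>x. if enc_nat (k x) \<noteq> Lf then g x else f x)"
    by (rule ptime_if[OF assms(1)]) (use assms in simp_all)
  then show ?thesis by (rule ptime_cong) auto
qed

lemma ptime_if_le:
  assumes "ptime X e (\<lambda>x. enc_nat (k x))" "ptime X e (\<lambda>x. enc_nat (l x))"
    "ptime {x \<in> X. k x \<le> l x} e f" "ptime {x \<in> X. \<not> k x \<le> l x} e g"
  shows "ptime X e (\<lambda>x. if k x \<le> l x then f x else g x)"
  using ptime_if_zero[OF ptime_minus[OF assms(1,2)], of f g] assms by simp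

lemma ptime_if_eq:
  assumes "ptime X e (\<lambda>x. enc_nat (k x))" "ptime X e (\<lambda>x. enc_nat (l x))"
    "ptime {x \<in> X. k x = l x} e f" "ptime {x \<in> X. k x \<noteq> l x} e g"
  shows "ptime X e (\<lambda>x. if k x = l x then f x else g x)"
proof -
  have *: "k x - l x + (l x - k x) = 0 \<longleftrightarrow> k x = l x" for x by auto
  show ?thesis
    using ptime_if_zero[OF ptime_add[OF ptime_minus[OF assms(1,2)] ptime_minus[OF assms(2,1)]], of f g] assms
    unfolding * by simp
qed

lemma ptime_if_bool:
  assumes "ptime X e (\<lambda>x. enc_bool (b x))" "ptime {x \<in> X. b x} e f" "ptime {x \<in> X. \<not> b x} e g"
  shows "ptime X e (\<lambda>x. if b x then f x else g x)"
proof -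
  have *: "(enc_bool c = Lf) = (\<not> c)" for c by (simp add: enc_bool_def)
  show ?thesis using ptime_if[OF assms(1), of f g] assms unfolding * by (simp only: * not_not)
qed

lemma ptime_fst: "ptime X e (\<lambda>x. enc_pair ea eb (f x)) \<Longrightarrow> ptime X e (\<lambda>x. ea (fst (f x)))"
  by (drule ptime_left) (simp add: enc_pair_def split_beta)

lemma ptime_snd: "ptime X e (\<lambda>x. enc_pair ea eb (f x)) \<Longrightarrow> ptime X e (\<lambda>x. eb (snd (f x)))"
  by (drule ptime_right) (simp add: enc_pair_def split_beta)

lemma ptime_Pair:
  "ptime X e (\<lambda>x. ea (f x)) \<Longrightarrow> ptime X e (\<lambda>x. eb (g x)) \<Longrightarrow> ptime X e (\<lambda>x. enc_pair ea eb (f x, g x))"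
  by (simp add: enc_pair_def ptime_Nd)

text \<open>The values -1, 0, 1 are coded by 0, 1, 2, so negation is subtraction from 2.\<close>

lemma ptime_uminus_trit:
  assumes "ptime X e (\<lambda>x. enc_trit (f x))" "\<And>x. x \<in> X \<Longrightarrow> f x \<in> {-1, 1, 0}"
  shows "ptime X e (\<lambda>x. enc_trit (- f x))"
proof -
  have "ptime X e (\<lambda>x. enc_nat (2 - nat (f x + 1)))"
    by (intro ptime_minus ptime_const assms(1)[unfolded enc_trit_def])
  then show ?thesis
    by (rule ptime_cong) (use assms(2) in \<open>fastforce simp: enc_trit_def\<close>)
qed

lemma ptime_mult_trit:
  assumes "ptime X e (\<lambda>x. enc_trit (f x))" "ptime X e (\<lambda>x. enc_trit (g x))"
    "\<And>x. x \<in> X \<Longrightarrow> f x \<in> {-1, 1, 0}" "\<And>x. x \<in> X \<Longrightarrow> g x \<in> {-1, 1, 0}"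
  shows "ptime X e (\<lambda>x. enc_trit (f x * g x))"
proof -
  have "ptime X e (\<lambda>x. if nat (f x + 1) = 0 then enc_trit (- g x) else
     if nat (f x + 1) = 1 then enc_trit 0 else enc_trit (g x))"
    by (intro ptime_if_zero ptime_if_eq ptime_const ptime_uminus_trit
         ptime_subset[OF assms(1)[unfolded enc_trit_def]] ptime_subset[OF assms(2)] assms(1)[unfolded enc_trit_def])
       (use assms(4) in auto)
  then show ?thesis
    by (rule ptime_cong) (use assms(3) in \<open>fastforce simp: enc_trit_def\<close>)
qed

lemma size_enc_trit: "a \<in> {-1, 1, 0} \<Longrightarrow> size (enc_trit a) \<le> 2"
  by (auto simp: enc_trit_def)
section \<open>Finite probability distributions\<close>

abbreviation expect :: "'a pmf \<Rightarrow> ('a \<Rightarrow> real) \<Rightarrow> real" where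
  "expect p f \<equiv> measure_pmf.expectation p f"

text \<open>Finite supports are assumed here and in what follows; they make every real function
  integrable and hold for all distributions of the reduction.\<close>

lemma expect_bind:
  assumes "finite (set_pmf p)" "\<And>x. x \<in> set_pmf p \<Longrightarrow> finite (set_pmf (f x))"
  shows "expect (bind_pmf p f) h = expect p (\<lambda>x. expect (f x) h)"
  by (subst pmf_expectation_bind[OF assms order_refl])
     (use assms in \<open>auto simp: integral_measure_pmf[where A = "set_pmf p"]\<close>)

lemma prob_eq_expect: "measure_pmf.prob p A = expect p (indicator A)"
  by simp

lemma prob_bind:
  assumes "finite (set_pmf p)" "\<And>x. x \<in> set_pmf p \<Longrightarrow> finite (set_pmf (f x))"
  shows "measure_pmf.prob (bind_pmf p f) A = expect p (\<lambda>x. measure_pmf.prob (f x) A)"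
  unfolding prob_eq_expect by (rule expect_bind[OF assms])

lemma expect_mono:
  assumes "finite (set_pmf p)" "\<And>x. x \<in> set_pmf p \<Longrightarrow> f x \<le> g x"
  shows "expect p f \<le> expect p g"
  by (intro integral_mono_AE integrable_measure_pmf_finite assms) (auto simp: AE_measure_pmf_iff assms)

lemma expect_cong: "(\<And>x. x \<in> set_pmf p \<Longrightarrow> f x = g x) \<Longrightarrow> expect p f = expect p g"
  by (intro integral_cong_AE) (auto simp: AE_measure_pmf_iff)

text \<open>Markov's inequality with the threshold scaled into \<open>f\<close>.\<close>

lemma prob_le_of_expect:
  assumes "finite (set_pmf p)" "\<And>x. x \<in> set_pmf p \<Longrightarrow> x \<in> A \<Longrightarrow> 1 \<le> f x" "\<And>x. x \<in> set_pmf p \<Longrightarrow> 0 \<le> f x"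
  shows "measure_pmf.prob p A \<le> expect p f"
  unfolding prob_eq_expect by (rule expect_mono[OF assms(1)]) (use assms in \<open>auto simp: indicator_def\<close>)

lemma prob_mono_supp:
  assumes "\<And>x. x \<in> set_pmf p \<Longrightarrow> x \<in> A \<Longrightarrow> x \<in> B"
  shows "measure_pmf.prob p A \<le> measure_pmf.prob p B"
  by (rule measure_pmf.finite_measure_mono_AE) (use assms in \<open>auto simp: AE_measure_pmf_iff\<close>)

lemma finite_set_replicate_pmf [simp]: "finite (set_pmf p) \<Longrightarrow> finite (set_pmf (replicate_pmf n p))"
  unfolding set_replicate_pmf lists_eq_set
  by (rule finite_subset[OF _ finite_lists_length_eq[of "set_pmf p" n]]) auto

section \<open>Second moments of sums of independent draws\<close>

lemma expect_replicate_Suc: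
  assumes "finite (set_pmf p)"
  shows "expect (replicate_pmf (Suc n) p) h = expect p (\<lambda>x. expect (replicate_pmf n p) (\<lambda>xs. h (x # xs)))"
proof -
  have "expect (replicate_pmf (Suc n) p) h =
      expect (bind_pmf p (\<lambda>x. map_pmf (\<lambda>xs. x # xs) (replicate_pmf n p))) h"
    by (simp add: map_pmf_def)
  also have "\<dots> = expect p (\<lambda>x. expect (replicate_pmf n p) (\<lambda>xs. h (x # xs)))"
    by (subst expect_bind) (use assms in auto)
  finally show ?thesis .
qed

lemma expect_replicate_sum:
  assumes "finite (set_pmf p)" "expect p g = 0"
  shows "expect (replicate_pmf n p) (\<lambda>xs. \<Sum>x\<leftarrow>xs. g x) = 0"
proof (induction n)
  case (Suc n)
  note [simp] = integrable_measure_pmf_finite[OF assms(1)]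
    integrable_measure_pmf_finite[OF finite_set_replicate_pmf[OF assms(1)]]
  show ?case by (simp add: expect_replicate_Suc assms Suc del: replicate_pmf.simps)
qed auto

text \<open>When one draw is split off, the cross term contains the mean of the remaining sum, which
  is zero.\<close>

lemma expect_replicate_sum_square:
  assumes "finite (set_pmf p)" "expect p g = 0"
  shows "expect (replicate_pmf n p) (\<lambda>xs. (\<Sum>x\<leftarrow>xs. g x)\<^sup>2) = real n * expect p (\<lambda>x. (g x)\<^sup>2)"
proof (induction n)
  case (Suc n)
  note [simp] = integrable_measure_pmf_finite[OF assms(1)]
    integrable_measure_pmf_finite[OF finite_set_replicate_pmf[OF assms(1)]]
  have "expect (replicate_pmf n p) (\<lambda>xs. (g x + (\<Sum>x\<leftarrow>xs. g x))\<^sup>2) =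
     (g x)\<^sup>2 + real n * expect p (\<lambda>x. (g x)\<^sup>2)" for x
  proof -
    have "expect (replicate_pmf n p) (\<lambda>xs. (g x + (\<Sum>x\<leftarrow>xs. g x))\<^sup>2) =
       expect (replicate_pmf n p) (\<lambda>xs. (g x)\<^sup>2 + 2 * g x * (\<Sum>x\<leftarrow>xs. g x) + (\<Sum>x\<leftarrow>xs. g x)\<^sup>2)"
      by (intro expect_cong) (simp add: power2_sum)
    also have "\<dots> = (g x)\<^sup>2 + 2 * g x * expect (replicate_pmf n p) (\<lambda>xs. \<Sum>x\<leftarrow>xs. g x) +
        real n * expect p (\<lambda>x. (g x)\<^sup>2)"
      by (simp add: Suc)
    finally show ?thesis by (simp add: expect_replicate_sum[OF assms])
  qed
  then show ?case by (simp add: expect_replicate_Suc assms algebra_simps del: replicate_pmf.simps)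
qed auto

text \<open>Deviations of at most 1 give variance at most 1 per draw. This crude form is used both
  for the sums of random signs and for the error counts of hypotheses.\<close>

lemma chebyshev_replicate:
  assumes fin: "finite (set_pmf p)" and \<mu>: "expect p g = \<mu>"
    and b: "\<And>x. x \<in> set_pmf p \<Longrightarrow> \<bar>g x - \<mu>\<bar> \<le> 1" and t: "t > 0"
  shows "measure_pmf.prob (replicate_pmf n p) {xs. \<bar>(\<Sum>x\<leftarrow>xs. g x) - real n * \<mu>\<bar> \<ge> t} \<le> real n / t\<^sup>2"
proof -
  define h where "h x = g x - \<mu>" for x
  note [simp] = integrable_measure_pmf_finite[OF fin]
    integrable_measure_pmf_finite[OF finite_set_replicate_pmf[OF fin]]
  have h0: "expect p h = 0" unfolding h_def using \<mu> by simp
  have sum: "(\<Sum>x\<leftarrow>xs. g x) - real n * \<mu> = (\<Sum>x\<leftarrow>xs. h x)" if "length xs = n" for xs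
    using that unfolding h_def by (simp add: sum_list_subtractf sum_list_triv)
  have "expect p (\<lambda>x. (h x)\<^sup>2) \<le> expect p (\<lambda>x. 1)"
    by (rule expect_mono[OF fin]) (use b in \<open>simp add: h_def abs_le_square_iff[of _ 1, simplified]\<close>)
  then have v: "expect p (\<lambda>x. (h x)\<^sup>2) \<le> 1" by simp
  have "measure_pmf.prob (replicate_pmf n p) {xs. \<bar>(\<Sum>x\<leftarrow>xs. g x) - real n * \<mu>\<bar> \<ge> t} \<le>
      expect (replicate_pmf n p) (\<lambda>xs. (\<Sum>x\<leftarrow>xs. h x)\<^sup>2 / t\<^sup>2)"
  proof (rule prob_le_of_expect)
    fix xs assume xs: "xs \<in> set_pmf (replicate_pmf n p)" "xs \<in> {xs. \<bar>(\<Sum>x\<leftarrow>xs. g x) - real n * \<mu>\<bar> \<ge> t}"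
    then have "t \<le> \<bar>\<Sum>x\<leftarrow>xs. h x\<bar>" using sum[of xs] by (simp add: set_replicate_pmf)
    then have "t\<^sup>2 \<le> (\<Sum>x\<leftarrow>xs. h x)\<^sup>2" using t by (simp add: abs_le_square_iff[symmetric])
    then show "1 \<le> (\<Sum>x\<leftarrow>xs. h x)\<^sup>2 / t\<^sup>2" using t by simp
  qed (use fin in auto)
  also have "\<dots> = real n * expect p (\<lambda>x. (h x)\<^sup>2) / t\<^sup>2"
    by (simp add: expect_replicate_sum_square[OF fin h0])
  also have "\<dots> \<le> real n / t\<^sup>2"
    using v by (intro divide_right_mono) (auto intro: mult_left_le)
  finally show ?thesis .
qed

section \<open>Independence of pairs, blocks and positions\<close>

lemma map_replicate_pmf: "map_pmf (map f) (replicate_pmf n p) = replicate_pmf n (map_pmf f p)"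
proof (induction n)
  case (Suc n)
  have "map_pmf (map f) (replicate_pmf (Suc n) p) =
      do {x \<leftarrow> p; xs \<leftarrow> map_pmf (map f) (replicate_pmf n p); return_pmf (f x # xs)}"
    by (simp add: map_bind_pmf bind_map_pmf)
  then show ?case by (simp add: Suc bind_map_pmf)
qed simp

lemma replicate_pair_pmf:
  "replicate_pmf n (pair_pmf p q) = map_pmf (\<lambda>(xs, ys). zip xs ys) (pair_pmf (replicate_pmf n p) (replicate_pmf n q))"
proof (induction n)
  case (Suc n)
  have "replicate_pmf (Suc n) (pair_pmf p q) = do {x \<leftarrow> p; y \<leftarrow> q; xs \<leftarrow> replicate_pmf n p;
      ys \<leftarrow> replicate_pmf n q; return_pmf ((x, y) # zip xs ys)}"
    by (simp only: replicate_pmf.simps Suc) (simp add: pair_pmf_def map_pmf_def bind_assoc_pmf bind_return_pmf)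
  also have "\<dots> = do {x \<leftarrow> p; xs \<leftarrow> replicate_pmf n p; y \<leftarrow> q;
      ys \<leftarrow> replicate_pmf n q; return_pmf ((x, y) # zip xs ys)}"
    by (subst bind_commute_pmf) rule
  also have "\<dots> = map_pmf (\<lambda>(xs, ys). zip xs ys) (pair_pmf (replicate_pmf (Suc n) p) (replicate_pmf (Suc n) q))"
    by (simp add: pair_pmf_def map_pmf_def bind_assoc_pmf bind_return_pmf)
  finally show ?case .
qed (simp add: map_pmf_def bind_return_pmf pair_pmf_def)

text \<open>Given by indices, so that two nested maps over ranges compute it.\<close>

definition chunks :: "nat \<Rightarrow> nat \<Rightarrow> 'a list \<Rightarrow> 'a list list" where
  "chunks w k r = map (\<lambda>i. map (\<lambda>j. r ! (i * w + j)) [0..<w]) [0..<k]"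

lemma chunks_append:
  assumes "length xs = w" "w * k \<le> length ys"
  shows "chunks w (Suc k) (xs @ ys) = xs # chunks w k ys"
proof -
  have "chunks w (Suc k) (xs @ ys) = map (\<lambda>j. (xs @ ys) ! j) [0..<w] #
      map (\<lambda>i. map (\<lambda>j. (xs @ ys) ! (Suc i * w + j)) [0..<w]) [0..<k]"
    unfolding chunks_def by (simp add: map_upt_Suc del: upt_Suc)
  also have "map (\<lambda>j. (xs @ ys) ! j) [0..<w] = xs"
    using assms by (intro nth_equalityI) (auto simp: nth_append)
  also have "map (\<lambda>i. map (\<lambda>j. (xs @ ys) ! (Suc i * w + j)) [0..<w]) [0..<k] = chunks w k ys"
    unfolding chunks_def using assms by (simp add: nth_append)
  finally show ?thesis .
qed

lemma chunks_append2:
  assumes "w * k \<le> length xs"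
  shows "chunks w k (xs @ ys) = chunks w k xs"
proof -
  have "i * w + j < length xs" if "i < k" "j < w" for i j
  proof -
    have "i * w + j < Suc i * w" using that by simp
    also have "\<dots> \<le> k * w" using that by (intro mult_right_mono) auto
    finally show ?thesis using assms by (simp add: mult.commute)
  qed
  then show ?thesis unfolding chunks_def by (auto simp: nth_append)
qed

lemma set_chunks: "w * k \<le> length r \<Longrightarrow> cs \<in> set (chunks w k r) \<Longrightarrow> length cs = w"
  by (auto simp: chunks_def)

lemma length_chunks [simp]: "length (chunks w k r) = k"
  by (simp add: chunks_def)

lemma map_chunks_replicate_pmf:
  "map_pmf (chunks w k) (replicate_pmf (w * k) p) = replicate_pmf k (replicate_pmf w p)"
proof (induction k)
  case (Suc k)
  have "map_pmf (chunks w (Suc k)) (replicate_pmf (w * Suc k) p) =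
     do {xs \<leftarrow> replicate_pmf w p; ys \<leftarrow> replicate_pmf (w * k) p; return_pmf (chunks w (Suc k) (xs @ ys))}"
    by (simp add: replicate_pmf_distrib map_pmf_def bind_assoc_pmf bind_return_pmf)
  also have "\<dots> = do {xs \<leftarrow> replicate_pmf w p; ys \<leftarrow> replicate_pmf (w * k) p; return_pmf (xs # chunks w k ys)}"
    by (intro bind_pmf_cong refl) (simp add: chunks_append set_replicate_pmf)
  also have "\<dots> = do {xs \<leftarrow> replicate_pmf w p; yss \<leftarrow> map_pmf (chunks w k) (replicate_pmf (w * k) p); return_pmf (xs # yss)}"
    by (simp add: bind_map_pmf)
  also have "\<dots> = replicate_pmf (Suc k) (replicate_pmf w p)" by (simp add: Suc)
  finally show ?case .
qed (simp add: chunks_def map_pmf_def bind_return_pmf)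

text \<open>Since \<open>js\<close> is distinct, its head can be removed from the index set, and the
  remaining entries do not see the value chosen there.\<close>

lemma map_nth_Pi_pmf:
  assumes "finite A" "distinct js" "set js \<subseteq> A"
  shows "map_pmf (\<lambda>f. map f js) (Pi_pmf A d (\<lambda>_. p)) = replicate_pmf (length js) p"
  using assms
proof (induction js arbitrary: A)
  case Nil
  then show ?case by (simp add: map_pmf_def bind_return_pmf)
next
  case (Cons j js)
  let ?B = "A - {j}"
  have A: "A = insert j ?B" using Cons.prems by auto
  have "map_pmf (\<lambda>f. map f (j # js)) (Pi_pmf A d (\<lambda>_. p)) =
     map_pmf (\<lambda>f. map f (j # js)) (Pi_pmf (insert j ?B) d (\<lambda>_. p))" using A by simp
  also have "\<dots> = map_pmf (\<lambda>(y, f). map (f(j := y)) (j # js)) (pair_pmf p (Pi_pmf ?B d (\<lambda>_. p)))"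
    using Cons.prems by (subst Pi_pmf_insert) (auto simp: pmf.map_comp o_def case_prod_unfold simp del: list.map)
  also have "\<dots> = map_pmf (\<lambda>(y, f). y # map f js) (pair_pmf p (Pi_pmf ?B d (\<lambda>_. p)))"
    using Cons.prems by (intro map_pmf_cong refl) (auto simp: split_beta cong: map_cong)
  also have "\<dots> = do {y \<leftarrow> p; xs \<leftarrow> map_pmf (\<lambda>f. map f js) (Pi_pmf ?B d (\<lambda>_. p)); return_pmf (y # xs)}"
    by (simp add: pair_pmf_def map_pmf_def bind_assoc_pmf bind_return_pmf)
  also have "\<dots> = replicate_pmf (length (j # js)) p"
    using Cons.prems by (subst Cons.IH) auto
  finally show ?case .
qed

lemma map_nth_replicate_pmf:
  assumes "distinct js" "set js \<subseteq> {..<m}"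
  shows "map_pmf (\<lambda>J. map (\<lambda>j. J ! j) js) (replicate_pmf m p) = replicate_pmf (length js) p"
proof -
  have "replicate_pmf m p = map_pmf (\<lambda>f. map f [0..<m]) (Pi_pmf {..<m} undefined (\<lambda>_. p))"
    by (subst map_nth_Pi_pmf) auto
  then have "map_pmf (\<lambda>J. map (\<lambda>j. J ! j) js) (replicate_pmf m p) =
     map_pmf (\<lambda>f. map (\<lambda>j. map f [0..<m] ! j) js) (Pi_pmf {..<m} undefined (\<lambda>_. p))"
    by (simp add: pmf.map_comp o_def)
  also have "\<dots> = map_pmf (\<lambda>f. map f js) (Pi_pmf {..<m} undefined (\<lambda>_. p))"
    using assms by (intro map_pmf_cong refl map_cong) auto
  also have "\<dots> = replicate_pmf (length js) p" by (rule map_nth_Pi_pmf) (use assms in auto)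
  finally show ?thesis .
qed

lemma prob_map_pmf: "measure_pmf.prob (map_pmf f p) A = measure_pmf.prob p {x. f x \<in> A}"
  by (simp add: vimage_def)

section \<open>Collisions and repeated trials\<close>

lemma prob_mem_replicate_pmf:
  assumes "finite (set_pmf p)" "\<And>j. pmf p j \<le> \<beta>"
  shows "measure_pmf.prob p {j. j \<in> set js} \<le> real (length js) * \<beta>"
proof -
  have "measure_pmf.prob p (set js) = sum (pmf p) (set js)" by (simp add: measure_measure_pmf_finite)
  also have "\<dots> \<le> (\<Sum>j\<in>set js. \<beta>)" by (intro sum_mono assms)
  also have "\<dots> \<le> real (length js) * \<beta>"
    using order_trans[OF pmf_nonneg assms(2)] by (auto intro!: mult_right_mono card_length)
  finally show ?thesis by simp
qed

text \<open>The birthday bound: a new draw hits one of s earlier values with probability at most s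
  times \<beta>, and these add up to less than s^2 times \<beta> or equal to it.\<close>

lemma prob_not_distinct:
  assumes "finite (set_pmf p)" "\<And>j. pmf p j \<le> \<beta>"
  shows "measure_pmf.prob (replicate_pmf s p) {js. \<not> distinct js} \<le> (real s)\<^sup>2 * \<beta>"
proof (induction s)
  case (Suc s)
  have \<beta>: "0 \<le> \<beta>" using order_trans[OF pmf_nonneg assms(2)] .
  let ?R = "replicate_pmf s p"
  \<comment> \<open>The head is drawn after the tail, so that it meets a fixed list.\<close>
  have "replicate_pmf (Suc s) p = bind_pmf ?R (\<lambda>js. map_pmf (\<lambda>j. j # js) p)"
    by (simp add: map_pmf_def) (rule bind_commute_pmf)
  then have "measure_pmf.prob (replicate_pmf (Suc s) p) {js. \<not> distinct js} =
     expect ?R (\<lambda>js. measure_pmf.prob (map_pmf (\<lambda>j. j # js) p) {js. \<not> distinct js})"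
    using assms(1) by (simp only: prob_bind[OF finite_set_replicate_pmf[OF assms(1)]] pmf.set_map finite_imageI)
  also have "\<dots> \<le> expect ?R (\<lambda>js. real s * \<beta> + indicator {js. \<not> distinct js} js)"
  proof (rule expect_mono)
    fix js assume js: "js \<in> set_pmf ?R"
    show "measure_pmf.prob (map_pmf (\<lambda>j. j # js) p) {js. \<not> distinct js} \<le>
        real s * \<beta> + indicator {js. \<not> distinct js} js"
    proof (cases "distinct js")
      case True
      then show ?thesis using prob_mem_replicate_pmf[OF assms, of js] js
        by (simp add: prob_map_pmf set_replicate_pmf del: measure_map_pmf)
    next
      case False
      then show ?thesis using \<beta> measure_pmf.prob_le_1[of "map_pmf (\<lambda>j. j # js) p" "{js. \<not> distinct js}"]
        by (simp add: add_increasing del: measure_map_pmf)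
    qed
  qed (use assms in auto)
  also have "\<dots> = real s * \<beta> + measure_pmf.prob ?R {js. \<not> distinct js}"
    by (subst Bochner_Integration.integral_add)
       (auto intro!: integrable_measure_pmf_finite finite_set_replicate_pmf assms)
  also have "\<dots> \<le> real s * \<beta> + (real s)\<^sup>2 * \<beta>" using Suc by simp
  also have "\<dots> = (real s + (real s)\<^sup>2) * \<beta>" by (simp add: algebra_simps)
  also have "\<dots> \<le> (real (Suc s))\<^sup>2 * \<beta>"
    by (intro mult_right_mono \<beta>) (simp add: power2_eq_square algebra_simps)
  finally show ?case .
qed auto

lemma prob_replicate_all:
  assumes "finite (set_pmf p)"
  shows "measure_pmf.prob (replicate_pmf T p) {xs. \<forall>x\<in>set xs. x \<in> A} = measure_pmf.prob p A ^ T"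
proof (induction T)
  case (Suc T)
  have "measure_pmf.prob (replicate_pmf (Suc T) p) {xs. \<forall>x\<in>set xs. x \<in> A} =
     expect p (\<lambda>x. indicator A x * expect (replicate_pmf T p) (indicator {xs. \<forall>x\<in>set xs. x \<in> A}))"
    unfolding prob_eq_expect expect_replicate_Suc[OF assms]
  proof (intro expect_cong)
    fix x
    have "(\<lambda>xs. indicator {xs. \<forall>x\<in>set xs. x \<in> A} (x # xs) :: real) =
        (\<lambda>xs. indicator A x * indicator {xs. \<forall>x\<in>set xs. x \<in> A} xs)"
      by (auto simp: indicator_def)
    then show "expect (replicate_pmf T p) (\<lambda>xs. indicator {xs. \<forall>x\<in>set xs. x \<in> A} (x # xs)) =
        indicator A x * expect (replicate_pmf T p) (indicator {xs. \<forall>x\<in>set xs. x \<in> A})"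
      by simp
  qed
  then show ?case using Suc by simp
qed auto

lemma prob_replicate_ex:
  assumes "finite (set_pmf p)"
  shows "measure_pmf.prob (replicate_pmf T p) {xs. \<exists>x\<in>set xs. x \<in> A} \<le> real T * measure_pmf.prob p A"
proof (induction T)
  case (Suc T)
  note [simp] = integrable_measure_pmf_finite[OF assms(1)]
    integrable_measure_pmf_finite[OF finite_set_replicate_pmf[OF assms(1)]]
  let ?q = "expect (replicate_pmf T p) (indicator {xs. \<exists>x\<in>set xs. x \<in> A})"
  have "measure_pmf.prob (replicate_pmf (Suc T) p) {xs. \<exists>x\<in>set xs. x \<in> A} \<le>
     expect p (\<lambda>x. indicator A x + ?q)"
    unfolding prob_eq_expect expect_replicate_Suc[OF assms]
  proof (intro expect_mono assms)
    fix x
    have "expect (replicate_pmf T p) (\<lambda>xs. indicator {xs. \<exists>x\<in>set xs. x \<in> A} (x # xs)) \<le>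
      expect (replicate_pmf T p) (\<lambda>xs. indicator A x + indicator {xs. \<exists>x\<in>set xs. x \<in> A} xs)"
      by (intro expect_mono) (auto simp: assms indicator_def)
    then show "expect (replicate_pmf T p) (\<lambda>xs. indicator {xs. \<exists>x\<in>set xs. x \<in> A} (x # xs)) \<le> indicator A x + ?q"
      by simp
  qed
  also have "\<dots> = measure_pmf.prob p A + ?q" by simp
  finally show ?case using Suc by (simp add: algebra_simps)
qed auto

section \<open>Almost uniform indices from fair coins\<close>

abbreviation coin :: "bool pmf" where "coin \<equiv> pmf_of_set UNIV"

lemma replicate_coin: "replicate_pmf B coin = pmf_of_set {bs. length bs = B}"
proof -
  have fin: "finite {bs :: bool list. length bs = B}" using finite_lists_length_eq[of "UNIV :: bool set" B] by simp
  have ne: "{bs :: bool list. length bs = B} \<noteq> {}" using Ex_list_of_length by auto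
  have card: "card {bs :: bool list. length bs = B} = 2 ^ B"
    using card_lists_length_eq[of "UNIV :: bool set" B] by simp
  have "pmf (replicate_pmf B coin) bs = (if length bs = B then 1 / 2 ^ B else 0)" for bs
  proof (induction B arbitrary: bs)
    case (Suc B)
    show ?case
    proof (cases bs)
      case Nil
      then show ?thesis by (simp add: pmf_eq_0_set_pmf set_replicate_pmf del: replicate_pmf.simps)
    next
      case (Cons b bs')
      have "replicate_pmf (Suc B) coin = map_pmf (\<lambda>(x, xs). x # xs) (pair_pmf coin (replicate_pmf B coin))"
        by (simp add: pair_pmf_def map_pmf_def bind_assoc_pmf bind_return_pmf)
      moreover have "inj (\<lambda>(x :: bool, xs). x # xs)" by (auto simp: inj_def)
      ultimately have "pmf (replicate_pmf (Suc B) coin) bs = pmf (pair_pmf coin (replicate_pmf B coin)) (b, bs')"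
        using pmf_map_inj'[of "\<lambda>(x :: bool, xs). x # xs" _ "(b, bs')"] Cons by simp
      then show ?thesis using Suc[of bs'] Cons by (auto simp: pmf_pair field_simps simp del: replicate_pmf.simps)
    qed
  qed (auto simp: indicator_def)
  then show ?thesis
    using fin ne card by (intro pmf_eqI) (simp add: indicator_def)
qed

text \<open>Horner evaluation with the most significant bit first.\<close>

definition bin :: "bool list \<Rightarrow> nat" where
  "bin bs = fold (\<lambda>b v. 2 * v + of_bool b) bs 0"

text \<open>Reducing after each step keeps the intermediate values polynomial, as the program holds them
  in unary.\<close>

definition idx :: "nat \<Rightarrow> bool list \<Rightarrow> nat" where
  "idx m bs = fold (\<lambda>b v. if m \<le> 2 * v + of_bool b then 2 * v + of_bool b - m else 2 * v + of_bool b) bs 0"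

lemma fold_bin: "fold (\<lambda>b v. 2 * v + of_bool b) bs v = 2 ^ length bs * v + bin bs"
proof (induction bs arbitrary: v)
  case (Cons b bs)
  show ?case unfolding bin_def fold_simps comp_apply using Cons[of "2 * v + of_bool b"] Cons[of "of_bool b"]
    by (simp add: algebra_simps)
qed (simp add: bin_def)

lemma bin_Cons: "bin (b # bs) = 2 ^ length bs * of_bool b + bin bs"
  unfolding bin_def[of "b # bs"] by (simp add: fold_bin)

lemma bin_less: "bin bs < 2 ^ length bs"
  by (induction bs) (auto simp: bin_Cons bin_def[of "[]"])

lemma bin_inj: "length bs = length cs \<Longrightarrow> bin bs = bin cs \<Longrightarrow> bs = cs"
proof (induction bs cs rule: list_induct2)
  case (Cons b bs c cs)
  then show ?case using bin_less[of bs] bin_less[of cs] by (cases b; cases c) (auto simp: bin_Cons)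
qed auto

text \<open>For v < m the next value 2v + b is below 2m, so one subtraction per bit is a full
  reduction modulo m.\<close>

lemma idx_eq: "m > 0 \<Longrightarrow> idx m bs = bin bs mod m"
proof -
  assume m: "m > 0"
  have "fold (\<lambda>b v. if m \<le> 2 * v + of_bool b then 2 * v + of_bool b - m else 2 * v + of_bool b) bs (v mod m) =
     fold (\<lambda>b v. 2 * v + of_bool b) bs v mod m" for v
  proof (induction bs arbitrary: v)
    case (Cons b bs)
    let ?u = "2 * (v mod m) + of_bool b"
    have "v mod m + 1 \<le> m" using m by (simp add: Suc_leI)
    then have "?u < 2 * m" by (cases b) auto
    then have "(if m \<le> ?u then ?u - m else ?u) = ?u mod m"
      by (auto simp: le_mod_geq)
    also have "\<dots> = (2 * v + of_bool b) mod m" by (metis mod_add_left_eq mod_mult_right_eq)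
    finally show ?case using Cons[of "2 * v + of_bool b"] by simp
  qed simp
  from this[of 0] show ?thesis by (simp add: idx_def bin_def)
qed

lemma idx_less: "m > 0 \<Longrightarrow> idx m bs < m"
  by (simp add: idx_eq)

text \<open>Within a residue class modulo m a number is determined by its quotient, so at most 2^B
  div m + 1 of the 2^B bit strings lead to the same index. The extra string costs 1/2^B.\<close>

lemma pmf_idx:
  assumes m: "m > 0"
  shows "pmf (map_pmf (idx m) (replicate_pmf B coin)) j \<le> 1 / real m + 1 / 2 ^ B"
proof -
  let ?S = "{bs :: bool list. length bs = B}"
  have fin: "finite ?S" using finite_lists_length_eq[of "UNIV :: bool set" B] by simp
  have ne: "?S \<noteq> {}" using Ex_list_of_length by auto
  have card: "card ?S = 2 ^ B" using card_lists_length_eq[of "UNIV :: bool set" B] by simp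
  let ?C = "{c. c < 2 ^ B \<and> c mod m = j}"
  have "card (?S \<inter> {bs. idx m bs = j}) \<le> card ?C"
  proof (rule card_inj_on_le[where f = bin])
    show "inj_on bin (?S \<inter> {bs. idx m bs = j})" by (auto simp: inj_on_def intro: bin_inj)
    show "bin ` (?S \<inter> {bs. idx m bs = j}) \<subseteq> ?C" using m bin_less by (auto simp: idx_eq)
  qed auto
  also have "card ?C \<le> card {..2 ^ B div m}"
  proof (rule card_inj_on_le[where f = "\<lambda>c. c div m"])
    show "inj_on (\<lambda>c. c div m) ?C"
    proof (rule inj_onI)
      fix c d assume "c \<in> ?C" "d \<in> ?C" "c div m = d div m"
      then show "c = d" using div_mult_mod_eq[of c m] div_mult_mod_eq[of d m] by simp
    qed
    show "(\<lambda>c. c div m) ` ?C \<subseteq> {..2 ^ B div m}" by (auto intro: div_le_mono)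
  qed auto
  finally have c: "card (?S \<inter> {bs. idx m bs = j}) \<le> 2 ^ B div m + 1" by simp
  have "pmf (map_pmf (idx m) (replicate_pmf B coin)) j = real (card (?S \<inter> {bs. idx m bs = j})) / 2 ^ B"
    unfolding replicate_coin pmf_map using fin ne card
    by (simp add: measure_pmf_of_set vimage_def)
  also have "\<dots> \<le> (real (2 ^ B div m) + 1) / 2 ^ B"
    using c by (intro divide_right_mono) (auto simp: of_nat_le_iff[symmetric, where 'a = real] simp del: of_nat_le_iff)
  also have "\<dots> \<le> (2 ^ B / real m + 1) / 2 ^ B"
  proof (intro divide_right_mono add_right_mono)
    have "real (2 ^ B div m * m) \<le> real (2 ^ B)" by (simp only: of_nat_le_iff) simp
    then show "real (2 ^ B div m) \<le> 2 ^ B / real m" using m by (simp add: field_simps)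
  qed auto
  also have "\<dots> = 1 / real m + 1 / 2 ^ B" by (simp add: add_divide_distrib)
  finally show ?thesis .
qed
section \<open>Parities as halfspaces\<close>

text \<open>Indexing instead of zipping preserves the length of \<open>C\<close> for every
  \<open>bs\<close>, which makes flipping an involution without any side condition.\<close>

definition flip :: "ktuple \<Rightarrow> bool list \<Rightarrow> ktuple" where
  "flip C bs = map (\<lambda>j. (fst (C ! j), if bs ! j then - snd (C ! j) else snd (C ! j))) [0..<length C]"

definition label :: "bool list \<Rightarrow> int" where
  "label bs = (\<Prod>b\<leftarrow>bs. if b then -1 else 1)"

text \<open>The fold is a lookup with default 0; in a tuple at most one entry matches an
  index.\<close>

definition kvec :: "nat \<Rightarrow> ktuple \<Rightarrow> int list" where
  "kvec n C = map (\<lambda>i. fold (\<lambda>q acc. if fst q = i then snd q else acc) C 0) [0..<n]"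

text \<open>The D-th tensor power of the vector \<open>1 # x\<close>. The leading 1 provides the
  constant terms, so the entries contain all monomials of degree up to D that products of affine
  forms need.\<close>

fun tens :: "nat \<Rightarrow> int list \<Rightarrow> int list" where
  "tens 0 x = [1]"
| "tens (Suc D) x = concat (map (\<lambda>a. map (\<lambda>b. a * b) (1 # x)) (tens D x))"

fun tens_weights :: "real list list \<Rightarrow> real list" where
  "tens_weights [] = [1]"
| "tens_weights (u # us) = concat (map (\<lambda>a. map (\<lambda>b. a * b) u) (tens_weights us))"

definition dot :: "real list \<Rightarrow> int list \<Rightarrow> real" where
  "dot w x = (\<Sum>p\<leftarrow>zip w x. fst p * real_of_int (snd p))"

section \<open>Products of affine forms as linear forms on tensor powers\<close>

lemma dot_Nil [simp]: "dot [] x = 0" "dot w [] = 0"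
  by (auto simp: dot_def)

lemma dot_Cons [simp]: "dot (a # w) (b # x) = a * real_of_int b + dot w x"
  by (auto simp: dot_def)

lemma dot_append: "length w = length x \<Longrightarrow> dot (w @ w') (x @ x') = dot w x + dot w' x'"
  by (simp add: dot_def)

lemma dot_scale: "dot (map (\<lambda>b. a * b) w) (map (\<lambda>c. d * c) x) = a * real_of_int d * dot w x"
proof (induction w arbitrary: x)
  case (Cons b w)
  then show ?case by (cases x) (auto simp: algebra_simps)
qed simp

text \<open>Inner products of tensors factorise; the equal lengths align the blocks of the two
  concatenations.\<close>

lemma dot_tensor:
  assumes "length w = length x" "length u = length y"
  shows "dot (concat (map (\<lambda>a. map (\<lambda>b. a * b) u) w)) (concat (map (\<lambda>a. map (\<lambda>b. a * b) y) x)) =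
    dot w x * dot u y"
  using assms(1)
proof (induction w x rule: list_induct2)
  case (Cons a w b x)
  then show ?case using assms(2) by (simp add: dot_append dot_scale algebra_simps)
qed simp

lemma length_tens: "length (tens D x) = (length x + 1) ^ D"
  by (induction D) (auto simp: length_concat o_def sum_list_triv)

lemma length_tens_weights:
  "(\<And>u. u \<in> set us \<Longrightarrow> length u = l) \<Longrightarrow> length (tens_weights us) = l ^ length us"
  by (induction us) (auto simp: length_concat o_def sum_list_triv)

lemma dot_tens:
  assumes "\<And>u. u \<in> set us \<Longrightarrow> length u = length x + 1"
  shows "dot (tens_weights us) (tens (length us) x) = (\<Prod>u\<leftarrow>us. dot u (1 # x))"
  using assms
proof (induction us)
  case (Cons u us)
  have "length (tens_weights us) = length (tens (length us) x)"
    unfolding length_tens by (rule length_tens_weights) (use Cons.prems in auto)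
  moreover have "length u = length (1 # x)" using Cons.prems by simp
  ultimately show ?case
    unfolding tens_weights.simps list.size add_0_right add_Suc_right tens.simps
    by (subst dot_tensor) (use Cons in auto)
qed simp

lemma dot_eq_sum: "length w = length x \<Longrightarrow> dot w x = (\<Sum>i<length x. w ! i * real_of_int (x ! i))"
proof (induction w x rule: list_induct2)
  case (Cons a w b x)
  then show ?case by (simp add: sum.lessThan_Suc_shift del: sum.lessThan_Suc)
qed simp

lemma halfspace_eq: "length w = length x \<Longrightarrow> halfspace (\<lambda>i. w ! i) x = sgn (dot w x)"
  by (simp add: halfspace_def dot_eq_sum)

lemma set_tens: "set x \<subseteq> {-1, 1, 0} \<Longrightarrow> set (tens D x) \<subseteq> {-1, 1, 0}"
proof (induction D)
  case (Suc D)
  have m: "a * b \<in> {-1, 1, 0}" if "a \<in> {-1, 1, 0}" "b \<in> {-1, 1, 0}" for a b :: int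
    using that by auto
  have "a * b \<in> {-1, 1, 0}" if "a \<in> set (tens D x)" "b \<in> set (1 # x)" for a b
    by (rule m) (use that Suc in auto)
  moreover have "\<exists>a b. a \<in> set (tens D x) \<and> b \<in> set (1 # x) \<and> y = a * b"
    if "y \<in> set (tens (Suc D) x)" for y
  proof -
    obtain a where "a \<in> set (tens D x)" "y \<in> set (map (\<lambda>b. a * b) (1 # x))" using \<open>y \<in> _\<close> by auto
    then show ?thesis unfolding set_map by blast
  qed
  ultimately show ?case by blast
qed simp

section \<open>Signed tuples and their vectors\<close>

lemma length_flip [simp]: "length (flip C bs) = length C"
  by (simp add: flip_def)

lemma map_fst_flip [simp]: "map fst (flip C bs) = map fst C"
  by (intro nth_equalityI) (auto simp: flip_def)

lemma ktuplesD:
  assumes "C \<in> ktuples n K"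
  shows "length C = K" "distinct (map fst C)" "set C \<subseteq> {..<n} \<times> {-1, 1}"
  using assms by (auto simp: ktuples_def)

lemma flip_in_ktuples: "C \<in> ktuples n K \<Longrightarrow> flip C bs \<in> ktuples n K"
proof -
  assume C: "C \<in> ktuples n K"
  have "(fst (C ! j), if bs ! j then - snd (C ! j) else snd (C ! j)) \<in> {..<n} \<times> {-1, 1}"
    if "j < length C" for j
  proof -
    have "C ! j \<in> {..<n} \<times> {-1, 1}" using ktuplesD(3)[OF C] that nth_mem by blast
    then show ?thesis by (cases "C ! j") auto
  qed
  then have "set (flip C bs) \<subseteq> {..<n} \<times> {-1, 1}" by (force simp: flip_def)
  then show ?thesis using ktuplesD[OF C] by (simp add: ktuples_def del: distinct_map)
qed

lemma flip_flip: "flip (flip C bs) bs = C"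
  by (intro nth_equalityI) (auto simp: flip_def)

lemma finite_ktuples [simp]: "finite (ktuples n K)"
  by (rule finite_subset[OF _ finite_lists_length_eq[of "{..<n} \<times> {-1, 1 :: int}" K]]) (auto simp: ktuples_def)

lemma ktuples_nonempty: "K \<le> n \<Longrightarrow> ktuples n K \<noteq> {}"
proof -
  assume "K \<le> n"
  then have "map (\<lambda>i. (i, 1)) [0..<K] \<in> ktuples n K" by (auto simp: ktuples_def o_def)
  then show ?thesis by auto
qed

text \<open>An involution on the tuples is a bijection. This is the source of the independence of
  instance and label for random formulas: the flips leave no trace in a uniform tuple.\<close>

lemma map_flip_uniform:
  assumes "K \<le> n"
  shows "map_pmf (\<lambda>C. flip C bs) (pmf_of_set (ktuples n K)) = pmf_of_set (ktuples n K)"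
proof -
  have inj: "inj_on (\<lambda>C. flip C bs) (ktuples n K)" by (metis flip_flip inj_onI)
  have "(\<lambda>C. flip C bs) ` ktuples n K = ktuples n K"
    by (rule endo_inj_surj) (use inj flip_in_ktuples in auto)
  then show ?thesis using map_pmf_of_set_inj[OF inj ktuples_nonempty[OF assms] finite_ktuples] by simp
qed

lemma length_kvec [simp]: "length (kvec n C) = n"
  by (simp add: kvec_def)

lemma sum_list_lookup_0: "i \<notin> fst ` set C \<Longrightarrow> (\<Sum>q\<leftarrow>C. if fst q = i then snd q else 0 :: int) = 0"
  by (induction C) auto

text \<open>With distinct indices at most one summand is nonzero. The sum, unlike the lookup, can be
  exchanged with the summation over coordinates in \<open>sum_kvec\<close>.\<close>

lemma fold_lookup:
  "distinct (map fst C) \<Longrightarrow> fold (\<lambda>q acc. if fst q = i then snd q else acc) C a =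
    (if i \<in> fst ` set C then (\<Sum>q\<leftarrow>C. if fst q = i then snd q else 0) else a :: int)"
proof (induction C arbitrary: a)
  case (Cons q C)
  then show ?case using sum_list_lookup_0[of i C] by auto
qed simp

lemma kvec_nth:
  assumes "distinct (map fst C)" "i < n"
  shows "kvec n C ! i = (\<Sum>q\<leftarrow>C. if fst q = i then snd q else 0)"
  using assms sum_list_lookup_0[of i C] by (auto simp: kvec_def fold_lookup)

lemma sum_kvec:
  assumes C: "distinct (map fst C)" "set C \<subseteq> {..<n} \<times> S"
  shows "(\<Sum>i<n. \<psi> ! i * kvec n C ! i) = sum_list (apply_ktuple C \<psi>)"
proof -
  have "(\<Sum>i<n. \<psi> ! i * kvec n C ! i) = (\<Sum>i<n. \<Sum>q\<leftarrow>C. if fst q = i then \<psi> ! i * snd q else 0)"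
    using C(1) by (intro sum.cong refl) (simp add: kvec_nth sum_list_const_mult[symmetric] if_distrib cong: if_cong)
  also have "\<dots> = (\<Sum>q\<leftarrow>C. \<psi> ! fst q * snd q)"
    using C(2)
  proof (induction C)
    case (Cons q C)
    then have "fst q < n" by auto
    then have "(\<Sum>i<n. if fst q = i then \<psi> ! i * snd q else 0) = \<psi> ! fst q * snd q"
      by (simp add: sum.delta')
    then show ?case using Cons by (simp add: sum.distrib)
  qed simp
  finally show ?thesis by (simp add: apply_ktuple_def case_prod_unfold mult.commute)
qed

lemma lookup_in:
  "set C \<subseteq> A \<times> {-1, 1 :: int} \<Longrightarrow> a \<in> {-1, 1, 0} \<Longrightarrow>
    fold (\<lambda>q acc. if fst q = i then snd q else acc) C a \<in> {-1, 1, 0}"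
proof (induction C arbitrary: a)
  case (Cons q C)
  then have "(if fst q = i then snd q else a) \<in> {-1, 1, 0}" by auto
  with Cons show ?case by simp
qed simp

lemma set_kvec: "C \<in> ktuples n K \<Longrightarrow> set (kvec n C) \<subseteq> {-1, 1, 0}"
  using lookup_in[OF ktuplesD(3)[of C n K]] by (auto simp: kvec_def)

definition flip_example :: "nat \<Rightarrow> nat \<Rightarrow> ktuple \<Rightarrow> bool list \<Rightarrow> int list \<times> int" where
  "flip_example n D C bs = (tens D (kvec n (flip C bs)), label bs)"

lemma label_in: "label bs \<in> {-1, 1}"
  unfolding label_def by (induction bs) auto

lemma flip_example_in: "C \<in> ktuples n K \<Longrightarrow> flip_example n D C bs \<in> examples ((n + 1) ^ D)"
  using set_tens[OF set_kvec[OF flip_in_ktuples, of C n K bs], of D] label_in[of bs]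
  by (auto simp: flip_example_def examples_def instances_def length_tens)

section \<open>A polynomial whose sign is the parity\<close>

definition roots :: "nat \<Rightarrow> nat \<Rightarrow> int list" where
  "roots A D = map (\<lambda>i. 2 * int i + 1 - 2 * int A) [0..<D]"

text \<open>The roots are the odd integers from 1 - 2A on, and the even point 2(i - A) lies just
  below the root number i. Exactly D - i roots are above it, each giving a negative factor.\<close>

lemma sgn_prod_roots:
  assumes "i \<le> D"
  shows "sgn (\<Prod>r\<leftarrow>roots A D. 2 * (int i - int A) - r) = (- 1) ^ (D - i)"
  using assms
proof (induction D)
  case (Suc D)
  show ?case
  proof (cases "i \<le> D")
    case True
    then have "sgn (2 * (int i - int A) - (2 * int D + 1 - 2 * int A)) = -1" by (simp add: sgn_if)
    then show ?thesis using Suc True by (simp add: roots_def sgn_mult Suc_diff_le)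
  next
    case False
    then have i: "i = Suc D" using Suc.prems by simp
    \<comment> \<open>At the last point no root lies above and all factors are positive; the bound
      \<open>E\<close> permits an induction with the point held fixed.\<close>
    have "sgn (\<Prod>r\<leftarrow>roots A E. 2 * (int i - int A) - r) = 1" if "E \<le> i" for E
      using that
    proof (induction E)
      case (Suc E)
      then have "sgn (2 * (int i - int A) - (2 * int E + 1 - 2 * int A)) = 1" by (simp add: sgn_if)
      then show ?case using Suc by (simp add: roots_def sgn_mult)
    qed (simp add: roots_def)
    from this[of "Suc D"] show ?thesis using i by simp
  qed
qed (simp add: roots_def)

lemma sum_prod_signs:
  "set z \<subseteq> {-1, 1 :: int} \<Longrightarrow> \<exists>k \<le> length z. sum_list z = int (length z) - 2 * int k \<and> prod_list z = (- 1) ^ k"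
proof (induction z)
  case (Cons a z)
  then obtain k where k: "k \<le> length z" "sum_list z = int (length z) - 2 * int k" "prod_list z = (- 1) ^ k"
    by auto
  show ?case
  proof (cases "a = 1")
    case True
    then show ?thesis using k by (intro exI[of _ k]) auto
  next
    case False
    then have "a = -1" using Cons.prems by auto
    then show ?thesis using k by (intro exI[of _ "Suc k"]) auto
  qed
qed simp

text \<open>With l entries -1 the sum is 4k - 2l, which is the point i = 2k - l + A of
  \<open>sgn_prod_roots\<close>. The resulting sign (-1)^(2A - i) agrees with (-1)^l because A is
  even; this and the divisibility of the length by 4 prevent a global change of sign.\<close>

lemma sgn_roots_eq_prod:
  assumes z: "set z \<subseteq> {-1, 1}" "length z = 4 * k" "even A" "\<bar>sum_list z\<bar> \<le> 2 * int A"
  shows "sgn (\<Prod>r\<leftarrow>roots A (2 * A). sum_list z - r) = prod_list z"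
proof -
  obtain l where l: "l \<le> length z" "sum_list z = int (length z) - 2 * int l" "prod_list z = (- 1) ^ l"
    using sum_prod_signs[OF z(1)] by auto
  \<comment> \<open>The bound on the sum puts the argument of \<open>nat\<close> between 0 and 2A,
    so nothing is truncated.\<close>
  define i where "i = nat (2 * int k - int l + int A)"
  have i: "int i = 2 * int k - int l + int A" unfolding i_def using z l by auto
  have "i \<le> 2 * A" using i z l by auto
  have s: "sum_list z = 2 * (int i - int A)" using i l z by simp
  have "sgn (\<Prod>r\<leftarrow>roots A (2 * A). sum_list z - r) = (- 1) ^ (2 * A - i)"
    unfolding s by (rule sgn_prod_roots) fact
  also have "even (2 * A - i) \<longleftrightarrow> even l"
  proof -
    have "int (2 * A - i) = int A - 2 * int k + int l" using i \<open>i \<le> 2 * A\<close> by simp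
    then have "even (int (2 * A - i)) \<longleftrightarrow> even (int l)" using z(3) by simp
    then show ?thesis by simp
  qed
  then have "(- 1 :: int) ^ (2 * A - i) = (- 1) ^ l" by (metis neg_one_even_power neg_one_odd_power)
  finally show ?thesis using l by simp
qed

text \<open>The root \<open>r\<close> contributes the affine form with constant term
  \<open>-r\<close> and linear part \<psi>, whose value at the vector of a tuple is the sum of its
  literals minus \<open>r\<close>.\<close>

definition weights :: "nat \<Rightarrow> int list \<Rightarrow> real list" where
  "weights A \<psi> = tens_weights (map (\<lambda>r. - real_of_int r # map real_of_int \<psi>) (roots A (2 * A)))"

lemma length_roots [simp]: "length (roots A D) = D"
  by (simp add: roots_def)

lemma of_int_prod_list: "real_of_int (\<Prod>r\<leftarrow>rs. f r) = (\<Prod>r\<leftarrow>rs. real_of_int (f r))"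
  by (induction rs) auto

lemma dot_weights:
  assumes "C \<in> ktuples n K" "length \<psi> = n"
  shows "dot (weights A \<psi>) (tens (2 * A) (kvec n C)) =
     real_of_int (\<Prod>r\<leftarrow>roots A (2 * A). sum_list (apply_ktuple C \<psi>) - r)"
proof -
  let ?us = "map (\<lambda>r. - real_of_int r # map real_of_int \<psi>) (roots A (2 * A))"
  have "dot (tens_weights ?us) (tens (length ?us) (kvec n C)) = (\<Prod>u\<leftarrow>?us. dot u (1 # kvec n C))"
    by (rule dot_tens) (use assms in auto)
  moreover have "dot (map real_of_int \<psi>) (kvec n C) = real_of_int (sum_list (apply_ktuple C \<psi>))"
    using sum_kvec[OF ktuplesD(2,3)[OF assms(1)], of \<psi>] assms(2) by (simp add: dot_eq_sum flip: of_int_mult of_int_sum)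
  ultimately show ?thesis unfolding weights_def
    by (simp add: o_def of_int_prod_list)
qed
section \<open>Examples drawn from a formula\<close>

definition signs :: "int list \<Rightarrow> bool list \<Rightarrow> int list" where
  "signs z bs = map2 (\<lambda>a b. if b then - a else a) z bs"

lemma apply_ktuple_flip:
  "length bs = length C \<Longrightarrow> apply_ktuple (flip C bs) \<psi> = signs (apply_ktuple C \<psi>) bs"
  by (intro nth_equalityI) (auto simp: apply_ktuple_def flip_def signs_def split_beta)

lemma prod_list_signs: "length z = length bs \<Longrightarrow> prod_list (signs z bs) = label bs * prod_list z"
  by (induction z bs rule: list_induct2) (auto simp: signs_def label_def)

lemma set_signs: "set z \<subseteq> {-1, 1} \<Longrightarrow> set (signs z bs) \<subseteq> {-1, 1}"
  by (fastforce simp: signs_def dest!: set_zip_leftD)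

lemma set_apply_ktuple:
  assumes "C \<in> ktuples n K" "\<psi> \<in> sign_vectors n"
  shows "set (apply_ktuple C \<psi>) \<subseteq> {-1, 1}"
proof
  fix y assume "y \<in> set (apply_ktuple C \<psi>)"
  then obtain q where q: "q \<in> set C" "y = snd q * \<psi> ! fst q" by (auto simp: apply_ktuple_def)
  then have "fst q < n" "snd q \<in> {-1, 1}" using ktuplesD(3)[OF assms(1)] by auto
  moreover have "set \<psi> \<subseteq> {-1, 1}" "length \<psi> = n" using assms(2) by (auto simp: sign_vectors_def)
  then have "\<psi> ! fst q \<in> {-1, 1}" using nth_mem[of "fst q" \<psi>] \<open>fst q < n\<close> by blast
  ultimately show "y \<in> {-1, 1}" using q by auto
qed

lemma map_sign_coin:
  assumes "a \<in> {-1, 1 :: int}"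
  shows "map_pmf (\<lambda>b. if b then - a else a) coin = pmf_of_set {-1, 1}"
proof -
  have "inj (\<lambda>b. if b then - a else a)" using assms by (auto simp: inj_def)
  moreover have "range (\<lambda>b. if b then - a else a) = {-1, 1}" using assms by (auto simp: UNIV_bool)
  ultimately show ?thesis by (subst map_pmf_of_set_inj) auto
qed

lemma map_signs_coins:
  "set z \<subseteq> {-1, 1} \<Longrightarrow>
    map_pmf (signs z) (replicate_pmf (length z) coin) = replicate_pmf (length z) (pmf_of_set {-1, 1})"
proof (induction z)
  case (Cons a z)
  have "map_pmf (signs (a # z)) (replicate_pmf (length (a # z)) coin) =
     do {x \<leftarrow> map_pmf (\<lambda>b. if b then - a else a) coin; xs \<leftarrow> map_pmf (signs z) (replicate_pmf (length z) coin);
         return_pmf (x # xs)}"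
    by (simp add: map_bind_pmf bind_map_pmf signs_def)
  also have "\<dots> = replicate_pmf (length (a # z)) (pmf_of_set {-1, 1})"
    using Cons by (subst map_sign_coin) auto
  finally show ?case .
qed (simp add: signs_def)

definition example_pmf :: "nat \<Rightarrow> nat \<Rightarrow> nat \<Rightarrow> ktuple \<Rightarrow> (int list \<times> int) pmf" where
  "example_pmf n D K C = map_pmf (flip_example n D C) (replicate_pmf K coin)"

lemma expect_sign: "expect (pmf_of_set {-1, 1 :: int}) real_of_int = 0"
  by (simp add: integral_pmf_of_set)

text \<open>The label is the parity of the flipped literals, so the halfspace errs only if their sum
  leaves the range of the roots. They are K uniform signs, and Chebyshev's bound at 2A = 40a is 8a^2
  / (40a)^2 = 1/200.\<close>

lemma example_pmf_error:
  assumes C: "C \<in> ktuples n (8 * a\<^sup>2)" and \<psi>: "\<psi> \<in> sign_vectors n" and a: "a > 0"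
    and sat: "XOR (apply_ktuple C \<psi>) = 1"
  shows "measure_pmf.prob (example_pmf n (40 * a) (8 * a\<^sup>2) C)
     {(x, y). halfspace (\<lambda>i. weights (20 * a) \<psi> ! i) x \<noteq> real_of_int y} \<le> 1 / 200"
proof -
  let ?K = "8 * a\<^sup>2"
  let ?A = "20 * a"
  let ?z = "apply_ktuple C \<psi>"
  have lz: "length ?z = ?K" using ktuplesD(1)[OF C] by (simp add: apply_ktuple_def)
  have sz: "set ?z \<subseteq> {-1, 1}" by (rule set_apply_ktuple[OF C \<psi>])
  have l\<psi>: "length \<psi> = n" using \<psi> by (simp add: sign_vectors_def)
  have lw: "length (weights ?A \<psi>) = (n + 1) ^ (40 * a)"
    unfolding weights_def by (subst length_tens_weights[where l = "n + 1"]) (auto simp: l\<psi>)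
  have key: "real (40 * a) \<le> \<bar>(\<Sum>x\<leftarrow>signs ?z bs. real_of_int x) - real ?K * 0\<bar>"
    if bs: "length bs = ?K" and e: "halfspace (\<lambda>i. weights ?A \<psi> ! i) (fst (flip_example n (40 * a) C bs)) \<noteq>
      real_of_int (snd (flip_example n (40 * a) C bs))" for bs
  proof (rule ccontr)
    assume n: "\<not> real (40 * a) \<le> \<bar>(\<Sum>x\<leftarrow>signs ?z bs. real_of_int x) - real ?K * 0\<bar>"
    have "(\<Sum>x\<leftarrow>signs ?z bs. real_of_int x) = real_of_int (sum_list (signs ?z bs))"
      by (simp add: sum_list_of_int[symmetric] del: sum_list_of_int)
    with n have "\<bar>real_of_int (sum_list (signs ?z bs))\<bar> \<le> real_of_int (2 * int ?A)" by simp
    then have s: "\<bar>sum_list (signs ?z bs)\<bar> \<le> 2 * int ?A" by linarith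
    \<comment> \<open>K is four times 2a^2 and A = 20a is even, as the sign of the polynomial
      requires.\<close>
    have "sgn (\<Prod>r\<leftarrow>roots ?A (2 * ?A). sum_list (signs ?z bs) - r) = prod_list (signs ?z bs)"
      by (rule sgn_roots_eq_prod[where k = "2 * a\<^sup>2"])
         (use s set_signs[OF sz] lz bs in \<open>auto simp: signs_def\<close>)
    also have "\<dots> = label bs" using sat bs lz by (simp add: prod_list_signs XOR_def)
    finally have sg: "sgn (\<Prod>r\<leftarrow>roots ?A (2 * ?A). sum_list (signs ?z bs) - r) = label bs" .
    have sgi: "sgn (real_of_int x) = real_of_int (sgn x)" for x by (simp add: sgn_if)
    have C': "flip C bs \<in> ktuples n ?K" by (rule flip_in_ktuples[OF C])
    have "dot (weights ?A \<psi>) (tens (2 * ?A) (kvec n (flip C bs))) =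
        real_of_int (\<Prod>r\<leftarrow>roots ?A (2 * ?A). sum_list (signs ?z bs) - r)"
      using dot_weights[OF C' l\<psi>, of ?A] apply_ktuple_flip[of bs C \<psi>] bs ktuplesD(1)[OF C] by simp
    then have "sgn (dot (weights ?A \<psi>) (tens (40 * a) (kvec n (flip C bs)))) = real_of_int (label bs)"
      using sgi[of "\<Prod>r\<leftarrow>roots ?A (2 * ?A). sum_list (signs ?z bs) - r"] sg by simp
    then have "halfspace (\<lambda>i. weights ?A \<psi> ! i) (tens (40 * a) (kvec n (flip C bs))) = real_of_int (label bs)"
      by (subst halfspace_eq) (auto simp: lw length_tens)
    then show False using e by (simp add: flip_example_def)
  qed
  have "measure_pmf.prob (example_pmf n (40 * a) ?K C)
     {(x, y). halfspace (\<lambda>i. weights ?A \<psi> ! i) x \<noteq> real_of_int y} \<le>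
     measure_pmf.prob (replicate_pmf ?K coin)
      {bs. real (40 * a) \<le> \<bar>(\<Sum>x\<leftarrow>signs ?z bs. real_of_int x) - real ?K * 0\<bar>}"
    unfolding example_pmf_def prob_map_pmf
    by (rule prob_mono_supp) (use key in \<open>auto simp: set_replicate_pmf split_beta\<close>)
  \<comment> \<open>Random flips of fixed literals are uniform signs, so \<psi> and the tuple
    disappear from the estimate.\<close>
  also have "\<dots> = measure_pmf.prob (map_pmf (signs ?z) (replicate_pmf (length ?z) coin))
      {xs. real (40 * a) \<le> \<bar>(\<Sum>x\<leftarrow>xs. real_of_int x) - real ?K * 0\<bar>}"
    unfolding prob_map_pmf lz by simp
  also have "\<dots> \<le> real ?K / (real (40 * a))\<^sup>2"
    unfolding lz map_signs_coins[OF sz, unfolded lz]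
    by (rule chebyshev_replicate) (use a expect_sign in auto)
  also have "\<dots> = 1 / 200" using a by (simp add: power2_eq_square field_simps)
  finally show ?thesis .
qed

text \<open>Using m coins, far more than the length of an index, is still polynomial, and 2^m being
  at least 2m limits the bias to half of 1/m.\<close>

definition index_pmf :: "nat \<Rightarrow> nat pmf" where
  "index_pmf m = map_pmf (idx m) (replicate_pmf m coin)"

lemma two_mult_le_power: "m > 0 \<Longrightarrow> 2 * m \<le> 2 ^ m" for m :: nat
proof (induction m rule: nat_induct_non_zero)
  case (Suc m)
  then show ?case by (simp add: Suc_le_eq)
qed simp

lemma pmf_index:
  assumes "m > 0"
  shows "pmf (index_pmf m) j \<le> 3 / (2 * real m)"
proof -
  have "real (2 * m) \<le> real (2 ^ m)" using two_mult_le_power[OF assms] by (rule of_nat_mono)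
  then have "1 / 2 ^ m \<le> 1 / (2 * real m)" using assms by (intro divide_left_mono) auto
  with pmf_idx[OF assms, of m j] have "pmf (index_pmf m) j \<le> 1 / real m + 1 / (2 * real m)"
    unfolding index_pmf_def by linarith
  then show ?thesis using assms by (simp add: field_simps)
qed

lemma set_index_pmf: "m > 0 \<Longrightarrow> set_pmf (index_pmf m) \<subseteq> {..<m}"
  by (auto simp: index_pmf_def idx_less)

lemma finite_set_index_pmf [simp]: "finite (set_pmf (index_pmf m))"
  by (auto simp: index_pmf_def)

definition formula_pmf :: "nat \<Rightarrow> nat \<Rightarrow> nat \<Rightarrow> ktuple list \<Rightarrow> (int list \<times> int) pmf" where
  "formula_pmf n D K J = map_pmf (\<lambda>(j, bs). flip_example n D (J ! j) bs)
     (pair_pmf (index_pmf (length J)) (replicate_pmf K coin))"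

lemma finite_set_formula_pmf [simp]: "finite (set_pmf (formula_pmf n D K J))"
  by (simp add: formula_pmf_def)

lemma formula_pmf_eq_bind:
  "formula_pmf n D K J = bind_pmf (index_pmf (length J)) (\<lambda>j. example_pmf n D K (J ! j))"
  by (simp add: formula_pmf_def example_pmf_def pair_pmf_def map_bind_pmf map_pmf_def bind_assoc_pmf bind_return_pmf)

lemma nth_formula: "J \<in> formulas n K m \<Longrightarrow> j < m \<Longrightarrow> J ! j \<in> ktuples n K"
  by (auto simp: formulas_def)

lemma set_formula_pmf:
  assumes "J \<in> formulas n K m" "m > 0"
  shows "set_pmf (formula_pmf n D K J) \<subseteq> examples ((n + 1) ^ D)"
  using assms set_index_pmf[of m] flip_example_in[OF nth_formula[OF assms(1)]]
  by (force simp: formula_pmf_def formulas_def)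

lemma finite_sign_vectors: "finite (sign_vectors n)"
  using finite_lists_length_eq[of "{-1, 1 :: int}" n] by (simp add: sign_vectors_def)

lemma sign_vectors_nonempty: "sign_vectors n \<noteq> {}"
proof -
  have "replicate n 1 \<in> sign_vectors n" by (auto simp: sign_vectors_def)
  then show ?thesis by auto
qed

text \<open>An index is drawn with probability at most \<open>3/2\<close> times \<open>1/m\<close>, which is affordable:
  \<open>3/2 \<cdot> 1/100 + 1/200 = 2/100\<close>.\<close>

lemma formula_pmf_almost_realizable:
  assumes J: "J \<in> formulas n (8 * a\<^sup>2) m" and m: "m > 0" and a: "a > 0"
    and val: "VAL_XOR n J \<ge> 1 - 1 / 100"
  shows "formula_pmf n (40 * a) (8 * a\<^sup>2) J \<in> almost_realizable (2 / 100) ((n + 1) ^ (40 * a))"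
proof -
  let ?K = "8 * a\<^sup>2"
  have lJ: "length J = m" using J by (simp add: formulas_def)
  define g where "g \<psi> = real (card {j. j < length J \<and> XOR (apply_ktuple (J ! j) \<psi>) = 1}) / real (length J)" for \<psi>
  have "VAL_XOR n J \<in> g ` sign_vectors n"
    unfolding VAL_XOR_def g_def using finite_sign_vectors[of n] sign_vectors_nonempty[of n]
    by (intro Max_in) auto
  then obtain \<psi> where \<psi>: "\<psi> \<in> sign_vectors n" "g \<psi> \<ge> 1 - 1 / 100" using val by auto
  define U where "U = {j. j < m \<and> XOR (apply_ktuple (J ! j) \<psi>) \<noteq> 1}"
  have "card {j. j < m \<and> XOR (apply_ktuple (J ! j) \<psi>) = 1} + card U = card {..<m}"
  proof (subst card_Un_disjoint[symmetric])
    have "{j. j < m \<and> XOR (apply_ktuple (J ! j) \<psi>) = 1} \<union> U = {..<m}" by (auto simp: U_def)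
    then show "card ({j. j < m \<and> XOR (apply_ktuple (J ! j) \<psi>) = 1} \<union> U) = card {..<m}" by simp
  qed (auto simp: U_def)
  then have "real (card {j. j < m \<and> XOR (apply_ktuple (J ! j) \<psi>) = 1}) + real (card U) = real m"
    by (metis card_lessThan of_nat_add)
  then have cU: "real (card U) \<le> real m / 100"
    using \<psi>(2) m unfolding g_def lJ by (simp add: field_simps)
  let ?E = "{(x, y). halfspace (\<lambda>i. weights (20 * a) \<psi> ! i) x \<noteq> real_of_int y}"
  have "Err (formula_pmf n (40 * a) ?K J) (halfspace (\<lambda>i. weights (20 * a) \<psi> ! i)) =
      expect (index_pmf m) (\<lambda>j. measure_pmf.prob (example_pmf n (40 * a) ?K (J ! j)) ?E)"
    unfolding Err_def formula_pmf_eq_bind lJ by (rule prob_bind) (auto simp: example_pmf_def)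
  \<comment> \<open>Nothing is known about the examples of an unsatisfied constraint, so their error
    is estimated by 1.\<close>
  also have "\<dots> \<le> expect (index_pmf m) (\<lambda>j. indicator U j + 1 / 200)"
  proof (rule expect_mono)
    fix j assume "j \<in> set_pmf (index_pmf m)"
    then have j: "j < m" using set_index_pmf[OF m] by auto
    show "measure_pmf.prob (example_pmf n (40 * a) ?K (J ! j)) ?E \<le> indicator U j + 1 / 200"
    proof (cases "j \<in> U")
      case True
      have "measure_pmf.prob (example_pmf n (40 * a) ?K (J ! j)) ?E \<le> 1" by (rule measure_pmf.prob_le_1)
      then have "measure_pmf.prob (example_pmf n (40 * a) ?K (J ! j)) ?E \<le> 1 + 1 / 200" by linarith
      then show ?thesis using True by simp
    next
      case False
      then have "XOR (apply_ktuple (J ! j) \<psi>) = 1" using j by (simp add: U_def)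
      from example_pmf_error[OF nth_formula[OF J j] \<psi>(1) a this] show ?thesis using False by simp
    qed
  qed simp
  also have "\<dots> = measure_pmf.prob (index_pmf m) U + 1 / 200"
    by (subst Bochner_Integration.integral_add) (auto intro!: integrable_measure_pmf_finite)
  also have "measure_pmf.prob (index_pmf m) U = sum (pmf (index_pmf m)) U"
    by (rule measure_measure_pmf_finite) (simp add: U_def)
  also have "sum (pmf (index_pmf m)) U \<le> (\<Sum>j\<in>U. 3 / (2 * real m))"
    by (intro sum_mono pmf_index m)
  also have "\<dots> = real (card U) * (3 / (2 * real m))" by simp
  also have "\<dots> \<le> real m / 100 * (3 / (2 * real m))" by (intro mult_right_mono cU) auto
  also have "\<dots> + 1 / 200 = 2 / 100" using m by simp
  finally have "Err (formula_pmf n (40 * a) ?K J) (halfspace (\<lambda>i. weights (20 * a) \<psi> ! i)) \<le> 2 / 100" by simp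
  then show ?thesis using set_formula_pmf[OF J m] unfolding almost_realizable_def by blast
qed

section \<open>Examples from random formulas\<close>

definition scattered_pmf :: "nat \<Rightarrow> nat \<Rightarrow> nat \<Rightarrow> (int list \<times> int) pmf" where
  "scattered_pmf n D K =
     pair_pmf (map_pmf (\<lambda>C. tens D (kvec n C)) (pmf_of_set (ktuples n K))) (pmf_of_set {-1, 1})"

lemma finite_set_scattered_pmf [simp]: "K \<le> n \<Longrightarrow> finite (set_pmf (scattered_pmf n D K))"
  by (simp add: scattered_pmf_def ktuples_nonempty)

text \<open>The first coin alone makes the product a fair sign, whatever the other coins are; it is
  therefore moved to the end of the experiment.\<close>

lemma map_label_coins:
  assumes "K > 0"
  shows "map_pmf label (replicate_pmf K coin) = pmf_of_set {-1, 1}"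
proof -
  obtain k where k: "K = Suc k" using assms by (cases K) auto
  have "map_pmf label (replicate_pmf K coin) =
      do {b \<leftarrow> coin; bs \<leftarrow> replicate_pmf k coin; return_pmf (if b then - label bs else label bs)}"
    unfolding k replicate_pmf.simps map_bind_pmf map_return_pmf by (intro bind_pmf_cong refl) (auto simp: label_def)
  also have "\<dots> = do {bs \<leftarrow> replicate_pmf k coin; map_pmf (\<lambda>b. if b then - label bs else label bs) coin}"
    unfolding map_pmf_def by (rule bind_commute_pmf)
  also have "\<dots> = pmf_of_set {-1, 1}" by (simp add: map_sign_coin[OF label_in])
  finally show ?thesis .
qed

text \<open>For each fixed choice of flips the flipped tuple is uniform again. It is thus
  independent of the flips, and in particular of the label that they determine.\<close>

lemma flip_uniform_scattered:
  assumes "K \<le> n" "K > 0"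
  shows "map_pmf (\<lambda>(C, bs). flip_example n D C bs) (pair_pmf (pmf_of_set (ktuples n K)) (replicate_pmf K coin)) =
    scattered_pmf n D K"
proof -
  let ?U = "pmf_of_set (ktuples n K)"
  have "map_pmf (\<lambda>(C, bs). flip_example n D C bs) (pair_pmf ?U (replicate_pmf K coin)) =
     do {C \<leftarrow> ?U; bs \<leftarrow> replicate_pmf K coin; return_pmf (flip_example n D C bs)}"
    by (simp add: pair_pmf_def map_bind_pmf)
  also have "\<dots> = do {bs \<leftarrow> replicate_pmf K coin; C \<leftarrow> ?U; return_pmf (flip_example n D C bs)}"
    by (rule bind_commute_pmf)
  also have "\<dots> = do {bs \<leftarrow> replicate_pmf K coin; C \<leftarrow> map_pmf (\<lambda>C. flip C bs) ?U;
      return_pmf (tens D (kvec n C), label bs)}"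
    by (simp add: bind_map_pmf flip_example_def)
  also have "\<dots> = do {bs \<leftarrow> replicate_pmf K coin; C \<leftarrow> ?U; return_pmf (tens D (kvec n C), label bs)}"
    by (simp add: map_flip_uniform[OF assms(1)])
  also have "\<dots> = do {C \<leftarrow> ?U; bs \<leftarrow> replicate_pmf K coin; return_pmf (tens D (kvec n C), label bs)}"
    by (rule bind_commute_pmf)
  also have "\<dots> = scattered_pmf n D K"
    by (simp add: scattered_pmf_def map_label_coins[OF assms(2), symmetric] pair_pmf_def bind_map_pmf)
  finally show ?thesis .
qed

lemma replicate_formula_pmf:
  "replicate_pmf s (formula_pmf n D K J) = do {js \<leftarrow> replicate_pmf s (index_pmf (length J));
     bss \<leftarrow> replicate_pmf s (replicate_pmf K coin);
     return_pmf (map (\<lambda>(C, bs). flip_example n D C bs) (zip (map (\<lambda>j. J ! j) js) bss))}"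
  unfolding formula_pmf_def map_replicate_pmf[symmetric] replicate_pair_pmf
  by (simp add: pair_pmf_def map_bind_pmf zip_map1 o_def case_prod_unfold)

lemma random_formula_scattered:
  assumes K: "K \<le> n" "K > 0" and js: "distinct js" "set js \<subseteq> {..<m}"
  shows "do {J \<leftarrow> random_formula n K m; bss \<leftarrow> replicate_pmf (length js) (replicate_pmf K coin);
     return_pmf (map (\<lambda>(C, bs). flip_example n D C bs) (zip (map (\<lambda>j. J ! j) js) bss))} =
     replicate_pmf (length js) (scattered_pmf n D K)"
proof -
  have "do {J \<leftarrow> random_formula n K m; bss \<leftarrow> replicate_pmf (length js) (replicate_pmf K coin);
     return_pmf (map (\<lambda>(C, bs). flip_example n D C bs) (zip (map (\<lambda>j. J ! j) js) bss))} =
     do {Cs \<leftarrow> map_pmf (\<lambda>J. map (\<lambda>j. J ! j) js) (random_formula n K m);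
       bss \<leftarrow> replicate_pmf (length js) (replicate_pmf K coin);
     return_pmf (map (\<lambda>(C, bs). flip_example n D C bs) (zip Cs bss))}"
    by (simp add: bind_map_pmf)
  also have "\<dots> = map_pmf (map (\<lambda>(C, bs). flip_example n D C bs)) (replicate_pmf (length js)
       (pair_pmf (pmf_of_set (ktuples n K)) (replicate_pmf K coin)))"
    unfolding random_formula_def map_nth_replicate_pmf[OF js] replicate_pair_pmf
    by (simp add: pair_pmf_def map_bind_pmf)
  finally show ?thesis by (simp add: map_replicate_pmf flip_uniform_scattered[OF K])
qed

lemma finite_set_random_formula [simp]: "K \<le> n \<Longrightarrow> finite (set_pmf (random_formula n K m))"
  by (simp add: random_formula_def ktuples_nonempty)

lemma set_random_formula:
  "K \<le> n \<Longrightarrow> set_pmf (random_formula n K m) \<subseteq> formulas n K m"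
  by (auto simp: random_formula_def formulas_def set_replicate_pmf ktuples_nonempty)

text \<open>With distinct indices the examples are exactly independent draws from
  \<open>scattered_pmf\<close>; otherwise the probability is estimated by 1, which costs the
  birthday bound. \<open>R\<close> is the place of the learner's coins and \<open>A\<close> that of
  its success in the test.\<close>

lemma expect_random_formula_le:
  assumes K: "K \<le> n" "K > 0" and m: "m > 0" and R: "finite (set_pmf R)"
  shows "expect (random_formula n K m) (\<lambda>J. measure_pmf.prob (pair_pmf (replicate_pmf s (formula_pmf n D K J)) R) A)
    \<le> (real s)\<^sup>2 * (3 / (2 * real m)) + measure_pmf.prob (pair_pmf (replicate_pmf s (scattered_pmf n D K)) R) A"
proof -
  define Q where "Q js J = do {bss \<leftarrow> replicate_pmf s (replicate_pmf K coin);
     return_pmf (map (\<lambda>(C, bs). flip_example n D C bs) (zip (map (\<lambda>j. J ! j) js) bss))}" for js J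
  let ?F = "random_formula n K m"
  let ?I = "replicate_pmf s (index_pmf m)"
  let ?S = "measure_pmf.prob (pair_pmf (replicate_pmf s (scattered_pmf n D K)) R) A"
  have finQ [simp]: "finite (set_pmf (Q js J))" for js J by (simp add: Q_def)
  have "expect ?F (\<lambda>J. measure_pmf.prob (pair_pmf (replicate_pmf s (formula_pmf n D K J)) R) A) =
     measure_pmf.prob (do {J \<leftarrow> ?F; pair_pmf (replicate_pmf s (formula_pmf n D K J)) R}) A"
    by (rule prob_bind[symmetric]) (use K R in auto)
  also have "do {J \<leftarrow> ?F; pair_pmf (replicate_pmf s (formula_pmf n D K J)) R} =
     do {J \<leftarrow> ?F; js \<leftarrow> ?I; pair_pmf (Q js J) R}"
  proof (intro bind_pmf_cong refl)
    fix J assume "J \<in> set_pmf ?F"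
    then have "length J = m" using set_random_formula[OF K(1)] by (auto simp: formulas_def)
    then show "pair_pmf (replicate_pmf s (formula_pmf n D K J)) R = do {js \<leftarrow> ?I; pair_pmf (Q js J) R}"
      unfolding replicate_formula_pmf Q_def by (simp add: pair_pmf_def bind_assoc_pmf)
  qed
  \<comment> \<open>The law of the indices depends on the length of the formula only, so they can be
    drawn before the formula.\<close>
  also have "\<dots> = do {js \<leftarrow> ?I; J \<leftarrow> ?F; pair_pmf (Q js J) R}" by (rule bind_commute_pmf)
  also have "measure_pmf.prob \<dots> A = expect ?I (\<lambda>js. measure_pmf.prob (do {J \<leftarrow> ?F; pair_pmf (Q js J) R}) A)"
    by (rule prob_bind) (use K R in auto)
  also have "\<dots> \<le> expect ?I (\<lambda>js. indicator {js. \<not> distinct js} js + ?S)"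
  proof (rule expect_mono)
    fix js assume js: "js \<in> set_pmf ?I"
    then have js: "length js = s" "set js \<subseteq> {..<m}" using set_index_pmf[OF m] by (auto simp: set_replicate_pmf)
    show "measure_pmf.prob (do {J \<leftarrow> ?F; pair_pmf (Q js J) R}) A \<le> indicator {js. \<not> distinct js} js + ?S"
    proof (cases "distinct js")
      case True
      have "do {J \<leftarrow> ?F; pair_pmf (Q js J) R} = pair_pmf (do {J \<leftarrow> ?F; Q js J}) R"
        by (simp add: pair_pmf_def bind_assoc_pmf)
      also have "do {J \<leftarrow> ?F; Q js J} = replicate_pmf s (scattered_pmf n D K)"
        unfolding Q_def using random_formula_scattered[OF K True js(2), of D] js(1) by simp
      finally show ?thesis using True by simp
    next
      case False
      have "measure_pmf.prob (do {J \<leftarrow> ?F; pair_pmf (Q js J) R}) A \<le> 1" by (rule measure_pmf.prob_le_1)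
      then show ?thesis using False by (simp add: add_increasing2)
    qed
  qed simp
  also have "\<dots> = measure_pmf.prob ?I {js. \<not> distinct js} + ?S"
    by (subst Bochner_Integration.integral_add) (auto intro!: integrable_measure_pmf_finite finite_set_replicate_pmf)
  also have "\<dots> \<le> (real s)\<^sup>2 * (3 / (2 * real m)) + ?S"
    using prob_not_distinct[OF finite_set_index_pmf pmf_index[OF m], of s] by simp
  finally show ?thesis .
qed

section \<open>Testing a hypothesis on fresh examples\<close>

definition errors :: "(int list \<Rightarrow> real) \<Rightarrow> (int list \<times> int) list \<Rightarrow> nat" where
  "errors h ts = length (filter (\<lambda>(x, y). h x \<noteq> real_of_int y) ts)"

lemma errors_chebyshev:
  assumes "finite (set_pmf P)" "t > 0"
  shows "measure_pmf.prob (replicate_pmf M P) {ts. \<bar>real (errors h ts) - real M * Err P h\<bar> \<ge> t} \<le> real M / t\<^sup>2"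
proof -
  let ?g = "indicator {(x, y). h x \<noteq> real_of_int y} :: _ \<Rightarrow> real"
  have "real (errors h ts) = (\<Sum>p\<leftarrow>ts. ?g p)" for ts
    by (induction ts) (auto simp: errors_def)
  moreover have "\<bar>?g p - Err P h\<bar> \<le> 1" for p
  proof -
    have "0 \<le> Err P h" "Err P h \<le> 1" by (auto simp: Err_def)
    then show ?thesis by (auto simp: indicator_def)
  qed
  ultimately show ?thesis
    using chebyshev_replicate[OF assms(1) _ _ assms(2), of ?g "Err P h" M] by (simp add: Err_def)
qed

text \<open>On \<open>2N\<^bsup>2c+1\<^esup>\<close> test examples, the standard deviation \<open>O(N\<^bsup>c+1/2\<^esup>)\<close> of the number of errors
  is below the advantage \<open>2N\<^bsup>c+1\<^esup>\<close> of the learner over guessing; the threshold is halfway.\<close>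

lemma test_accepts:
  assumes "finite (set_pmf P)" "N > 0" "Err P h \<le> 1 / 2 - 1 / real N ^ c"
  shows "measure_pmf.prob (replicate_pmf (2 * N ^ (2 * c + 1)) P)
     {ts. errors h ts + N ^ (c + 1) < N ^ (2 * c + 1)} \<ge> 1 - 2 / real N"
proof -
  let ?M = "2 * N ^ (2 * c + 1)"
  let ?R = "replicate_pmf ?M P"
  have "real ?M * Err P h \<le> real ?M * (1 / 2 - 1 / real N ^ c)"
    by (intro mult_left_mono assms) auto
  also have "\<dots> = real N ^ (2 * c + 1) - 2 * real N ^ (c + 1)"
  proof -
    have "real N ^ (2 * c + 1) = real N ^ (c + 1) * real N ^ c"
      by (simp flip: power_add) (simp add: mult_2)
    then have "real N ^ (2 * c + 1) / real N ^ c = real N ^ (c + 1)" using assms(2) by simp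
    moreover have "2 * x * (1 / 2 - 1 / y) = x - 2 * (x / y)" for x y :: real
      by (simp add: algebra_simps)
    ultimately show ?thesis by simp
  qed
  finally have e: "real ?M * Err P h \<le> real N ^ (2 * c + 1) - 2 * real N ^ (c + 1)" .
  have "1 - measure_pmf.prob ?R {ts. errors h ts + N ^ (c + 1) < N ^ (2 * c + 1)} =
     measure_pmf.prob ?R (UNIV - {ts. errors h ts + N ^ (c + 1) < N ^ (2 * c + 1)})"
    using measure_pmf.prob_compl[of "{ts. errors h ts + N ^ (c + 1) < N ^ (2 * c + 1)}" ?R] by simp
  also have "\<dots> \<le> measure_pmf.prob ?R {ts. \<bar>real (errors h ts) - real ?M * Err P h\<bar> \<ge> real N ^ (c + 1)}"
  proof (intro measure_pmf.finite_measure_mono)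
    show "UNIV - {ts. errors h ts + N ^ (c + 1) < N ^ (2 * c + 1)} \<subseteq>
       {ts. real N ^ (c + 1) \<le> \<bar>real (errors h ts) - real ?M * Err P h\<bar>}"
    proof safe
      fix ts assume "\<not> errors h ts + N ^ (c + 1) < N ^ (2 * c + 1)"
      then have "real (N ^ (2 * c + 1)) \<le> real (errors h ts + N ^ (c + 1))" by (simp only: of_nat_le_iff not_less)
      then show "real N ^ (c + 1) \<le> \<bar>real (errors h ts) - real ?M * Err P h\<bar>" using e by simp
    qed
  qed simp
  also have "\<dots> \<le> real ?M / (real N ^ (c + 1))\<^sup>2"
    by (rule errors_chebyshev[OF assms(1)]) (use assms(2) in simp)
  also have "\<dots> = 2 / real N"
  proof -
    have "real N ^ (2 * c + 1) * real N = (real N ^ (c + 1))\<^sup>2"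
      unfolding power2_eq_square power_add mult_2 by (simp only: power_one_right ac_simps)
    then show ?thesis using assms(2) by (simp add: frac_eq_eq)
  qed
  finally show ?thesis by simp
qed

text \<open>The expected number of errors is N^(2c+1), and passing the test means falling short of
  it by more than N^(c+1). Chebyshev's bound for this is 2 N^(2c+1) / N^(2c+2).\<close>

lemma test_rejects:
  assumes "finite (set_pmf P)" "N > 0" "Err P h = 1 / 2"
  shows "measure_pmf.prob (replicate_pmf (2 * N ^ (2 * c + 1)) P)
     {ts. errors h ts + N ^ (c + 1) < N ^ (2 * c + 1)} \<le> 2 / real N"
proof -
  let ?M = "2 * N ^ (2 * c + 1)"
  let ?R = "replicate_pmf ?M P"
  have e: "real ?M * Err P h = real N ^ (2 * c + 1)" using assms(3) by simp
  have "measure_pmf.prob ?R {ts. errors h ts + N ^ (c + 1) < N ^ (2 * c + 1)} \<le>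
     measure_pmf.prob ?R {ts. \<bar>real (errors h ts) - real ?M * Err P h\<bar> \<ge> real N ^ (c + 1)}"
  proof (intro measure_pmf.finite_measure_mono)
    show "{ts. errors h ts + N ^ (c + 1) < N ^ (2 * c + 1)} \<subseteq>
       {ts. real N ^ (c + 1) \<le> \<bar>real (errors h ts) - real ?M * Err P h\<bar>}"
    proof safe
      fix ts assume "errors h ts + N ^ (c + 1) < N ^ (2 * c + 1)"
      then have "real (errors h ts + N ^ (c + 1)) < real (N ^ (2 * c + 1))" by (simp only: of_nat_less_iff)
      then show "real N ^ (c + 1) \<le> \<bar>real (errors h ts) - real ?M * Err P h\<bar>" unfolding e by simp
    qed
  qed simp
  also have "\<dots> \<le> real ?M / (real N ^ (c + 1))\<^sup>2"
    by (rule errors_chebyshev[OF assms(1)]) (use assms(2) in simp)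
  also have "\<dots> = 2 / real N"
  proof -
    have "real N ^ (2 * c + 1) * real N = (real N ^ (c + 1))\<^sup>2"
      unfolding power2_eq_square power_add mult_2 by (simp only: power_one_right ac_simps)
    then show ?thesis using assms(2) by (simp add: frac_eq_eq)
  qed
  finally show ?thesis .
qed

text \<open>Given the instance, the label is a fair sign, and a hypothesis with values -1 and 1
  misses exactly one of its two values.\<close>

lemma Err_scattered:
  assumes "K \<le> n" "\<And>x. h x = -1 \<or> h x = 1"
  shows "Err (scattered_pmf n D K) h = 1 / 2"
proof -
  let ?V = "map_pmf (\<lambda>C. tens D (kvec n C)) (pmf_of_set (ktuples n K))"
  let ?E = "{(x, y). h x \<noteq> real_of_int y}"
  have pair: "pair_pmf V S = bind_pmf V (\<lambda>x. map_pmf (\<lambda>y. (x, y)) S)" for V :: "int list pmf" and S :: "int pmf"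
    by (simp add: pair_pmf_def map_pmf_def)
  have "Err (scattered_pmf n D K) h = expect ?V (\<lambda>x. measure_pmf.prob (map_pmf (\<lambda>y. (x, y)) (pmf_of_set {-1, 1})) ?E)"
    unfolding Err_def scattered_pmf_def pair
    by (rule prob_bind) (use assms in \<open>auto simp: ktuples_nonempty\<close>)
  also have "\<dots> = expect ?V (\<lambda>x. 1 / 2)"
  proof (rule expect_cong)
    fix x
    have "{-1, 1} \<inter> {y. h x \<noteq> real_of_int y} = (if h x = 1 then {-1} else {1})"
      using assms(2)[of x] by auto
    then show "measure_pmf.prob (map_pmf (\<lambda>y. (x, y)) (pmf_of_set {-1, 1})) ?E = 1 / 2"
      unfolding prob_map_pmf by (simp add: measure_pmf_of_set)
  qed
  finally show ?thesis by simp
qed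
section \<open>Running time of the reduction\<close>

lemma ptime_if_distrib:
  "ptime X e (\<lambda>x. if P x then enc (f x) else enc (g x)) \<Longrightarrow> ptime X e (\<lambda>x. enc (if P x then f x else g x))"
  by (erule ptime_cong) auto

lemma ptime_take:
  assumes "ptime X e (\<lambda>x. enc_nat (k x))" "ptime X e (\<lambda>x. enc_list ea (xs x))"
    "\<And>x. x \<in> X \<Longrightarrow> k x \<le> length (xs x)"
  shows "ptime X e (\<lambda>x. enc_list ea (take (k x) (xs x)))"
proof -
  let ?Y = "SIGMA x:X. {..<k x}"
  have "ptime X e (\<lambda>x. enc_list ea (map (\<lambda>i. xs x ! i) [0..<k x]))"
  proof (rule ptime_map[where Y = ?Y, OF ptime_upt[OF assms(1)]])
    show "ptime ?Y (\<lambda>p. Nd (e (fst p)) (enc_nat (snd p))) (\<lambda>p. ea (xs (fst p) ! snd p))"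
      by (intro ptime_nth ptime_lift[where h = fst, OF assms(2)] ptime_env1) (use assms(3) in fastforce)+
  qed auto
  then show ?thesis
  proof (rule ptime_cong)
    show "x \<in> X \<and> e x = e x \<and> enc_list ea (map (\<lambda>i. xs x ! i) [0..<k x]) = enc_list ea (take (k x) (xs x))"
      if "x \<in> X" for x
      using that assms(3)[OF that] by (auto intro!: arg_cong[where f = "enc_list ea"] nth_equalityI)
  qed
qed

lemma ptime_chunks:
  assumes "ptime X e (\<lambda>x. enc_nat (w x))" "ptime X e (\<lambda>x. enc_nat (k x))" "ptime X e (\<lambda>x. enc_list ea (r x))"
    "\<And>x. x \<in> X \<Longrightarrow> w x * k x \<le> length (r x)"
  shows "ptime X e (\<lambda>x. enc_list (enc_list ea) (chunks (w x) (k x) (r x)))"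
proof -
  let ?Y = "SIGMA x:X. {..<k x}"
  let ?Z = "SIGMA p:?Y. {..<w (fst p)}"
  let ?e = "\<lambda>p. Nd (e (fst p)) (enc_nat (snd p))"
  let ?e' = "\<lambda>t. Nd (?e (fst t)) (enc_nat (snd t))"
  have lt: "i * w x + j < length (r x)" if "x \<in> X" "i < k x" "j < w x" for x i j
  proof -
    have "i * w x + j < Suc i * w x" using that by simp
    also have "\<dots> \<le> k x * w x" using that by (intro mult_right_mono) auto
    finally show ?thesis using assms(4)[OF that(1)] by (simp add: mult.commute)
  qed
  have r: "ptime ?Y ?e (\<lambda>p. enc_list ea (r (fst p)))" and w: "ptime ?Y ?e (\<lambda>p. enc_nat (w (fst p)))"
    by (rule ptime_lift[where h = fst], (rule assms)+, auto)+
  have "ptime X e (\<lambda>x. enc_list (enc_list ea) (map (\<lambda>i. map (\<lambda>j. r x ! (i * w x + j)) [0..<w x]) [0..<k x]))"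
  proof (rule ptime_map[where Y = ?Y, OF ptime_upt[OF assms(2)]])
    show "ptime ?Y ?e (\<lambda>p. enc_list ea (map (\<lambda>j. r (fst p) ! (snd p * w (fst p) + j)) [0..<w (fst p)]))"
    proof (rule ptime_map[where Y = ?Z, OF ptime_upt[OF w]])
      have "ptime ?Z ?e' (\<lambda>t. enc_nat (snd (fst t)))"
        by (rule ptime_lift[where h = fst, OF ptime_env1]) auto
      then show "ptime ?Z ?e' (\<lambda>t. ea (r (fst (fst t)) ! (snd (fst t) * w (fst (fst t)) + snd t)))"
        by (intro ptime_nth ptime_add ptime_mult ptime_lift[where h = fst, OF r]
          ptime_lift[where h = fst, OF w] ptime_env1)
           (auto simp: lt)
    qed auto
  qed auto
  then show ?thesis by (simp add: chunks_def)
qed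

lemma ptime_sum_list:
  assumes "ptime X e (\<lambda>x. enc_list enc_nat (xs x))"
  shows "ptime X e (\<lambda>x. enc_nat (sum_list (xs x)))"
proof -
  have *: "fold (\<lambda>a acc. a + acc) xs b = sum_list xs + b" for xs and b :: nat
    by (induction xs arbitrary: b) auto
  have "ptime X e (\<lambda>x. enc_nat (fold (\<lambda>a acc. a + acc) (xs x) 0))"
  proof (rule ptime_fold[OF assms])
    show "ptime X e (\<lambda>x. enc_nat 0)" by (rule ptime_const)
    show "ptime UNIV (\<lambda>p. Nd (e (fst p)) (Nd (enc_nat (fst (snd p))) (enc_nat (snd (snd p)))))
      (\<lambda>p. enc_nat (fst (snd p) + snd (snd p)))"
      by (intro ptime_add ptime_env2 ptime_env3)
    show "pbounded X e (\<lambda>x. size (enc_list enc_nat (xs x)))" by (rule ptime_size[OF assms])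
    have "sum_list ys \<le> size (enc_list enc_nat ys)" for ys by (induction ys) auto
    also have "size (enc_list enc_nat (take k ys)) \<le> size (enc_list enc_nat ys)" for k ys
      by (subst append_take_drop_id[of k ys, symmetric]) (simp only: size_enc_list map_append sum_list_append)
    finally show "size (enc_nat (fold (\<lambda>a acc. a + acc) (take k (xs x)) 0)) \<le> size (enc_list enc_nat (xs x))" for x k
      by (simp add: *)
  qed auto
  then show ?thesis by (simp add: *)
qed

lemma ptime_idx:
  assumes "ptime X e (\<lambda>x. enc_nat (m x))" "ptime X e (\<lambda>x. enc_list enc_bool (bs x))" "\<And>x. x \<in> X \<Longrightarrow> 0 < m x"
  shows "ptime X e (\<lambda>x. enc_nat (idx (m x) (bs x)))"
proof -
  let ?Y = "X \<times> UNIV"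
  let ?e = "\<lambda>p. Nd (e (fst p)) (Nd (enc_bool (fst (snd p))) (enc_nat (snd (snd p))))"
  have m: "ptime ?Y ?e (\<lambda>p. enc_nat (m (fst p)))" by (rule ptime_lift[where h = fst, OF assms(1)]) auto
  have "ptime ?Y ?e (\<lambda>p. if fst (snd p) then enc_nat (Suc 0) else enc_nat 0)"
    by (intro ptime_if_bool ptime_const ptime_env2)
  then have b: "ptime ?Y ?e (\<lambda>p. enc_nat (of_bool (fst (snd p))))" by (rule ptime_cong) auto
  have v: "ptime ?Y ?e (\<lambda>p. enc_nat (2 * snd (snd p) + of_bool (fst (snd p))))"
    by (intro ptime_add ptime_mult b ptime_const ptime_env3)
  show ?thesis unfolding idx_def
  proof (rule ptime_fold[where eb = enc_nat and Y = ?Y, OF assms(2)])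
    show "ptime X e (\<lambda>x. enc_nat 0)" by (rule ptime_const)
    show "ptime ?Y ?e (\<lambda>p. enc_nat (if m (fst p) \<le> 2 * snd (snd p) + of_bool (fst (snd p))
       then 2 * snd (snd p) + of_bool (fst (snd p)) - m (fst p) else 2 * snd (snd p) + of_bool (fst (snd p))))"
      by (intro ptime_if_distrib[where enc = enc_nat] ptime_if_le m v ptime_minus
        ptime_subset[OF m] ptime_subset[OF v]) auto
    show "pbounded X e (\<lambda>x. size (enc_nat (m x)))" by (rule ptime_size[OF assms(1)])
    show "size (enc_nat (fold (\<lambda>b v. if m x \<le> 2 * v + of_bool b then 2 * v + of_bool b - m x else 2 * v + of_bool b)
       (take k (bs x)) 0)) \<le> size (enc_nat (m x))" if "x \<in> X" for x k
      using idx_less[OF assms(3)[OF that], of "take k (bs x)"] unfolding idx_def by simp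
  qed auto
qed

section \<open>Programs for tuples, examples and error counts\<close>

abbreviation enc_ktuple :: "ktuple \<Rightarrow> bintree" where
  "enc_ktuple \<equiv> enc_list (enc_pair enc_nat enc_trit)"

lemma nth_ktuple:
  assumes "C \<in> ktuples n K" "j < length C"
  shows "fst (C ! j) < n" "snd (C ! j) \<in> {-1, 1}"
proof -
  have "C ! j \<in> {..<n} \<times> {-1, 1}" using ktuplesD(3)[OF assms(1)] nth_mem[OF assms(2)] by blast
  then show "fst (C ! j) < n" "snd (C ! j) \<in> {-1, 1}" by auto
qed

lemma ptime_flip:
  assumes C: "ptime X e (\<lambda>x. enc_ktuple (C x))" and bs: "ptime X e (\<lambda>x. enc_list enc_bool (bs x))"
    and X: "\<And>x. x \<in> X \<Longrightarrow> C x \<in> ktuples (n x) K" "\<And>x. x \<in> X \<Longrightarrow> length (bs x) = K"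
  shows "ptime X e (\<lambda>x. enc_ktuple (flip (C x) (bs x)))"
proof -
  let ?Y = "SIGMA x:X. {..<length (C x)}"
  let ?e = "\<lambda>p. Nd (e (fst p)) (enc_nat (snd p))"
  have Cj: "ptime ?Y ?e (\<lambda>p. enc_pair enc_nat enc_trit (C (fst p) ! snd p))"
    by (intro ptime_nth ptime_lift[where h = fst, OF C] ptime_env1) auto
  have bj: "ptime ?Y ?e (\<lambda>p. enc_bool (bs (fst p) ! snd p))"
    by (intro ptime_nth ptime_lift[where h = fst, OF bs] ptime_env1) (use ktuplesD(1)[OF X(1)] X(2) in auto)
  show ?thesis unfolding flip_def
  proof (rule ptime_map[where Y = ?Y, OF ptime_upt[OF ptime_length[OF C]]])
    show "ptime ?Y ?e (\<lambda>p. enc_pair enc_nat enc_trit (fst (C (fst p) ! snd p),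
      if bs (fst p) ! snd p then - snd (C (fst p) ! snd p) else snd (C (fst p) ! snd p)))"
    proof (intro ptime_Pair ptime_fst[OF Cj] ptime_if_distrib[where enc = enc_trit] ptime_if_bool bj ptime_uminus_trit
        ptime_subset[OF ptime_snd[OF Cj]])
      fix p assume "p \<in> {p \<in> ?Y. bs (fst p) ! snd p}"
      then have "fst p \<in> X" "snd p < length (C (fst p))" by auto
      from nth_ktuple(2)[OF X(1)[OF this(1)] this(2)] show "snd (C (fst p) ! snd p) \<in> {-1, 1, 0}" by auto
    qed auto
  qed auto
qed

lemma ptime_kvec:
  assumes n: "ptime X e (\<lambda>x. enc_nat (n x))" and C: "ptime X e (\<lambda>x. enc_ktuple (C x))"
    and X: "\<And>x. x \<in> X \<Longrightarrow> C x \<in> ktuples (n x) K"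
  shows "ptime X e (\<lambda>x. enc_list enc_trit (kvec (n x) (C x)))"
  unfolding kvec_def
proof (rule ptime_map[where Y = "X \<times> UNIV", OF ptime_upt[OF n]])
  let ?Y = "X \<times> UNIV"
  let ?e = "\<lambda>p. Nd (e (fst p)) (enc_nat (snd p))"
  let ?Z = "?Y \<times> UNIV"
  let ?e' = "\<lambda>t. Nd (?e (fst t)) (Nd (enc_pair enc_nat enc_trit (fst (snd t))) (enc_trit (snd (snd t))))"
  have C': "ptime ?Y ?e (\<lambda>p. enc_ktuple (C (fst p)))" by (rule ptime_lift[where h = fst, OF C]) auto
  show "ptime ?Y ?e (\<lambda>p. enc_trit (fold (\<lambda>q acc. if fst q = snd p then snd q else acc) (C (fst p)) 0))"
  proof (rule ptime_fold[where eb = enc_trit and Y = ?Z, OF C'])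
    show "ptime ?Y ?e (\<lambda>p. enc_trit 0)" by (rule ptime_const)
    have i: "ptime ?Z ?e' (\<lambda>t. enc_nat (snd (fst t)))" by (rule ptime_lift[where h = fst, OF ptime_env1]) auto
    show "ptime ?Z ?e' (\<lambda>t. enc_trit (if fst (fst (snd t)) = snd (fst t) then snd (fst (snd t)) else snd (snd t)))"
      by (intro ptime_if_distrib[where enc = enc_trit] ptime_if_eq i ptime_fst[where ea = enc_nat and eb = enc_trit]
          ptime_snd[where ea = enc_nat and eb = enc_trit] ptime_env2 ptime_env3)
    show "pbounded ?Y ?e (\<lambda>_. 2)" by (rule pbounded_const)
    show "size (enc_trit (fold (\<lambda>q acc. if fst q = snd p then snd q else acc) (take k (C (fst p))) 0)) \<le> 2"
      if p: "p \<in> ?Y" for p k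
    proof (rule size_enc_trit, rule lookup_in)
      have "fst p \<in> X" using p by auto
      from ktuplesD(3)[OF X[OF this]] show "set (take k (C (fst p))) \<subseteq> {..<n (fst p)} \<times> {-1, 1}"
        using set_take_subset by fast
    qed simp
  qed auto
qed auto

text \<open>The degree \<open>D\<close> is a constant and not part of the input: the induction
  yields one program for each \<open>D\<close>, and the degree of its time bound may depend on
  \<open>D\<close>.\<close>

lemma ptime_tens:
  assumes v: "ptime X e (\<lambda>x. enc_list enc_trit (v x))" and X: "\<And>x. x \<in> X \<Longrightarrow> set (v x) \<subseteq> {-1, 1, 0}"
  shows "ptime X e (\<lambda>x. enc_list enc_trit (tens D (v x)))"
proof (induction D)
  case 0
  show ?case using ptime_const[of X e "enc_list enc_trit [1]"] by simp
next
  case (Suc D)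
  let ?Y = "SIGMA x:X. set (tens D (v x))"
  let ?e = "\<lambda>p. Nd (e (fst p)) (enc_trit (snd p))"
  let ?Z = "SIGMA p:?Y. set (1 # v (fst p))"
  let ?e' = "\<lambda>t. Nd (?e (fst t)) (enc_trit (snd t))"
  have "ptime X e (\<lambda>x. enc_list (enc_list enc_trit) (map (\<lambda>a. map (\<lambda>b. a * b) (1 # v x)) (tens D (v x))))"
  proof (rule ptime_map[where Y = ?Y, OF Suc])
    have v': "ptime ?Y ?e (\<lambda>p. enc_list enc_trit (v (fst p)))" by (rule ptime_lift[where h = fst, OF v]) auto
    show "ptime ?Y ?e (\<lambda>p. enc_list enc_trit (map (\<lambda>b. snd p * b) (1 # v (fst p))))"
    proof (rule ptime_map[where Y = ?Z and ea = enc_trit])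
      show "ptime ?Y ?e (\<lambda>p. enc_list enc_trit (1 # v (fst p)))" by (intro ptime_Cons ptime_const v')
      have a: "ptime ?Z ?e' (\<lambda>t. enc_trit (snd (fst t)))" by (rule ptime_lift[where h = fst, OF ptime_env1]) auto
      show "ptime ?Z ?e' (\<lambda>t. enc_trit (snd (fst t) * snd t))"
      proof (intro ptime_mult_trit a ptime_env1)
        fix t assume t: "t \<in> ?Z"
        then have x: "fst (fst t) \<in> X" "snd (fst t) \<in> set (tens D (v (fst (fst t))))"
          "snd t \<in> set (1 # v (fst (fst t)))" by auto
        show "snd (fst t) \<in> {-1, 1, 0}" using set_tens[OF X[OF x(1)], of D] x(2) by blast
        show "snd t \<in> {-1, 1, 0}" using X[OF x(1)] x(3) by auto
      qed
    qed auto
  qed auto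
  from ptime_concat[OF this] show ?case by simp
qed

lemma ptime_label:
  assumes "ptime X e (\<lambda>x. enc_list enc_bool (bs x))"
  shows "ptime X e (\<lambda>x. enc_trit (label (bs x)))"
proof -
  have *: "fold (\<lambda>b acc. if b then - acc else acc) bs a = label bs * a" for bs a
    by (induction bs arbitrary: a) (auto simp: label_def)
  let ?Y = "X \<times> (UNIV \<times> {-1, 1, 0 :: int})"
  let ?e = "\<lambda>p. Nd (e (fst p)) (Nd (enc_bool (fst (snd p))) (enc_trit (snd (snd p))))"
  have "ptime X e (\<lambda>x. enc_trit (fold (\<lambda>b acc. if b then - acc else acc) (bs x) 1))"
  proof (rule ptime_fold[where eb = enc_trit and Y = ?Y, OF assms])
    show "ptime X e (\<lambda>x. enc_trit 1)" by (rule ptime_const)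
    show "ptime ?Y ?e (\<lambda>p. enc_trit (if fst (snd p) then - snd (snd p) else snd (snd p)))"
      by (intro ptime_if_distrib[where enc = enc_trit] ptime_if_bool ptime_uminus_trit ptime_env2 ptime_env3) auto
    show "pbounded X e (\<lambda>_. 2)" by (rule pbounded_const)
    have lab: "label cs \<in> {-1, 1, 0}" for cs using label_in[of cs] by auto
    show "size (enc_trit (fold (\<lambda>b acc. if b then - acc else acc) (take k (bs x)) 1)) \<le> 2" for x k
      using size_enc_trit[OF lab] by (simp add: *)
    show "(x, bs x ! k, fold (\<lambda>b acc. if b then - acc else acc) (take k (bs x)) 1) \<in> ?Y" if "x \<in> X" for x k
      using that lab[of "take k (bs x)"] unfolding * by simp
  qed
  then show ?thesis by (simp add: *)
qed

lemma ptime_flip_example: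
  assumes n: "ptime X e (\<lambda>x. enc_nat (n x))" and C: "ptime X e (\<lambda>x. enc_ktuple (C x))"
    and bs: "ptime X e (\<lambda>x. enc_list enc_bool (bs x))"
    and X: "\<And>x. x \<in> X \<Longrightarrow> C x \<in> ktuples (n x) K" "\<And>x. x \<in> X \<Longrightarrow> length (bs x) = K"
  shows "ptime X e (\<lambda>x. enc_pair enc_vec enc_trit (flip_example (n x) D (C x) (bs x)))"
  unfolding flip_example_def enc_vec_def
  by (intro ptime_Pair ptime_tens ptime_kvec[where K = K] n ptime_flip[OF C bs X] ptime_label[OF bs]
      set_kvec[where K = K] flip_in_ktuples X)

text \<open>Learner and evaluator come with time bounds in a parameter \<open>k\<close>. As the
  dimension is present in unary or as the length of a vector, it is at most the size of the
  input.\<close>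

lemma ptime_result:
  assumes "\<And>x. x \<in> X \<Longrightarrow> halts_within c (e x) (poly p (k x))" "\<And>x. x \<in> X \<Longrightarrow> k x \<le> size (e x)"
  shows "ptime X e (\<lambda>x. result c (e x))"
proof (rule ptI)
  show "pbounded X e (\<lambda>x. poly p (size (e x)))" by (intro pbounded_intros)
  show "\<exists>t s. exec c (init (e x)) t s \<and> s 0 = result c (e x) \<and> t \<le> poly p (size (e x))" if x: "x \<in> X" for x
  proof -
    obtain t s where ts: "t \<le> poly p (k x)" "exec c (init (e x)) t s"
      using assms(1)[OF x] by (auto simp: halts_within_def)
    then show ?thesis using result_eq[OF ts(2)] poly_nat_mono[OF assms(2)[OF x], of p]
      by (auto intro: order_trans)
  qed
qed

text \<open>The label -1 is encoded by \<open>Lf\<close>, which is also the output that the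
  evaluator uses for -1. Comparing prediction and label takes tests for \<open>Lf\<close>
  only.\<close>

lemma errors_eq_fold:
  assumes "\<And>p. p \<in> set ts \<Longrightarrow> snd p \<in> {-1, 1}"
  shows "errors (hypothesis E z) ts = fold (\<lambda>p acc. if result E (Nd z (enc_vec (fst p))) \<noteq> Lf
    then if enc_trit (snd p) \<noteq> Lf then acc else Suc acc
    else if enc_trit (snd p) \<noteq> Lf then Suc acc else acc) ts 0"
proof -
  let ?st = "\<lambda>p acc. if result E (Nd z (enc_vec (fst p))) \<noteq> Lf
    then if enc_trit (snd p) \<noteq> Lf then acc else Suc acc
    else if enc_trit (snd p) \<noteq> Lf then Suc acc else acc"
  have "fold ?st ts b = errors (hypothesis E z) ts + b" for b
    using assms
  proof (induction ts arbitrary: b)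
    case (Cons p ts)
    obtain v y where p: "p = (v, y)" by (cases p)
    then have "y = -1 \<or> y = 1" using Cons.prems by fastforce
    moreover have "fold ?st ts c = errors (hypothesis E z) ts + c" for c
      by (rule Cons.IH) (use Cons.prems in auto)
    ultimately show ?case
      by (auto simp: p errors_def hypothesis_def enc_trit_def)
  qed (simp add: errors_def)
  then show ?thesis by simp
qed

lemma ptime_errors:
  assumes z: "ptime X e z" and ts: "ptime X e (\<lambda>x. enc_list (enc_pair enc_vec enc_trit) (ts x))"
    and X: "\<And>x. x \<in> X \<Longrightarrow> set (ts x) \<subseteq> examples (k x)"
    and h: "\<And>x v. x \<in> X \<Longrightarrow> v \<in> instances (k x) \<Longrightarrow> halts_within E (Nd (z x) (enc_vec v)) (poly p (k x))"
  shows "ptime X e (\<lambda>x. enc_nat (errors (hypothesis E (z x)) (ts x)))"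
proof -
  let ?st = "\<lambda>x p acc. if result E (Nd (z x) (enc_vec (fst p))) \<noteq> Lf
    then if enc_trit (snd p) \<noteq> Lf then acc else Suc acc
    else if enc_trit (snd p) \<noteq> Lf then Suc acc else acc"
  let ?Y = "SIGMA x:X. examples (k x) \<times> UNIV"
  let ?e = "\<lambda>p. Nd (e (fst p)) (Nd (enc_pair enc_vec enc_trit (fst (snd p))) (enc_nat (snd (snd p))))"
  have "ptime X e (\<lambda>x. enc_nat (fold (?st x) (ts x) 0))"
  proof (rule ptime_fold[where eb = enc_nat and Y = ?Y, OF ts])
    show "ptime X e (\<lambda>x. enc_nat 0)" by (rule ptime_const)
    have z': "ptime ?Y ?e (\<lambda>p. z (fst p))" by (rule ptime_lift[where h = fst, OF z]) auto
    have v: "ptime ?Y ?e (\<lambda>p. enc_vec (fst (fst (snd p))))" by (rule ptime_fst[OF ptime_env2])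
    have y: "ptime ?Y ?e (\<lambda>p. enc_trit (snd (fst (snd p))))" by (rule ptime_snd[OF ptime_env2])
    have "ptime ?Y (\<lambda>p. Nd (z (fst p)) (enc_vec (fst (fst (snd p)))))
      (\<lambda>p. result E (Nd (z (fst p)) (enc_vec (fst (fst (snd p))))))"
    proof (rule ptime_result[where k = "\<lambda>p. k (fst p)"])
      fix q assume q: "q \<in> ?Y"
      then have "fst (fst (snd q)) \<in> instances (k (fst q))" "fst q \<in> X" by (auto simp: examples_def)
      then show "halts_within E (Nd (z (fst q)) (enc_vec (fst (fst (snd q))))) (poly p (k (fst q)))"
        "k (fst q) \<le> size (Nd (z (fst q)) (enc_vec (fst (fst (snd q)))))"
        using h length_le_size_enc_list[of "fst (fst (snd q))" enc_trit]
        by (auto simp: instances_def enc_vec_def)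
    qed
    from ptime_comp[OF this, where h = "\<lambda>p. p", OF ptime_Nd[OF z' v]]
    have r: "ptime ?Y ?e (\<lambda>p. result E (Nd (z (fst p)) (enc_vec (fst (fst (snd p))))))" by simp
    show "ptime ?Y ?e (\<lambda>p. enc_nat (?st (fst p) (fst (snd p)) (snd (snd p))))"
      by (intro ptime_if_distrib[where enc = enc_nat] ptime_if r ptime_Suc ptime_env3 ptime_subset[OF y]) auto
    show "pbounded X e (\<lambda>x. size (enc_list (enc_pair enc_vec enc_trit) (ts x)))" by (rule ptime_size[OF ts])
    have "fold (?st x) us b \<le> length us + b" for x us b
    proof (induction us arbitrary: b)
      case (Cons p us)
      show ?case using Cons[of b] Cons[of "Suc b"] by simp
    qed simp
    from this[of _ "take i (ts x)" 0 for i x]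
    have "fold (?st x) (take i (ts x)) 0 \<le> length (ts x)" for x i
      by (rule order_trans) simp
    then show "size (enc_nat (fold (?st x) (take i (ts x)) 0)) \<le> size (enc_list (enc_pair enc_vec enc_trit) (ts x))" for x i
      unfolding size_enc_nat using length_le_size_enc_list[of "ts x" "enc_pair enc_vec enc_trit"] by (rule order_trans)
    show "(x, ts x ! i, fold (?st x) (take i (ts x)) 0) \<in> ?Y" if "x \<in> X" "i < length (ts x)" for x i
      using X[OF that(1)] nth_mem[OF that(2)] that by auto
  qed
  then show ?thesis
  proof (rule ptime_cong)
    show "x \<in> X \<and> e x = e x \<and> enc_nat (fold (?st x) (ts x) 0) = enc_nat (errors (hypothesis E (z x)) (ts x))"
      if "x \<in> X" for x
      using that X[OF that] by (subst errors_eq_fold) (auto simp: examples_def)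
  qed
qed

lemma prob_cong_supp:
  "(\<And>x. x \<in> set_pmf p \<Longrightarrow> x \<in> A \<longleftrightarrow> x \<in> B) \<Longrightarrow> measure_pmf.prob p A = measure_pmf.prob p B"
  by (intro antisym prob_mono_supp) auto

section \<open>The distinguisher\<close>

definition input :: "nat \<times> ktuple list \<times> bool list \<Rightarrow> bintree" where
  "input x = with_coins (enc_formula (fst x) (fst (snd x))) (snd (snd x))"

lemma ptime_input:
  "ptime X input (\<lambda>x. enc_nat (fst x))"
  "ptime X input (\<lambda>x. enc_list enc_ktuple (fst (snd x)))"
  "ptime X input (\<lambda>x. enc_list enc_bool (snd (snd x)))"
  using ptime_left[OF ptime_left[OF ptime_id[of X input]]] ptime_right[OF ptime_left[OF ptime_id[of X input]]]
    ptime_right[OF ptime_id[of X input]]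
  by (simp_all add: input_def with_coins_def enc_formula_def)

lemma finite_set_coins [simp]: "finite (set_pmf (coins q n))"
  by (simp add: coins_def)

text \<open>Here \<open>c\<close> is the exponent of the advantage, \<open>a\<close> the scale on
  which K and D depend, \<open>T\<close> the number of trials and \<open>n0\<close> the bound from
  which the learner is trusted.\<close>

locale reduction =
  fixes L E :: com and q d :: "nat poly" and c a T n0 :: nat
  assumes eff: "efficient L q d E" and a: "a > 0" and n0: "n0 > 0"
begin

definition "K = 8 * a\<^sup>2"

definition "D = 40 * a"

definition "num n = n ^ (2 * a\<^sup>2)" for n :: nat

definition "fdim n = (n + 1) ^ D" for n :: nat

text \<open>The first summand counts the training examples, the second the test examples.\<close>

definition "nsamp n = poly d (fdim n) + 2 * fdim n ^ (2 * c + 1)"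

text \<open>An example takes m coins for its index and K for its flips; the rest are the learner's
  own coins.\<close>

definition "ncoins n m = (m + K) * nsamp n + poly q (fdim n)"

definition sample :: "nat \<Rightarrow> ktuple list \<Rightarrow> bool list \<Rightarrow> (int list \<times> int) list" where
  "sample n J r = map (\<lambda>cs. flip_example n D (J ! idx (length J) (take (length J) cs)) (drop (length J) cs))
     (chunks (length J + K) (nsamp n) r)"

definition learnt :: "nat \<Rightarrow> (int list \<times> int) list \<Rightarrow> bool list \<Rightarrow> bintree" where
  "learnt n S r = result L (with_coins (enc_sample (fdim n) S) r)"

text \<open>As a truncated difference this is nonzero exactly if the hypothesis passes the test.
  Scores of several trials can then be combined by addition.\<close>

definition score :: "nat \<Rightarrow> (int list \<times> int) list \<Rightarrow> bool list \<Rightarrow> nat" where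
  "score n xs r = fdim n ^ (2 * c + 1) - (errors (hypothesis E (learnt n (take (poly d (fdim n)) xs) r))
     (drop (poly d (fdim n)) xs) + fdim n ^ (c + 1))"

definition trial :: "nat \<Rightarrow> ktuple list \<Rightarrow> bool list \<Rightarrow> nat" where
  "trial n J r = score n (sample n J r) (drop ((length J + K) * nsamp n) r)"

text \<open>The sum vanishes iff all trials fail, and the number 0 is encoded by \<open>Lf\<close>,
  the answer "random". For small n the constant answer "non-random" is safe: formulas of large value
  require it for every n, random ones restrict the limit only.\<close>

definition main :: "nat \<Rightarrow> ktuple list \<Rightarrow> bool list \<Rightarrow> nat" where
  "main n J r = (if n0 \<le> n then sum_list (map (\<lambda>r'. trial n J r') (chunks (ncoins n (length J)) T r)) else 1)"

definition valid :: "(nat \<times> ktuple list \<times> bool list) set" where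
  "valid = {x. 0 < length (fst (snd x)) \<and> set (fst (snd x)) \<subseteq> ktuples (fst x) K \<and>
     length (snd (snd x)) = ncoins (fst x) (length (fst (snd x)))}"

lemma length_sample [simp]: "length (sample n J r) = nsamp n"
  by (simp add: sample_def)

lemma set_sample:
  assumes "(n, J, r) \<in> valid"
  shows "set (sample n J r) \<subseteq> examples (fdim n)"
proof -
  have "J ! idx (length J) cs \<in> ktuples n K" for cs
    using assms idx_less[of "length J" cs] nth_mem by (force simp: valid_def)
  then have "flip_example n D (J ! idx (length J) cs) bs \<in> examples ((n + 1) ^ D)" for cs bs
    by (rule flip_example_in)
  then show ?thesis unfolding sample_def fdim_def set_map by blast
qed

lemma ptime_fdim: "ptime X e (\<lambda>x. enc_nat (n x)) \<Longrightarrow> ptime X e (\<lambda>x. enc_nat (fdim (n x)))"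
  unfolding fdim_def by (intro ptime_power ptime_add ptime_const)

lemma ptime_nsamp: "ptime X e (\<lambda>x. enc_nat (n x)) \<Longrightarrow> ptime X e (\<lambda>x. enc_nat (nsamp (n x)))"
  unfolding nsamp_def by (intro ptime_add ptime_mult ptime_const ptime_poly ptime_power ptime_fdim)

lemma ptime_ncoins:
  "ptime X e (\<lambda>x. enc_nat (n x)) \<Longrightarrow> ptime X e (\<lambda>x. enc_nat (m x)) \<Longrightarrow> ptime X e (\<lambda>x. enc_nat (ncoins (n x) (m x)))"
  unfolding ncoins_def by (intro ptime_add ptime_mult ptime_const ptime_poly ptime_fdim ptime_nsamp)

lemma ptime_sample:
  "ptime valid input (\<lambda>x. enc_list (enc_pair enc_vec enc_trit) (sample (fst x) (fst (snd x)) (snd (snd x))))"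
  unfolding sample_def
proof -
  let ?m = "\<lambda>x :: nat \<times> ktuple list \<times> bool list. length (fst (snd x))"
  let ?ch = "\<lambda>x. chunks (?m x + K) (nsamp (fst x)) (snd (snd x))"
  let ?Y = "SIGMA x:valid. set (?ch x)"
  let ?e = "\<lambda>p. Nd (input (fst p)) (enc_list enc_bool (snd p))"
  have ch: "ptime valid input (\<lambda>x. enc_list (enc_list enc_bool) (?ch x))"
    by (intro ptime_chunks ptime_add ptime_const ptime_nsamp ptime_length[OF ptime_input(2)] ptime_input)
       (auto simp: valid_def ncoins_def)
  have len: "length (snd p) = ?m (fst p) + K" "0 < ?m (fst p)" "set (fst (snd (fst p))) \<subseteq> ktuples (fst (fst p)) K"
    if p: "p \<in> ?Y" for p
  proof -
    have v: "fst p \<in> valid" and s: "snd p \<in> set (?ch (fst p))" using p by auto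
    have "(?m (fst p) + K) * nsamp (fst (fst p)) \<le> length (snd (snd (fst p)))"
      using v by (simp add: valid_def ncoins_def)
    from set_chunks[OF this s] show "length (snd p) = ?m (fst p) + K" .
    show "0 < ?m (fst p)" "set (fst (snd (fst p))) \<subseteq> ktuples (fst (fst p)) K" using v by (simp_all add: valid_def)
  qed
  have n: "ptime ?Y ?e (\<lambda>p. enc_nat (fst (fst p)))" and J: "ptime ?Y ?e (\<lambda>p. enc_list enc_ktuple (fst (snd (fst p))))"
    by (rule ptime_lift[where h = fst, OF ptime_input(1)] ptime_lift[where h = fst, OF ptime_input(2)]; auto)+
  have m: "ptime ?Y ?e (\<lambda>p. enc_nat (?m (fst p)))" by (rule ptime_length[OF J])
  have t: "ptime ?Y ?e (\<lambda>p. enc_list enc_bool (take (?m (fst p)) (snd p)))"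
    by (rule ptime_take[OF m ptime_env1]) (use len in auto)
  have Jj: "ptime ?Y ?e (\<lambda>p. enc_ktuple (fst (snd (fst p)) ! idx (?m (fst p)) (take (?m (fst p)) (snd p))))"
    by (rule ptime_nth[OF J ptime_idx[OF m t]]) (use len idx_less in auto)
  show "ptime valid input (\<lambda>x. enc_list (enc_pair enc_vec enc_trit)
     (map (\<lambda>cs. flip_example (fst x) D (fst (snd x) ! idx (?m x) (take (?m x) cs)) (drop (?m x) cs)) (?ch x)))"
  proof (rule ptime_map[where Y = ?Y, OF ch])
    show "ptime ?Y ?e (\<lambda>p. enc_pair enc_vec enc_trit (flip_example (fst (fst p)) D
        (fst (snd (fst p)) ! idx (?m (fst p)) (take (?m (fst p)) (snd p))) (drop (?m (fst p)) (snd p))))"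
    proof (rule ptime_flip_example[where K = K, OF n Jj ptime_drop[OF m ptime_env1]])
      fix p assume p: "p \<in> ?Y"
      show "fst (snd (fst p)) ! idx (?m (fst p)) (take (?m (fst p)) (snd p)) \<in> ktuples (fst (fst p)) K"
        using len(3)[OF p] nth_mem[OF idx_less[OF len(2)[OF p]]] by blast
      show "length (drop (?m (fst p)) (snd p)) = K" using len(1)[OF p] by simp
    qed
  qed auto
qed

text \<open>Every sample drawn from a nonempty formula consists of proper examples, and efficiency
  promises halting of learner and evaluator on all of these, realizable or not.\<close>

lemma ptime_trial: "ptime valid input (\<lambda>x. enc_nat (trial (fst x) (fst (snd x)) (snd (snd x))))"
proof -
  let ?m = "\<lambda>x :: nat \<times> ktuple list \<times> bool list. length (fst (snd x))"
  let ?S = "\<lambda>x. sample (fst x) (fst (snd x)) (snd (snd x))"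
  let ?d = "\<lambda>x :: nat \<times> ktuple list \<times> bool list. poly d (fdim (fst x))"
  let ?tr = "\<lambda>x. take (?d x) (?S x)"
  let ?r = "\<lambda>x. drop ((?m x + K) * nsamp (fst x)) (snd (snd x))"
  let ?z = "\<lambda>x. learnt (fst x) (?tr x) (?r x)"
  have fdim: "ptime valid input (\<lambda>x. enc_nat (fdim (fst x)))" by (intro ptime_fdim ptime_input)
  have tr: "ptime valid input (\<lambda>x. enc_list (enc_pair enc_vec enc_trit) (?tr x))"
    by (intro ptime_take ptime_poly fdim ptime_sample) (simp add: nsamp_def)
  have r: "ptime valid input (\<lambda>x. enc_list enc_bool (?r x))"
    by (intro ptime_drop ptime_mult ptime_add ptime_const ptime_nsamp ptime_input ptime_length[OF ptime_input(2)])
  have ok: "?tr x \<in> samples d (fdim (fst x))" "length (?r x) = poly q (fdim (fst x))"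
    "set (?S x) \<subseteq> examples (fdim (fst x))" if x: "x \<in> valid" for x
  proof -
    have S: "set (?S x) \<subseteq> examples (fdim (fst x))" using set_sample[of "fst x" "fst (snd x)" "snd (snd x)"] x by simp
    then show "set (?S x) \<subseteq> examples (fdim (fst x))" .
    have "set (?tr x) \<subseteq> examples (fdim (fst x))" using S set_take_subset by fastforce
    then show "?tr x \<in> samples d (fdim (fst x))" by (simp add: samples_def nsamp_def)
    show "length (?r x) = poly q (fdim (fst x))" using x by (simp add: valid_def ncoins_def)
  qed
  obtain p where p: "\<And>n S r. S \<in> samples d n \<Longrightarrow> length r = poly q n \<Longrightarrow>
      halts_within L (with_coins (enc_sample n S) r) (poly p n)"
    using eff unfolding efficient_def rand_poly_time_def by blast
  obtain p' where p': "\<And>n S r x. S \<in> samples d n \<Longrightarrow> length r = poly q n \<Longrightarrow> x \<in> instances n \<Longrightarrow>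
      halts_within E (Nd (result L (with_coins (enc_sample n S) r)) (enc_vec x)) (poly p' n)"
    using eff unfolding efficient_def by blast
  let ?l = "\<lambda>x. with_coins (enc_sample (fdim (fst x)) (?tr x)) (?r x)"
  have "ptime valid ?l (\<lambda>x. result L (?l x))"
  proof (rule ptime_result[where k = "\<lambda>x. fdim (fst x)"])
    show "halts_within L (?l x) (poly p (fdim (fst x)))" if "x \<in> valid" for x
      by (rule p[OF ok(1,2)[OF that]])
    show "fdim (fst x) \<le> size (?l x)" for x by (simp add: with_coins_def enc_sample_def)
  qed
  moreover have "ptime valid input ?l"
    unfolding with_coins_def enc_sample_def by (intro ptime_Nd fdim tr r)
  ultimately have z: "ptime valid input ?z"
    unfolding learnt_def by (rule ptime_comp[where h = "\<lambda>x. x" and e' = ?l]) auto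
  have "ptime valid input (\<lambda>x. enc_nat (errors (hypothesis E (?z x)) (drop (?d x) (?S x))))"
  proof (rule ptime_errors[where k = "\<lambda>x. fdim (fst x)" and p = p', OF z ptime_drop[OF ptime_poly[OF fdim] ptime_sample]])
    fix x assume x: "x \<in> valid"
    show "set (drop (?d x) (?S x)) \<subseteq> examples (fdim (fst x))"
      using ok(3)[OF x] set_drop_subset by fastforce
    show "halts_within E (Nd (?z x) (enc_vec v)) (poly p' (fdim (fst x)))" if "v \<in> instances (fdim (fst x))" for v
      unfolding learnt_def by (rule p'[OF ok(1,2)[OF x] that])
  qed
  then show ?thesis unfolding trial_def score_def
    by (intro ptime_minus ptime_add ptime_power fdim)
qed

text \<open>Nothing is required for n below \<open>n0\<close>, where the answer does not depend on
  the formula. This covers n = 0, for which the formula is empty and no index can be drawn.\<close>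

lemma ptime_main:
  "ptime {x. n0 \<le> fst x \<longrightarrow> 0 < length (fst (snd x)) \<and> set (fst (snd x)) \<subseteq> ktuples (fst x) K \<and>
       length (snd (snd x)) = ncoins (fst x) (length (fst (snd x))) * T} input
     (\<lambda>x. enc_nat (main (fst x) (fst (snd x)) (snd (snd x))))"
  (is "ptime ?X input _")
proof -
  let ?W = "{x \<in> ?X. n0 \<le> fst x}"
  let ?ch = "\<lambda>x. chunks (ncoins (fst x) (length (fst (snd x)))) T (snd (snd x))"
  let ?Y = "SIGMA x:?W. set (?ch x)"
  let ?e = "\<lambda>p. Nd (input (fst p)) (enc_list enc_bool (snd p))"
  have ch: "ptime ?W input (\<lambda>x. enc_list (enc_list enc_bool) (?ch x))"
    by (intro ptime_chunks ptime_ncoins ptime_const ptime_input ptime_length[OF ptime_input(2)]) auto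
  have ch_length: "length cs = ncoins (fst x) (length (fst (snd x)))" if "x \<in> ?W" "cs \<in> set (?ch x)" for x cs
    by (rule set_chunks[OF _ that(2)]) (use that in auto)
  have "ptime ?Y ?e (\<lambda>p. enc_nat (fst (fst p)))" "ptime ?Y ?e (\<lambda>p. enc_list enc_ktuple (fst (snd (fst p))))"
    by (rule ptime_lift[where h = fst, OF ptime_input(1)[of ?W]] ptime_lift[where h = fst, OF ptime_input(2)[of ?W]]; auto)+
  from ptime_Nd[OF ptime_Nd[OF this] ptime_env1]
  have "ptime ?Y ?e (\<lambda>p. input (fst (fst p), fst (snd (fst p)), snd p))"
    by (simp add: input_def with_coins_def enc_formula_def)
  then have "ptime ?Y ?e (\<lambda>p. (\<lambda>x. enc_nat (trial (fst x) (fst (snd x)) (snd (snd x))))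
      (fst (fst p), fst (snd (fst p)), snd p))"
  proof (rule ptime_comp[OF ptime_trial])
    fix p assume p: "p \<in> ?Y"
    then have "fst p \<in> ?W" "snd p \<in> set (?ch (fst p))" by auto
    with ch_length[OF this] show "(fst (fst p), fst (snd (fst p)), snd p) \<in> valid"
      by (simp add: valid_def)
  qed
  then have tr: "ptime ?Y ?e (\<lambda>p. enc_nat (trial (fst (fst p)) (fst (snd (fst p))) (snd p)))"
    by (simp only: fst_conv snd_conv)
  have "ptime ?W input (\<lambda>x. enc_list enc_nat (map (\<lambda>r'. trial (fst x) (fst (snd x)) r') (?ch x)))"
    by (rule ptime_map[where Y = ?Y and f = "\<lambda>x r'. trial (fst x) (fst (snd x)) r'"
        and eb = enc_nat, OF ch tr]) (rule SigmaI)
  from ptime_sum_list[OF this] show ?thesis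
    unfolding main_def by (intro ptime_if_distrib[where enc = enc_nat] ptime_if_le ptime_const ptime_input)
qed

end
section \<open>Correctness of the reduction\<close>

lemma poly_nat_bound: "\<exists>A e. \<forall>N\<ge>1. poly p N \<le> A * N ^ e" for p :: "nat poly"
proof (induction p)
  case (pCons b p)
  then obtain A e where Ae: "\<And>N. N \<ge> 1 \<Longrightarrow> poly p N \<le> A * N ^ e" by blast
  have "poly (pCons b p) N \<le> (b + A) * N ^ (Suc e)" if "N \<ge> 1" for N
  proof -
    have "b * 1 \<le> b * N ^ Suc e" using that by (intro mult_left_mono) (auto simp: one_le_power)
    moreover have "N * poly p N \<le> N * (A * N ^ e)" by (rule mult_left_mono[OF Ae[OF that]]) simp
    moreover have "(b + A) * N ^ Suc e = b * N ^ Suc e + N * (A * N ^ e)" by (simp add: algebra_simps)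
    ultimately show ?thesis unfolding poly_pCons by linarith
  qed
  then show ?case by blast
qed auto

lemma size_enc_list_le: "(\<And>x. x \<in> set xs \<Longrightarrow> size (f x) \<le> k) \<Longrightarrow> size (enc_list f xs) \<le> length xs * (k + 1)"
proof (induction xs)
  case (Cons x xs)
  then have "size (f x) \<le> k" "size (enc_list f xs) \<le> length xs * (k + 1)" by auto
  then show ?case by simp
qed simp

context reduction
begin

lemma fdim_ge: "n < fdim n"
proof -
  have "n + 1 \<le> (n + 1) ^ D" using a by (intro self_le_power) (auto simp: D_def)
  then show ?thesis by (simp add: fdim_def)
qed

definition coin_poly :: "nat poly" where
  "coin_poly = ((monom 1 (2 * a\<^sup>2) + [:K:]) * (pcompose d ([:1, 1:] ^ D) + [:2:] * ([:1, 1:] ^ D) ^ (2 * c + 1)) +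
     pcompose q ([:1, 1:] ^ D)) * [:T:]"

lemma poly_coin_poly: "poly coin_poly n = ncoins n (num n) * T"
  by (simp add: coin_poly_def ncoins_def num_def nsamp_def fdim_def poly_pcompose poly_monom algebra_simps)

lemma num_pos: "n > 0 \<Longrightarrow> num n > 0"
  by (simp add: num_def)

text \<open>The time bound of \<open>ptime\<close> is polynomial in the size of the input, whereas
  \<open>rand_poly_time\<close> asks for one in n. They are linked by the polynomial size of a
  formula together with its coins.\<close>

lemma algorithm:
  obtains A where "rand_poly_time A coin_poly (\<lambda>n. enc_formula n ` formulas n K (num n))"
    "\<And>n J r. J \<in> formulas n K (num n) \<Longrightarrow> length r = poly coin_poly n \<Longrightarrow>
      result A (with_coins (enc_formula n J) r) = enc_nat (main n J r)"
proof -
  let ?X = "{x. n0 \<le> fst x \<longrightarrow> 0 < length (fst (snd x)) \<and> set (fst (snd x)) \<subseteq> ktuples (fst x) K \<and>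
       length (snd (snd x)) = ncoins (fst x) (length (fst (snd x))) * T}"
  obtain A B where B: "pbounded ?X input B"
    "\<And>x. x \<in> ?X \<Longrightarrow> \<exists>t s. exec A (init (input x)) t s \<and>
       s 0 = enc_nat (main (fst x) (fst (snd x)) (snd (snd x))) \<and> t \<le> B x"
    by (rule ptE[OF ptime_main]) (rule that; assumption)
  obtain p where p: "\<And>x. x \<in> ?X \<Longrightarrow> B x \<le> poly p (size (input x))"
    using B(1) unfolding pbounded_def by blast
  have run: "\<exists>t s. exec A (init (with_coins (enc_formula n J) r)) t s \<and> s 0 = enc_nat (main n J r) \<and>
     t \<le> poly p (size (with_coins (enc_formula n J) r))"
    if "J \<in> formulas n K (num n)" "length r = poly coin_poly n" for n J r
  proof -
    have x: "(n, J, r) \<in> ?X"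
      using that n0 num_pos[of n] by (auto simp: formulas_def poly_coin_poly)
    from B(2)[OF x] p[OF x] show ?thesis by (auto simp: input_def intro: order_trans)
  qed
  \<comment> \<open>The inner polynomial estimates the input size: the unary n, then
    \<open>num n\<close> tuples of K short pairs, then two nodes per coin.\<close>
  define P where "P = pcompose p ([:2, 1:] + monom 1 (2 * a\<^sup>2) * [:K * 4 + 1, K:] + [:2:] * coin_poly)"
  show ?thesis
  proof
    show "rand_poly_time A coin_poly (\<lambda>n. enc_formula n ` formulas n K (num n))"
      unfolding rand_poly_time_def
    proof (intro exI[of _ P] allI ballI impI)
      fix n x and r :: "bool list" assume x: "x \<in> enc_formula n ` formulas n K (num n)" and r: "length r = poly coin_poly n"
      then obtain J where J: "J \<in> formulas n K (num n)" "x = enc_formula n J" by auto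
      have "size (enc_pair enc_nat enc_trit y) \<le> n + 3" if "C \<in> set J" "y \<in> set C" for C y
      proof -
        have "y \<in> {..<n} \<times> {-1, 1}" using that J ktuplesD(3)[of C n K] by (auto simp: formulas_def)
        then show ?thesis by (auto simp: enc_pair_def enc_trit_def)
      qed
      then have k: "size (enc_ktuple C) \<le> length C * (n + 3 + 1)" if "C \<in> set J" for C
        using that by (intro size_enc_list_le) auto
      have "size (enc_ktuple C) \<le> K * (n + 4)" if "C \<in> set J" for C
      proof -
        have "C \<in> ktuples n K" using that J(1) by (auto simp: formulas_def)
        then have "length C = K" by (rule ktuplesD(1))
        with k[OF that] show ?thesis by (simp add: algebra_simps)
      qed
      then have "size (enc_list enc_ktuple J) \<le> length J * (K * (n + 4) + 1)"
        by (rule size_enc_list_le)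
      then have 1: "size (enc_list enc_ktuple J) \<le> num n * (K * (n + 4) + 1)"
        using J by (simp add: formulas_def)
      have "size (enc_list enc_bool r) \<le> length r * (1 + 1)"
        by (rule size_enc_list_le) (simp add: enc_bool_def)
      then have "size (with_coins x r) \<le> (2 + n) + num n * (K * (n + 4) + 1) + 2 * poly coin_poly n"
        using 1 r by (simp add: J(2) with_coins_def enc_formula_def)
      then have "poly p (size (with_coins x r)) \<le> poly P n"
        unfolding P_def poly_pcompose by (intro poly_nat_mono) (simp add: poly_monom num_def algebra_simps)
      then show "halts_within A (with_coins x r) (poly P n)"
        using run[OF J(1) r] unfolding J(2) halts_within_def by (meson order_trans)
    qed
    show "result A (with_coins (enc_formula n J) r) = enc_nat (main n J r)"
      if "J \<in> formulas n K (num n)" "length r = poly coin_poly n" for n J r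
      using run[OF that] result_eq by metis
  qed
qed

section \<open>Acceptance probabilities\<close>

definition trial_prob :: "nat \<Rightarrow> ktuple list \<Rightarrow> real" where
  "trial_prob n J = measure_pmf.prob (pair_pmf (replicate_pmf (nsamp n) (formula_pmf n D K J)) (coins q (fdim n)))
     {(xs, r). score n xs r \<noteq> 0}"

text \<open>Disjoint blocks of coins are independent, and a block of \<open>length J + K\<close>
  coins determines one example.\<close>

lemma map_trial_pmf:
  "map_pmf (\<lambda>r. (sample n J r, drop ((length J + K) * nsamp n) r)) (replicate_pmf (ncoins n (length J)) coin) =
   pair_pmf (replicate_pmf (nsamp n) (formula_pmf n D K J)) (coins q (fdim n))"
proof -
  let ?m = "length J"
  let ?w = "?m + K"
  let ?g = "\<lambda>cs. flip_example n D (J ! idx ?m (take ?m cs)) (drop ?m cs)"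
  have g: "map_pmf ?g (replicate_pmf ?w coin) = formula_pmf n D K J"
  proof -
    have "map_pmf ?g (replicate_pmf ?w coin) = do {xs \<leftarrow> replicate_pmf ?m coin; ys \<leftarrow> replicate_pmf K coin;
        return_pmf (?g (xs @ ys))}"
      by (simp add: replicate_pmf_distrib map_bind_pmf)
    also have "\<dots> = do {xs \<leftarrow> replicate_pmf ?m coin; ys \<leftarrow> replicate_pmf K coin;
        return_pmf (flip_example n D (J ! idx ?m xs) ys)}"
      by (intro bind_pmf_cong refl) (simp add: set_replicate_pmf)
    also have "\<dots> = formula_pmf n D K J"
      by (simp add: formula_pmf_def index_pmf_def pair_pmf_def map_bind_pmf bind_map_pmf)
    finally show ?thesis .
  qed
  have "map_pmf (\<lambda>r. (sample n J r, drop (?w * nsamp n) r)) (replicate_pmf (ncoins n ?m) coin) =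
     do {xs \<leftarrow> replicate_pmf (?w * nsamp n) coin; ys \<leftarrow> replicate_pmf (poly q (fdim n)) coin;
       return_pmf (sample n J (xs @ ys), drop (?w * nsamp n) (xs @ ys))}"
    by (simp add: ncoins_def replicate_pmf_distrib map_bind_pmf)
  also have "\<dots> = do {xs \<leftarrow> replicate_pmf (?w * nsamp n) coin; ys \<leftarrow> replicate_pmf (poly q (fdim n)) coin;
       return_pmf (map ?g (chunks ?w (nsamp n) xs), ys)}"
    by (intro bind_pmf_cong refl) (simp add: set_replicate_pmf sample_def chunks_append2)
  also have "\<dots> = pair_pmf (map_pmf (map ?g) (map_pmf (chunks ?w (nsamp n)) (replicate_pmf (?w * nsamp n) coin)))
      (coins q (fdim n))"
    by (simp add: pair_pmf_def bind_map_pmf coins_def)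
  also have "\<dots> = pair_pmf (replicate_pmf (nsamp n) (formula_pmf n D K J)) (coins q (fdim n))"
    unfolding map_chunks_replicate_pmf map_replicate_pmf g ..
  finally show ?thesis .
qed

lemma trial_prob_eq:
  "measure_pmf.prob (replicate_pmf (ncoins n (length J)) coin) {r. trial n J r \<noteq> 0} = trial_prob n J"
  unfolding trial_prob_def map_trial_pmf[symmetric] prob_map_pmf by (simp add: trial_def)

text \<open>The trials use disjoint blocks of coins. The power amplifies the success on satisfiable
  formulas, and the union bound shows that false alarms grow by the constant factor T only.\<close>

lemma prob_main:
  assumes "n0 \<le> n" "length J = num n"
  shows "measure_pmf.prob (coins coin_poly n) {r. main n J r = 0} = (1 - trial_prob n J) ^ T"
    and "measure_pmf.prob (coins coin_poly n) {r. main n J r \<noteq> 0} \<le> real T * trial_prob n J"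
proof -
  let ?C = "replicate_pmf (ncoins n (num n)) coin"
  have c: "map_pmf (chunks (ncoins n (num n)) T) (coins coin_poly n) = replicate_pmf T ?C"
    unfolding coins_def poly_coin_poly map_chunks_replicate_pmf ..
  have "measure_pmf.prob (coins coin_poly n) {r. main n J r = 0} =
     measure_pmf.prob (replicate_pmf T ?C) {rs. \<forall>r\<in>set rs. r \<in> {r. trial n J r = 0}}"
    unfolding c[symmetric] prob_map_pmf using assms by (simp add: main_def)
  also have "\<dots> = measure_pmf.prob ?C {r. trial n J r = 0} ^ T" by (rule prob_replicate_all) simp
  also have "{r. trial n J r = 0} = UNIV - {r. trial n J r \<noteq> 0}" by auto
  also have "measure_pmf.prob ?C \<dots> = 1 - trial_prob n J"
    using trial_prob_eq[of n J] assms(2) measure_pmf.prob_compl[of "{r. trial n J r \<noteq> 0}" ?C] by simp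
  finally show "measure_pmf.prob (coins coin_poly n) {r. main n J r = 0} = (1 - trial_prob n J) ^ T" .
  have "measure_pmf.prob (coins coin_poly n) {r. main n J r \<noteq> 0} =
     measure_pmf.prob (replicate_pmf T ?C) {rs. \<exists>r\<in>set rs. r \<in> {r. trial n J r \<noteq> 0}}"
    unfolding c[symmetric] prob_map_pmf using assms by (simp add: main_def)
  also have "\<dots> \<le> real T * measure_pmf.prob ?C {r. trial n J r \<noteq> 0}" by (rule prob_replicate_ex) simp
  finally show "measure_pmf.prob (coins coin_poly n) {r. main n J r \<noteq> 0} \<le> real T * trial_prob n J"
    using trial_prob_eq[of n J] assms(2) by simp
qed

text \<open>Test examples are independent of the training data and of the learner's coins, so the
  test can be analysed for a fixed hypothesis.\<close>

lemma score_prob: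
  assumes "finite (set_pmf P)"
  shows "measure_pmf.prob (pair_pmf (replicate_pmf (nsamp n) P) (coins q (fdim n))) {(xs, r). score n xs r \<noteq> 0} =
    expect (pair_pmf (replicate_pmf (poly d (fdim n)) P) (coins q (fdim n)))
     (\<lambda>(S, r). measure_pmf.prob (replicate_pmf (2 * fdim n ^ (2 * c + 1)) P)
       {ts. errors (hypothesis E (learnt n S r)) ts + fdim n ^ (c + 1) < fdim n ^ (2 * c + 1)})"
proof -
  let ?d = "poly d (fdim n)"
  let ?M = "2 * fdim n ^ (2 * c + 1)"
  let ?A = "{(xs, r). score n xs r \<noteq> 0}"
  let ?Q = "pair_pmf (replicate_pmf ?d P) (coins q (fdim n))"
  let ?f = "\<lambda>(S, r). map_pmf (\<lambda>ts. (S @ ts, r)) (replicate_pmf ?M P)"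
  have "pair_pmf (replicate_pmf (nsamp n) P) (coins q (fdim n)) =
     do {S \<leftarrow> replicate_pmf ?d P; ts \<leftarrow> replicate_pmf ?M P; r \<leftarrow> coins q (fdim n); return_pmf (S @ ts, r)}"
    by (simp add: nsamp_def replicate_pmf_distrib pair_pmf_def bind_assoc_pmf bind_return_pmf)
  also have "\<dots> = do {S \<leftarrow> replicate_pmf ?d P; r \<leftarrow> coins q (fdim n); ts \<leftarrow> replicate_pmf ?M P; return_pmf (S @ ts, r)}"
    by (intro bind_pmf_cong refl bind_commute_pmf)
  also have "\<dots> = bind_pmf ?Q ?f"
    by (simp add: pair_pmf_def map_pmf_def bind_assoc_pmf bind_return_pmf)
  finally have "measure_pmf.prob (pair_pmf (replicate_pmf (nsamp n) P) (coins q (fdim n))) ?A =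
     expect ?Q (\<lambda>y. measure_pmf.prob (?f y) ?A)"
    using assms by (simp only: prob_bind) (subst prob_bind, auto)
  also have "\<dots> = expect ?Q (\<lambda>(S, r). measure_pmf.prob (replicate_pmf ?M P)
       {ts. errors (hypothesis E (learnt n S r)) ts + fdim n ^ (c + 1) < fdim n ^ (2 * c + 1)})"
    by (intro expect_cong) (auto simp: set_replicate_pmf prob_map_pmf score_def not_le simp del: measure_map_pmf)
  finally show ?thesis .
qed

text \<open>The learner finds a good hypothesis with probability at least \<delta>, and such a
  hypothesis passes the test with probability at least 1 - 2/N, which is at least 1/2 for N at least
  4.\<close>

lemma trial_accepts:
  assumes J: "J \<in> formulas n K (num n)" and n: "n > 0" and val: "VAL_XOR n J \<ge> 1 - 1 / 100"
    and learn: "\<And>P. P \<in> almost_realizable (2 / 100) (fdim n) \<Longrightarrow>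
      measure_pmf.prob (learned L q d E (fdim n) P) {h. Err P h \<le> 1 / 2 - 1 / real (fdim n) ^ c} \<ge> \<delta>"
    and \<delta>: "\<delta> \<ge> 0" and N: "fdim n \<ge> 4"
  shows "trial_prob n J \<ge> \<delta> / 2"
proof -
  let ?N = "fdim n"
  let ?P = "formula_pmf n D K J"
  let ?Q = "pair_pmf (replicate_pmf (poly d ?N) ?P) (coins q ?N)"
  let ?G = "{(S, r). Err ?P (hypothesis E (learnt n S r)) \<le> 1 / 2 - 1 / real ?N ^ c}"
  have "?P \<in> almost_realizable (2 / 100) ?N"
    using formula_pmf_almost_realizable[of J n a "num n"] J num_pos[OF n] a val
    by (simp add: D_def K_def fdim_def)
  from learn[OF this] have "\<delta> \<le> measure_pmf.prob ?Q ?G"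
    unfolding learned_def prob_map_pmf learnt_def by (simp add: case_prod_unfold)
  then have "\<delta> * (1 - 2 / real ?N) \<le> measure_pmf.prob ?Q ?G * (1 - 2 / real ?N)"
    using N by (intro mult_right_mono) (auto simp: field_simps)
  also have "\<dots> = expect ?Q (\<lambda>y. indicator ?G y * (1 - 2 / real ?N))" by simp
  also have "\<dots> \<le> expect ?Q
     (\<lambda>(S, r). measure_pmf.prob (replicate_pmf (2 * ?N ^ (2 * c + 1)) ?P)
       {ts. errors (hypothesis E (learnt n S r)) ts + ?N ^ (c + 1) < ?N ^ (2 * c + 1)})"
  proof (rule expect_mono)
    fix y assume "y \<in> set_pmf ?Q"
    obtain S r where y: "y = (S, r)" by (cases y)
    show "indicator ?G y * (1 - 2 / real ?N) \<le> (case y of (S, r) \<Rightarrow>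
       measure_pmf.prob (replicate_pmf (2 * ?N ^ (2 * c + 1)) ?P)
       {ts. errors (hypothesis E (learnt n S r)) ts + ?N ^ (c + 1) < ?N ^ (2 * c + 1)})"
    proof (cases "y \<in> ?G")
      case True
      then show ?thesis using test_accepts[of ?P ?N "hypothesis E (learnt n S r)" c] N
        by (simp add: y del: power_Suc)
    next
      case False
      then show ?thesis by (simp add: y)
    qed
  qed simp
  also have "\<dots> = trial_prob n J" unfolding trial_prob_def by (rule score_prob[symmetric]) simp
  finally have 1: "\<delta> * (1 - 2 / real ?N) \<le> trial_prob n J" .
  have "\<delta> * (1 / 2) \<le> \<delta> * (1 - 2 / real ?N)" using N \<delta> by (intro mult_left_mono) (auto simp: field_simps)
  with 1 show ?thesis by linarith
qed

text \<open>Apart from the collision term, the examples come from \<open>scattered_pmf\<close>,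
  where whatever the learner outputs has error exactly 1/2 and so passes with probability at most
  2/N.\<close>

lemma expect_trial_prob:
  assumes "K \<le> n" "n > 0"
  shows "expect (random_formula n K (num n)) (trial_prob n) \<le>
    (real (nsamp n))\<^sup>2 * (3 / (2 * real (num n))) + 2 / real (fdim n)"
proof -
  let ?N = "fdim n"
  let ?P = "scattered_pmf n D K"
  have K: "K > 0" using a by (simp add: K_def)
  have fin: "finite (set_pmf ?P)" using assms(1) by simp
  have N: "?N > 0" using fdim_ge[of n] by simp
  have h: "Err ?P (hypothesis E z) = 1 / 2" for z
    by (rule Err_scattered[OF assms(1)]) (auto simp: hypothesis_def)
  have "measure_pmf.prob (pair_pmf (replicate_pmf (nsamp n) ?P) (coins q ?N)) {(xs, r). score n xs r \<noteq> 0} \<le>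
     expect (pair_pmf (replicate_pmf (poly d ?N) ?P) (coins q ?N)) (\<lambda>_. 2 / real ?N)"
    unfolding score_prob[OF fin]
    by (rule expect_mono) (use fin test_rejects[OF fin N h] in \<open>auto simp del: power_Suc\<close>)
  then have "measure_pmf.prob (pair_pmf (replicate_pmf (nsamp n) ?P) (coins q ?N)) {(xs, r). score n xs r \<noteq> 0} \<le> 2 / real ?N"
    by simp
  then show ?thesis
    using expect_random_formula_le[OF assms(1) K num_pos[OF assms(2)], of "coins q ?N" "nsamp n" D
      "{(xs, r). score n xs r \<noteq> 0}"]
    unfolding trial_prob_def by simp
qed

end

text \<open>K/4 is the integer 2a^2, so rounding has no effect; for n = 0 both sides vanish because
  the exponent is positive.\<close>

lemma nat_floor_powr: "a > 0 \<Longrightarrow> nat \<lfloor>real n powr (real (8 * a\<^sup>2) / 4)\<rfloor> = n ^ (2 * a\<^sup>2)" for a :: nat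
proof (cases "n = 0")
  case False
  have "real (8 * a\<^sup>2) / 4 = real (2 * a\<^sup>2)" by simp
  then have "real n powr (real (8 * a\<^sup>2) / 4) = real n ^ (2 * a\<^sup>2)"
    using False by (simp only: powr_realpow of_nat_0_less_iff neq0_conv)
  then show ?thesis by (simp flip: of_nat_power)
qed simp

theorem theorem6:
  assumes "\<forall>K > 4. CSP_XOR_hard (1 - 1 / 100) (\<lambda>n. nat \<lfloor>real n powr (real K / 4)\<rfloor>) K"
  shows "\<not> (\<exists>L q d E. efficient L q d E \<and>
            nontrivial_performance L q d E (almost_realizable (2 / 100)))"
proof
  assume "\<exists>L q d E. efficient L q d E \<and> nontrivial_performance L q d E (almost_realizable (2 / 100))"
  then obtain L q d E where eff: "efficient L q d E"
    and perf: "nontrivial_performance L q d E (almost_realizable (2 / 100))" by blast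
  from perf obtain b \<delta> n1 where b: "b > 0" and \<delta>: "\<delta> > 0" and learn: "\<And>N P. N \<ge> n1 \<Longrightarrow>
      P \<in> almost_realizable (2 / 100) N \<Longrightarrow>
      measure_pmf.prob (learned L q d E N P) {h. Err P h \<le> 1 / 2 - 1 / real N powr b} \<ge> \<delta>"
    unfolding nontrivial_performance_def eventually_sequentially by blast
  \<comment> \<open>Rounding the exponent up only lowers the advantage to be detected, and it makes
    the thresholds of the test natural numbers.\<close>
  define c where "c = nat \<lceil>b\<rceil>"
  \<comment> \<open>The polynomial is \<open>nsamp\<close> as a function of the dimension N:
    training plus test examples.\<close>
  obtain A e where Ae: "\<And>N. N \<ge> 1 \<Longrightarrow> poly (d + monom 2 (2 * c + 1)) N \<le> A * N ^ e"
    using poly_nat_bound by blast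
  \<comment> \<open>This choice gives 2a^2 = 80ae + 2a: the number of tuples exceeds the order
    n^(80ae) of the squared number of examples by a factor n^(2a).\<close>
  define a where "a = 40 * e + 1"
  \<comment> \<open>A trial on a formula of large value succeeds with probability at least
    \<delta>/2, so T trials all fail with probability below 1/4.\<close>
  obtain T where T: "(1 - \<delta> / 2) ^ T < 1 / 4"
    using real_arch_pow_inv[of "1 / 4" "1 - \<delta> / 2"] \<delta> by auto
  \<comment> \<open>As N exceeds n, the dimension is then in the range of the learner's guarantee
    and at least 4, as \<open>trial_accepts\<close> demands.\<close>
  define n0 where "n0 = max n1 4"
  interpret reduction L E q d c a T n0
    by unfold_locales (use eff in \<open>auto simp: a_def n0_def\<close>)
  have "a\<^sup>2 \<ge> 1" using a by simp
  then have K4: "K > 4" unfolding K_def by linarith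
  have num_eq: "(\<lambda>n. nat \<lfloor>real n powr (real K / 4)\<rfloor>) = num"
    unfolding K_def num_def using nat_floor_powr[OF a] by blast
  have "CSP_XOR_easy (1 - 1 / 100) num K"
  proof -
    obtain M where M: "rand_poly_time M coin_poly (\<lambda>n. enc_formula n ` formulas n K (num n))"
      "\<And>n J r. J \<in> formulas n K (num n) \<Longrightarrow> length r = poly coin_poly n \<Longrightarrow>
        result M (with_coins (enc_formula n J) r) = enc_nat (main n J r)"
      by (rule algorithm) (rule that; assumption)
    have pn: "prob_nonrandom M coin_poly n J = measure_pmf.prob (coins coin_poly n) {r. main n J r \<noteq> 0}"
      and pr: "prob_random M coin_poly n J = measure_pmf.prob (coins coin_poly n) {r. main n J r = 0}"
      if "J \<in> formulas n K (num n)" for n J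
      unfolding prob_nonrandom_def prob_random_def
      by (rule prob_cong_supp, use M(2)[OF that] in \<open>auto simp: coins_def set_replicate_pmf\<close>)+
    have sum1: "measure_pmf.prob (coins coin_poly n) {r. main n J r \<noteq> 0} =
        1 - measure_pmf.prob (coins coin_poly n) {r. main n J r = 0}" for n J
    proof -
      have "{r. main n J r \<noteq> 0} = UNIV - {r. main n J r = 0}" by auto
      then show ?thesis
        using measure_pmf.prob_compl[of "{r. main n J r = 0}" "coins coin_poly n"] by simp
    qed
    have learn': "\<delta> \<le> measure_pmf.prob (learned L q d E (fdim n) P) {h. Err P h \<le> 1 / 2 - 1 / real (fdim n) ^ c}"
      if "n \<ge> n0" "P \<in> almost_realizable (2 / 100) (fdim n)" for n P
    proof -
      have N: "fdim n \<ge> n1" "fdim n \<ge> 1" using fdim_ge[of n] that(1) by (auto simp: n0_def)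
      have "b \<le> real c" using b unfolding c_def by linarith
      then have "real (fdim n) powr b \<le> real (fdim n) powr real c" using N by (intro powr_mono) auto
      also have "\<dots> = real (fdim n) ^ c" using N by (intro powr_realpow) auto
      finally have "1 / real (fdim n) ^ c \<le> 1 / real (fdim n) powr b" using N by (intro divide_left_mono) auto
      then have "measure_pmf.prob (learned L q d E (fdim n) P) {h. Err P h \<le> 1 / 2 - 1 / real (fdim n) powr b} \<le>
        measure_pmf.prob (learned L q d E (fdim n) P) {h. Err P h \<le> 1 / 2 - 1 / real (fdim n) ^ c}"
        by (intro measure_pmf.finite_measure_mono) auto
      with learn[OF N(1) that(2)] show ?thesis by simp
    qed
    have good: "prob_nonrandom M coin_poly n J \<ge> 3 / 4"
      if J: "J \<in> formulas n K (num n)" and val: "VAL_XOR n J \<ge> 1 - 1 / 100" for n J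
    proof (cases "n0 \<le> n")
      case True
      have tp: "trial_prob n J \<ge> \<delta> / 2"
        by (rule trial_accepts[OF J _ val learn'[OF True]]) (use True n0 \<delta> fdim_ge[of n] in \<open>auto simp: n0_def\<close>)
      have "trial_prob n J \<le> 1" by (simp add: trial_prob_def)
      then have "(1 - trial_prob n J) ^ T \<le> (1 - \<delta> / 2) ^ T" using tp by (intro power_mono) auto
      moreover have "length J = num n" using J by (simp add: formulas_def)
      ultimately show ?thesis
        unfolding pn[OF J] sum1 prob_main(1)[OF True \<open>length J = num n\<close>] using T by linarith
    next
      case False
      then show ?thesis by (simp add: pn[OF J] main_def)
    qed
    \<comment> \<open>The factor 4T stems from Markov's inequality and the T trials; the first
      summand bounds the effect of repeated tuples, the second that of passing a test by
      chance.\<close>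
    define C where "C = 4 * real T * (3 / 2 * (real A)\<^sup>2 * 2 ^ (80 * a * e) + 2)"
    have bad: "measure_pmf.prob (random_formula n K (num n)) {J. prob_random M coin_poly n J \<ge> 3 / 4} \<ge> 1 - C / real n"
      if n: "n \<ge> max n0 K" for n
    proof -
      let ?F = "random_formula n K (num n)"
      let ?B = "{J. prob_random M coin_poly n J \<ge> 3 / 4}"
      have n': "n0 \<le> n" "K \<le> n" "n > 0" using n n0 by auto
      have "1 - measure_pmf.prob ?F ?B = measure_pmf.prob ?F (UNIV - ?B)"
        using measure_pmf.prob_compl[of ?B ?F] by simp
      \<comment> \<open>Markov over the formula: if the answer "random" has probability below 3/4,
        some trial succeeds with probability above 1/4, and then \<open>T * trial_prob n J\<close>
        exceeds 1/4.\<close>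
      also have "\<dots> \<le> expect ?F (\<lambda>J. 4 * real T * trial_prob n J)"
      proof (rule prob_le_of_expect)
        fix J assume J: "J \<in> set_pmf ?F"
        then have J: "J \<in> formulas n K (num n)" using set_random_formula[OF n'(2)] by blast
        show "0 \<le> 4 * real T * trial_prob n J" by (simp add: trial_prob_def)
        assume "J \<in> UNIV - ?B"
        then have "1 / 4 < measure_pmf.prob (coins coin_poly n) {r. main n J r \<noteq> 0}"
          unfolding sum1 by (simp add: pr[OF J])
        also have "\<dots> \<le> real T * trial_prob n J"
          by (rule prob_main(2)[OF n'(1)]) (use J in \<open>simp add: formulas_def\<close>)
        finally show "1 \<le> 4 * real T * trial_prob n J" by simp
      qed (use n' in simp)
      also have "\<dots> = 4 * real T * expect ?F (trial_prob n)" by simp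
      also have "\<dots> \<le> 4 * real T * ((real (nsamp n))\<^sup>2 * (3 / (2 * real (num n))) + 2 / real (fdim n))"
        by (intro mult_left_mono expect_trial_prob n') auto
      also have "\<dots> \<le> 4 * real T * (3 / 2 * (real A)\<^sup>2 * 2 ^ (80 * a * e) / real n + 2 / real n)"
      proof (intro mult_left_mono add_mono)
        show "2 / real (fdim n) \<le> 2 / real n" using fdim_ge[of n] n' by (intro divide_left_mono) auto
        have "nsamp n \<le> A * fdim n ^ e"
          using Ae[of "fdim n"] fdim_ge[of n] by (simp add: nsamp_def poly_monom)
        also have "fdim n \<le> (2 * n) ^ (40 * a)"
          unfolding fdim_def D_def using n' by (intro power_mono) auto
        finally have "nsamp n \<le> A * (2 * n) ^ (40 * a * e)" by (simp add: power_mult mult_left_mono power_mono)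
        then have "real (nsamp n) \<le> real (A * (2 * n) ^ (40 * a * e))" by (rule of_nat_mono)
        then have "real (nsamp n) \<le> real A * (2 * real n) ^ (40 * a * e)"
          by (simp only: of_nat_mult of_nat_power of_nat_numeral)
        then have "(real (nsamp n))\<^sup>2 \<le> (real A * (2 * real n) ^ (40 * a * e))\<^sup>2" by (intro power_mono) auto
        also have "\<dots> = (real A)\<^sup>2 * 2 ^ (80 * a * e) * real n ^ (80 * a * e)"
        proof -
          have "((2 * real n) ^ (40 * a * e))\<^sup>2 = (2 * real n) ^ (40 * a * e * 2)" by (rule power_mult[symmetric])
          also have "40 * a * e * 2 = 80 * a * e" by simp
          finally show ?thesis by (simp only: power_mult_distrib mult.assoc)
        qed
        finally have s: "(real (nsamp n))\<^sup>2 \<le> (real A)\<^sup>2 * 2 ^ (80 * a * e) * real n ^ (80 * a * e)" .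
        \<comment> \<open>Of the spare factor n^(2a) a single n is kept; it makes the error tend to
          0.\<close>
        have ex: "2 * a\<^sup>2 = 80 * a * e + 2 * a" by (simp add: a_def power2_eq_square algebra_simps)
        have "real n ^ 1 \<le> real n ^ (2 * a)" using n' a by (intro power_increasing) auto
        then have m: "real n ^ (80 * a * e) * real n \<le> real (num n)"
          unfolding num_def ex using n' by (simp add: power_add mult_left_mono)
        have "(real (nsamp n))\<^sup>2 * (3 / (2 * real (num n))) \<le>
            (real A)\<^sup>2 * 2 ^ (80 * a * e) * real n ^ (80 * a * e) * (3 / (2 * (real n ^ (80 * a * e) * real n)))"
          using m n' num_pos[OF n'(3)] by (intro mult_mono s divide_left_mono) auto
        also have "\<dots> = 3 / 2 * (real A)\<^sup>2 * 2 ^ (80 * a * e) / real n" using n' by simp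
        finally show "(real (nsamp n))\<^sup>2 * (3 / (2 * real (num n))) \<le> 3 / 2 * (real A)\<^sup>2 * 2 ^ (80 * a * e) / real n" .
      qed auto
      also have "\<dots> = C / real n" by (simp only: C_def add_divide_distrib[symmetric] times_divide_eq_right)
      finally show ?thesis by simp
    qed
    have "(\<lambda>n. measure_pmf.prob (random_formula n K (num n)) {J. prob_random M coin_poly n J \<ge> 3 / 4}) \<longlonglongrightarrow> 1"
    proof (rule tendsto_sandwich)
      show "\<forall>\<^sub>F n in sequentially. 1 - C / real n \<le>
          measure_pmf.prob (random_formula n K (num n)) {J. prob_random M coin_poly n J \<ge> 3 / 4}"
        using bad eventually_sequentially by blast
      have "(\<lambda>n. 1 - C / real n) \<longlonglongrightarrow> 1 - 0"
        by (intro tendsto_diff tendsto_const lim_const_over_n)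
      then show "(\<lambda>n. 1 - C / real n) \<longlonglongrightarrow> 1" by simp
    qed auto
    with M(1) good show ?thesis unfolding CSP_XOR_easy_def by blast
  qed
  with assms K4 show False unfolding CSP_XOR_hard_def num_eq[symmetric] by blast
qed

end
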